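(* Let $J$ be a WOT-closed two-sided ideal of $F_n^\infty$ and let $B_1,\ldots,B_n$ be the corresponding constrained shifts acting on $\mathcal N_J$. Let $\lambda_1,\ldots,\lambda_k$ be $k$ distinct points in the zero set $$\mathcal Z_J:=\{\lambda\in\mathbb B_n:\ f(\lambda)=0\text{ for any }f\in J\},$$ and let $A_1,\ldots,A_k\in B(\mathcal K)$, where $\mathcal K$ is a Hilbert space. Then there exists $\Phi(B_1,\ldots,B_n)\in\mathcal W(B_1,\ldots,B_n)\bar\otimes B(\mathcal K)$ such that $$\|\Phi(B_1,\ldots,B_n)\|\le1\quad\text{and}\quad\Phi(\lambda_j)=A_j,\ j=1,\ldots,k,$$ if and only if the operator matrix $$\left[\frac{I_{\mathcal K}-A_iA_j^*}{1-\langle\lambda_i,\lambda_j\rangle}\right]_{k\times k}$$ is positive semidefinite.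
   Context: Let $n\in\{1,2,\dots\}$, let $\mathbb B_n$ be the open unit ball of $\mathbb C^n$, and let $F^2(H_n)=\bigoplus_{k\ge 0}H_n^{\otimes k}$ be the full Fock space of an $n$-dimensional complex Hilbert space $H_n$ with orthonormal basis $e_1,\dots,e_n$ (with $H_n^{\otimes 0}=\mathbb C1$). Left creation operators: $S_i\varphi=e_i\otimes\varphi$. $F_n^\infty\subset B(F^2(H_n))$ is the WOT-closed algebra generated by $S_1,\dots,S_n$ and the identity. Put $\mathcal N_J=F^2(H_n)\ominus\overline{JF^2(H_n)}$ and $B_i=P_{\mathcal N_J}S_i|_{\mathcal N_J}$. $\mathcal W(B_1,\dots,B_n)$ is the $w^*$-closed algebra generated by $B_1,\dots,B_n$ and $I$; $\mathcal W(B_1,\dots,B_n)\bar\otimes B(\mathcal K)$ is the WOT-closed operator space generated by the spatial tensor product, and it equals $P_{\mathcal N_J\otimes\mathcal K}[F_n^\infty\bar\otimes B(\mathcal K)]|_{\mathcal N_J\otimes\mathcal K}$. $\mathbb F_n^+$ is the unital free semigroup on $g_1,\dots,g_n$; for $\lambda=(\lambda^{(1)},\dots,\lambda^{(n)})\in\mathbb B_n$ and $\alpha=g_{i_1}\cdots g_{i_m}$, $\lambda_\alpha=\lambda^{(i_1)}\cdots\lambda^{(i_m)}$ (and $\lambda_{g_0}=1$ for the neutral element $g_0$), $e_\alpha=e_{i_1}\otimes\cdots\otimes e_{i_m}$, $e_{g_0}=1$. If $f\in F_n^\infty$ with $f(1)=\sum_\alpha a_\alpha e_\alpha$, then $f(\lambda)=\sum_\alpha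 a_\alpha\lambda_\alpha$. More generally, if $\Phi(S_1,\dots,S_n)\in F_n^\infty\bar\otimes B(\mathcal K)$ has Fourier expansion $\sum_\alpha S_\alpha\otimes\Phi_{(\alpha)}$ (i.e. $\Phi(S_1,\dots,S_n)(1\otimes h)=\sum_\alpha e_\alpha\otimes\Phi_{(\alpha)}h$), and $\Phi(B_1,\dots,B_n)$ is its compression to $\mathcal N_J\otimes\mathcal K$, then $\Phi(\lambda)=\sum_\alpha\lambda_\alpha\Phi_{(\alpha)}\in B(\mathcal K)$. For $\lambda\in\mathcal Z_J$ this depends only on $\Phi(B_1,\dots,B_n)$: the vector $z_\lambda=\sum_\alpha\overline{\lambda_\alpha}e_\alpha$ lies in $\mathcal N_J$ and $\Phi(B_1,\dots,B_n)^*(z_\lambda\otimes h)=z_\lambda\otimes\Phi(\lambda)^*h$ for $h\in\mathcal K$. *)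

theory Defs
  imports "HOL-Analysis.Analysis"
begin

section \<open>Complex Hilbert spaces\<close>

text \<open>The inner product is linear in the first argument. The underlying real Hilbert space
  (with real inner product \<open>Re \<langle>x, y\<rangle>\<close>) is part of the class, so that the norm, the topology
  and completeness are those of the library. No separability or dimension is assumed.\<close>

class chilbert = real_inner + complete_space +
  fixes scaleC :: "complex \<Rightarrow> 'a \<Rightarrow> 'a" (infixr \<open>*\<^sub>C\<close> 75)
    and cinner :: "'a \<Rightarrow> 'a \<Rightarrow> complex"
  assumes scaleC_add_right: "c *\<^sub>C (x + y) = c *\<^sub>C x + c *\<^sub>C y"
    and scaleC_add_left: "(c + d) *\<^sub>C x = c *\<^sub>C x + d *\<^sub>C x"
    and scaleC_scaleC: "c *\<^sub>C d *\<^sub>C x = (c * d) *\<^sub>C x"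
    and scaleR_scaleC: "r *\<^sub>R x = complex_of_real r *\<^sub>C x"
    and cinner_commute: "cinner x y = cnj (cinner y x)"
    and cinner_add_left: "cinner (x + y) z = cinner x z + cinner y z"
    and cinner_scaleC_left: "cinner (c *\<^sub>C x) y = c * cinner x y"
    and inner_eq_Re_cinner: "inner x y = Re (cinner x y)"
begin

subclass banach ..

end

instantiation complex :: chilbert
begin

definition scaleC_complex :: "complex \<Rightarrow> complex \<Rightarrow> complex"
  where "scaleC_complex c x = c * x"

definition cinner_complex :: "complex \<Rightarrow> complex \<Rightarrow> complex"
  where "cinner_complex x y = x * cnj y"

instance
  by standard
    (auto simp: scaleC_complex_def cinner_complex_def algebra_simps scaleR_conv_of_real
      inner_complex_def)

end

lemma norm_scaleC: "norm (c *\<^sub>C x) = cmod c * norm (x :: 'a::chilbert)"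
proof -
  have "cinner x (c *\<^sub>C x) = cnj c * cinner x x"
    by (metis cinner_commute cinner_scaleC_left complex_cnj_mult)
  then have eq: "cinner (c *\<^sub>C x) (c *\<^sub>C x) = complex_of_real ((cmod c)\<^sup>2) * cinner x x"
    by (simp add: cinner_scaleC_left mult.assoc [symmetric] complex_norm_square
        del: of_real_power)
  have "(norm (c *\<^sub>C x))\<^sup>2 = (cmod c * norm x)\<^sup>2"
    by (simp only: power2_norm_eq_inner inner_eq_Re_cinner eq power_mult_distrib) simp
  then show ?thesis
    by (simp add: power2_eq_iff_nonneg)
qed

lemma cmod_cinner_le: "cmod (cinner x y) \<le> norm x * norm (y :: 'a::chilbert)"
proof (cases "cinner x y = 0")
  case False
  define c where "c = cnj (sgn (cinner x y))"
  have "complex_of_real (cmod (cinner x y)) = c * cinner x y"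
    using False unfolding c_def sgn_div_norm
    by (simp add: scaleR_conv_of_real field_simps complex_norm_square [symmetric] power2_eq_square
        mult.commute)
  then have "cmod (cinner x y) = inner (c *\<^sub>C x) y"
    by (metis Re_complex_of_real cinner_scaleC_left inner_eq_Re_cinner)
  also have "\<dots> \<le> norm (c *\<^sub>C x) * norm y"
    by (rule norm_cauchy_schwarz)
  also have "norm (c *\<^sub>C x) = norm x"
    using False by (simp add: c_def norm_scaleC norm_sgn)
  finally show ?thesis .
qed simp


section \<open>The Hilbert space of square-summable families\<close>

definition sq_summable :: "('i \<Rightarrow> 'k::real_normed_vector) \<Rightarrow> bool"
  where "sq_summable f \<longleftrightarrow> (\<lambda>i. (norm (f i))\<^sup>2) summable_on UNIV"

lemma sq_summable_zero: "sq_summable (\<lambda>_. 0)"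
  by (simp add: sq_summable_def)

lemma sq_summable_add:
  assumes "sq_summable f" "sq_summable g" shows "sq_summable (\<lambda>i. f i + g i)"
  unfolding sq_summable_def
proof (rule summable_on_comparison_test)
  show "(\<lambda>i. 2 * (norm (f i))\<^sup>2 + 2 * (norm (g i))\<^sup>2) summable_on UNIV"
    using assms unfolding sq_summable_def
    by (intro summable_on_add summable_on_cmult_right)
  show "(norm (f i + g i))\<^sup>2 \<le> 2 * (norm (f i))\<^sup>2 + 2 * (norm (g i))\<^sup>2" for i
  proof -
    have "(norm (f i + g i))\<^sup>2 \<le> (norm (f i) + norm (g i))\<^sup>2"
      by (intro power_mono norm_triangle_ineq) auto
    also have "\<dots> \<le> 2 * (norm (f i))\<^sup>2 + 2 * (norm (g i))\<^sup>2"
      using sum_squares_bound [of "norm (f i)" "norm (g i)"] by (simp add: power2_sum)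
    finally show ?thesis .
  qed
qed auto

lemma sq_summable_bound:
  assumes "sq_summable f" "\<And>i. norm (g i) \<le> c * norm (f i)" shows "sq_summable g"
  unfolding sq_summable_def
proof (rule summable_on_comparison_test)
  show "(\<lambda>i. c\<^sup>2 * (norm (f i))\<^sup>2) summable_on UNIV"
    using assms(1) unfolding sq_summable_def by (intro summable_on_cmult_right)
  show "(norm (g i))\<^sup>2 \<le> c\<^sup>2 * (norm (f i))\<^sup>2" for i
    using power_mono [OF assms(2), of i 2] by (simp add: power_mult_distrib)
qed auto

lemma sq_summable_minus:
  assumes "sq_summable f" "sq_summable g" shows "sq_summable (\<lambda>i. f i - g i)"
  using sq_summable_add [OF assms(1) sq_summable_bound [OF assms(2), of "\<lambda>i. - g i" 1]] by simp

lemma sq_summable_mult_bound: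
  assumes "sq_summable f" "sq_summable g" "\<And>i. norm (h i) \<le> norm (f i) * norm (g i)"
  shows "(\<lambda>i. norm (h i)) summable_on UNIV"
proof (rule summable_on_comparison_test)
  show "(\<lambda>i. (norm (f i))\<^sup>2 + (norm (g i))\<^sup>2) summable_on UNIV"
    using assms(1,2) unfolding sq_summable_def by (intro summable_on_add)
  show "norm (h i) \<le> (norm (f i))\<^sup>2 + (norm (g i))\<^sup>2" for i
  proof -
    have "2 * (norm (f i) * norm (g i)) \<le> (norm (f i))\<^sup>2 + (norm (g i))\<^sup>2"
      using sum_squares_bound [of "norm (f i)" "norm (g i)"] by simp
    moreover have "0 \<le> norm (f i) * norm (g i)"
      by simp
    ultimately show ?thesis
      using assms(3) [of i] by linarith
  qed
qed auto

typedef (overloaded) ('i, 'k::chilbert) ell2 = "{f :: 'i \<Rightarrow> 'k. sq_summable f}"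
  morphisms coord Abs_ell2
  using sq_summable_zero by blast

setup_lifting type_definition_ell2

lemma sq_summable_coord: "sq_summable (coord x)"
  using coord by blast

lemma summable_on_inner_coord: "(\<lambda>i. inner (coord x i) (coord y i)) summable_on UNIV"
  by (rule abs_summable_summable, rule sq_summable_mult_bound [OF sq_summable_coord [of x] sq_summable_coord [of y]])
    (simp add: Cauchy_Schwarz_ineq2)

lemma summable_on_cinner_coord: "(\<lambda>i. cinner (coord x i) (coord y i)) summable_on UNIV"
  by (rule abs_summable_summable, rule sq_summable_mult_bound [OF sq_summable_coord [of x] sq_summable_coord [of y]])
    (simp add: cmod_cinner_le)

instantiation ell2 :: (type, chilbert) real_inner
begin

lift_definition zero_ell2 :: "('a, 'b) ell2" is "\<lambda>_. 0"
  by (rule sq_summable_zero)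

lift_definition plus_ell2 :: "('a, 'b) ell2 \<Rightarrow> ('a, 'b) ell2 \<Rightarrow> ('a, 'b) ell2"
  is "\<lambda>f g i. f i + g i"
  by (rule sq_summable_add)

lift_definition minus_ell2 :: "('a, 'b) ell2 \<Rightarrow> ('a, 'b) ell2 \<Rightarrow> ('a, 'b) ell2"
  is "\<lambda>f g i. f i - g i"
  by (rule sq_summable_minus)

lift_definition uminus_ell2 :: "('a, 'b) ell2 \<Rightarrow> ('a, 'b) ell2" is "\<lambda>f i. - f i"
  by (erule sq_summable_bound [where c = 1]) simp

lift_definition scaleR_ell2 :: "real \<Rightarrow> ('a, 'b) ell2 \<Rightarrow> ('a, 'b) ell2" is "\<lambda>r f i. r *\<^sub>R f i"
  subgoal for r by (erule sq_summable_bound [where c = "\<bar>r\<bar>"]) simp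
  done

definition inner_ell2 :: "('a, 'b) ell2 \<Rightarrow> ('a, 'b) ell2 \<Rightarrow> real"
  where "inner_ell2 x y = (\<Sum>\<^sub>\<infinity>i. inner (coord x i) (coord y i))"

definition norm_ell2 :: "('a, 'b) ell2 \<Rightarrow> real"
  where "norm_ell2 x = sqrt (inner x x)"

definition dist_ell2 :: "('a, 'b) ell2 \<Rightarrow> ('a, 'b) ell2 \<Rightarrow> real"
  where "dist_ell2 x y = norm (x - y)"

definition sgn_ell2 :: "('a, 'b) ell2 \<Rightarrow> ('a, 'b) ell2"
  where "sgn_ell2 x = inverse (norm x) *\<^sub>R x"

definition uniformity_ell2 :: "(('a, 'b) ell2 \<times> ('a, 'b) ell2) filter"
  where "uniformity_ell2 = (INF e\<in>{0<..}. principal {(x, y). dist x y < e})"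

definition open_ell2 :: "('a, 'b) ell2 set \<Rightarrow> bool"
  where "open_ell2 U \<longleftrightarrow> (\<forall>x\<in>U. \<forall>\<^sub>F (x', y) in uniformity. x' = x \<longrightarrow> y \<in> U)"

instance
proof
  fix x y z :: "('a, 'b) ell2" and r s :: real
  show "x + y + z = x + (y + z)" "x + y = y + x" "0 + x = x" "- x + x = 0" "x - y = x + - y"
    "r *\<^sub>R (x + y) = r *\<^sub>R x + r *\<^sub>R y" "(r + s) *\<^sub>R x = r *\<^sub>R x + s *\<^sub>R x"
    "r *\<^sub>R s *\<^sub>R x = (r * s) *\<^sub>R x" "1 *\<^sub>R x = x"
    by (transfer, simp add: algebra_simps)+
  show "sgn x = inverse (norm x) *\<^sub>R x" "dist x y = norm (x - y)" "norm x = sqrt (inner x x)"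
    by (simp_all only: sgn_ell2_def dist_ell2_def norm_ell2_def)
  show "uniformity = (INF e\<in>{0<..}. principal {(x, y). dist (x :: ('a, 'b) ell2) y < e})"
    by (rule uniformity_ell2_def)
  show "open U \<longleftrightarrow> (\<forall>x\<in>U. \<forall>\<^sub>F (x', y) in uniformity. x' = x \<longrightarrow> y \<in> U)"
    for U :: "('a, 'b) ell2 set"
    by (rule open_ell2_def)
  show "inner x y = inner y x"
    by (simp add: inner_ell2_def inner_commute)
  show "inner (x + y) z = inner x z + inner y z"
    by (simp add: inner_ell2_def plus_ell2.rep_eq inner_add_left infsum_add
        summable_on_inner_coord)
  show "inner (r *\<^sub>R x) y = r * inner x y"
    by (simp add: inner_ell2_def scaleR_ell2.rep_eq infsum_cmult_right')
  show "0 \<le> inner x x"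
    by (simp add: inner_ell2_def infsum_nonneg)
  show "inner x x = 0 \<longleftrightarrow> x = 0"
  proof
    assume "inner x x = 0"
    then have "inner (coord x i) (coord x i) = 0" for i
      unfolding inner_ell2_def
      by (intro nonneg_infsum_le_0D [where A = UNIV and f = "\<lambda>i. inner (coord x i) (coord x i)"])
        (simp_all add: summable_on_inner_coord)
    then show "x = 0"
      by (simp add: coord_inject [symmetric] zero_ell2.rep_eq fun_eq_iff)
  qed (simp add: inner_ell2_def zero_ell2.rep_eq)
qed

end

lemma norm_ell2_sq: "(norm x)\<^sup>2 = (\<Sum>\<^sub>\<infinity>i. (norm (coord x i))\<^sup>2)"
  by (simp add: power2_norm_eq_inner inner_ell2_def)

lemma sum_norm_coord_le: "finite F \<Longrightarrow> (\<Sum>i\<in>F. (norm (coord x i))\<^sup>2) \<le> (norm x)\<^sup>2"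
  unfolding norm_ell2_sq
  by (rule finite_sum_le_infsum) (use sq_summable_coord sq_summable_def in auto)

lemma norm_coord_le: "norm (coord x i) \<le> norm x"
  using sum_norm_coord_le [of "{i}" x] by (simp add: abs_le_square_iff [symmetric])

instance ell2 :: (type, chilbert) complete_space
proof
  fix X :: "nat \<Rightarrow> ('a, 'b) ell2"
  assume X: "Cauchy X"
  have "Cauchy (\<lambda>n. coord (X n) i)" for i
  proof (rule CauchyI)
    fix e :: real
    assume "0 < e"
    then obtain N where N: "\<And>m n. m \<ge> N \<Longrightarrow> n \<ge> N \<Longrightarrow> norm (X m - X n) < e"
      using X CauchyD by blast
    show "\<exists>M. \<forall>m\<ge>M. \<forall>n\<ge>M. norm (coord (X m) i - coord (X n) i) < e"
    proof (intro exI allI impI)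
      fix m n assume "m \<ge> N" "n \<ge> N"
      then show "norm (coord (X m) i - coord (X n) i) < e"
        using N [of m n] norm_coord_le [of "X m - X n" i] by (simp add: minus_ell2.rep_eq)
    qed
  qed
  then have "\<exists>l. (\<lambda>n. coord (X n) i) \<longlonglongrightarrow> l" for i
    by (simp add: Cauchy_convergent_iff convergent_def)
  then obtain l where l: "\<And>i. (\<lambda>n. coord (X n) i) \<longlonglongrightarrow> l i"
    by metis
  have *: "\<exists>N. \<forall>m\<ge>N. \<forall>F. finite F \<longrightarrow> (\<Sum>i\<in>F. (norm (coord (X m) i - l i))\<^sup>2) \<le> e\<^sup>2"
    if "0 < e" for e
  proof -
    obtain N where N: "\<And>m n. m \<ge> N \<Longrightarrow> n \<ge> N \<Longrightarrow> norm (X m - X n) < e"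
      using X CauchyD \<open>0 < e\<close> by blast
    have "(\<Sum>i\<in>F. (norm (coord (X m) i - l i))\<^sup>2) \<le> e\<^sup>2" if "m \<ge> N" "finite F" for m F
    proof (rule LIMSEQ_le_const2)
      show "(\<lambda>n. \<Sum>i\<in>F. (norm (coord (X m) i - coord (X n) i))\<^sup>2)
          \<longlonglongrightarrow> (\<Sum>i\<in>F. (norm (coord (X m) i - l i))\<^sup>2)"
        by (intro tendsto_intros l)
      have "(\<Sum>i\<in>F. (norm (coord (X m) i - coord (X n) i))\<^sup>2) \<le> e\<^sup>2" if "n \<ge> N" for n
      proof -
        have "(\<Sum>i\<in>F. (norm (coord (X m) i - coord (X n) i))\<^sup>2) \<le> (norm (X m - X n))\<^sup>2"
          using sum_norm_coord_le [OF \<open>finite F\<close>, of "X m - X n"] by (simp add: minus_ell2.rep_eq)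
        also have "\<dots> \<le> e\<^sup>2"
          using N [OF \<open>m \<ge> N\<close> that] by (intro power_mono) auto
        finally show ?thesis .
      qed
      then show "\<exists>N. \<forall>n\<ge>N. (\<Sum>i\<in>F. (norm (coord (X m) i - coord (X n) i))\<^sup>2) \<le> e\<^sup>2"
        by blast
    qed
    then show ?thesis
      by blast
  qed
  have sq: "sq_summable (\<lambda>i. coord (X m) i - l i)"
    if "\<And>F. finite F \<Longrightarrow> (\<Sum>i\<in>F. (norm (coord (X m) i - l i))\<^sup>2) \<le> e\<^sup>2" for m e
    unfolding sq_summable_def using that
    by (intro nonneg_bdd_above_summable_on bdd_aboveI2 [where M = "e\<^sup>2"]) auto
  obtain N1 where N1: "\<And>F. finite F \<Longrightarrow> (\<Sum>i\<in>F. (norm (coord (X N1) i - l i))\<^sup>2) \<le> 1\<^sup>2"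
    using * [of 1] by auto
  have "sq_summable l"
    using sq_summable_minus [OF sq_summable_coord [of "X N1"] sq [OF N1]] by simp
  then have cl: "coord (Abs_ell2 l) = l"
    by (simp add: Abs_ell2_inverse)
  have "X \<longlonglongrightarrow> Abs_ell2 l"
  proof (rule LIMSEQ_I)
    fix r :: real
    assume "0 < r"
    then obtain N where N: "\<And>m F. m \<ge> N \<Longrightarrow> finite F \<Longrightarrow>
        (\<Sum>i\<in>F. (norm (coord (X m) i - l i))\<^sup>2) \<le> (r / 2)\<^sup>2"
      using * [of "r / 2"] by auto
    have "norm (X m - Abs_ell2 l) < r" if "m \<ge> N" for m
    proof -
      have "(norm (X m - Abs_ell2 l))\<^sup>2 \<le> (r / 2)\<^sup>2"
        unfolding norm_ell2_sq
        by (rule infsum_le_finite_sums)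
          (use N [OF that] sq_summable_coord [of "X m - Abs_ell2 l"] in
            \<open>auto simp: minus_ell2.rep_eq cl sq_summable_def\<close>)
      then have "norm (X m - Abs_ell2 l) \<le> r / 2"
        using \<open>0 < r\<close> by (simp add: power2_le_iff_abs_le)
      then show ?thesis
        using \<open>0 < r\<close> by linarith
    qed
    then show "\<exists>no. \<forall>n\<ge>no. norm (X n - Abs_ell2 l) < r"
      by blast
  qed
  then show "convergent X"
    by (auto simp: convergent_def)
qed

instantiation ell2 :: (type, chilbert) chilbert
begin

lift_definition scaleC_ell2 :: "complex \<Rightarrow> ('a, 'b) ell2 \<Rightarrow> ('a, 'b) ell2"
  is "\<lambda>c f i. c *\<^sub>C f i"
  subgoal for c by (erule sq_summable_bound [where c = "cmod c"]) (simp add: norm_scaleC)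
  done

definition cinner_ell2 :: "('a, 'b) ell2 \<Rightarrow> ('a, 'b) ell2 \<Rightarrow> complex"
  where "cinner_ell2 x y = (\<Sum>\<^sub>\<infinity>i. cinner (coord x i) (coord y i))"

instance
proof
  fix x y z :: "('a, 'b) ell2" and c d :: complex and r :: real
  show "c *\<^sub>C (x + y) = c *\<^sub>C x + c *\<^sub>C y" "(c + d) *\<^sub>C x = c *\<^sub>C x + d *\<^sub>C x"
    "c *\<^sub>C d *\<^sub>C x = (c * d) *\<^sub>C x" "r *\<^sub>R x = complex_of_real r *\<^sub>C x"
    by (transfer, simp add: scaleC_add_right scaleC_add_left scaleC_scaleC scaleR_scaleC)+
  show "cinner x y = cnj (cinner y x)"
    unfolding cinner_ell2_def by (subst cinner_commute) (simp flip: infsum_cnj)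
  show "cinner (x + y) z = cinner x z + cinner y z"
    by (simp add: cinner_ell2_def plus_ell2.rep_eq cinner_add_left infsum_add
        summable_on_cinner_coord)
  show "cinner (c *\<^sub>C x) y = c * cinner x y"
    by (simp add: cinner_ell2_def scaleC_ell2.rep_eq cinner_scaleC_left infsum_cmult_right')
  show "inner x y = Re (cinner x y)"
    by (simp add: cinner_ell2_def inner_ell2_def inner_eq_Re_cinner infsum_Re
        summable_on_cinner_coord)
qed

end


section \<open>Operators, subspaces and operator topologies\<close>

definition bounded_clinear :: "('a::chilbert \<Rightarrow> 'b::chilbert) \<Rightarrow> bool"
  where "bounded_clinear T \<longleftrightarrow> bounded_linear T \<and> (\<forall>c x. T (c *\<^sub>C x) = c *\<^sub>C T x)"

definition cadjoint :: "('a::chilbert \<Rightarrow> 'b::chilbert) \<Rightarrow> 'b \<Rightarrow> 'a"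
  where "cadjoint T = (THE S. \<forall>x y. cinner (T x) y = cinner x (S y))"

definition csubspace :: "'a::chilbert set \<Rightarrow> bool"
  where "csubspace M \<longleftrightarrow>
    0 \<in> M \<and> (\<forall>x\<in>M. \<forall>y\<in>M. x + y \<in> M) \<and> (\<forall>c. \<forall>x\<in>M. c *\<^sub>C x \<in> M)"

definition cspan :: "'a::chilbert set \<Rightarrow> 'a set"
  where "cspan S = csubspace hull S"

definition ocompl :: "'a::chilbert set \<Rightarrow> 'a set"
  where "ocompl M = {x. \<forall>y\<in>M. cinner x y = 0}"

text \<open>Orthogonal projection; intended for closed subspaces, where the vector described exists.\<close>

definition proj :: "'a::chilbert set \<Rightarrow> 'a \<Rightarrow> 'a"
  where "proj M x = (THE p. p \<in> M \<and> x - p \<in> ocompl M)"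

text \<open>An operator on a closed subspace \<open>M\<close> of \<open>H\<close> is represented by its extension to \<open>H\<close> that
  vanishes on the orthogonal complement of \<open>M\<close>. This identifies \<open>B(M)\<close> with \<open>P B(H) P\<close>,
  \<open>P = proj M\<close>, as algebras, isometrically and homeomorphically for the WOT and the weak-star
  topology; the identity operator of \<open>M\<close> becomes \<open>P\<close>, and since \<open>P B(H) P\<close> is WOT closed, closures
  taken in \<open>B(H)\<close> agree with closures taken in \<open>B(M)\<close>. The compression of \<open>T\<close> to \<open>M\<close> is thus
  \<open>P T P\<close>.\<close>

definition compression :: "'a::chilbert set \<Rightarrow> ('a \<Rightarrow> 'a) \<Rightarrow> 'a \<Rightarrow> 'a"
  where "compression M T = proj M \<circ> T \<circ> proj M"

definition wot :: "('a::chilbert \<Rightarrow> 'a) topology"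
  where "wot = topology_generated_by
    {{T. bounded_clinear T \<and> cinner (T x) y \<in> U} | x y U. open U}"

text \<open>The weak-star topology of \<open>B(H)\<close> as the dual of the trace class operators: it is generated by
  the functionals \<open>T \<mapsto> \<Sum>i. \<langle>T (x i), y i\<rangle>\<close> with square-summable \<open>x\<close> and \<open>y\<close>.\<close>

definition weak_star :: "('a::chilbert \<Rightarrow> 'a) topology"
  where "weak_star = topology_generated_by
    {{T. bounded_clinear T \<and> (\<Sum>i. cinner (T (x i)) (y i)) \<in> U} | (x :: nat \<Rightarrow> 'a) y U.
      sq_summable x \<and> sq_summable y \<and> open U}"

definition operator_space :: "('a::chilbert \<Rightarrow> 'a) set \<Rightarrow> bool"
  where "operator_space \<A> \<longleftrightarrow> (\<forall>T\<in>\<A>. bounded_clinear T) \<and> (\<lambda>_. 0) \<in> \<A> \<and>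
    (\<forall>S\<in>\<A>. \<forall>T\<in>\<A>. (\<lambda>x. S x + T x) \<in> \<A>) \<and> (\<forall>c. \<forall>T\<in>\<A>. (\<lambda>x. c *\<^sub>C T x) \<in> \<A>)"

definition operator_algebra :: "('a::chilbert \<Rightarrow> 'a) set \<Rightarrow> bool"
  where "operator_algebra \<A> \<longleftrightarrow> operator_space \<A> \<and> (\<forall>S\<in>\<A>. \<forall>T\<in>\<A>. S \<circ> T \<in> \<A>)"

definition two_sided_ideal :: "('a::chilbert \<Rightarrow> 'a) set \<Rightarrow> ('a \<Rightarrow> 'a) set \<Rightarrow> bool"
  where "two_sided_ideal J \<A> \<longleftrightarrow> J \<subseteq> \<A> \<and> operator_space J \<and>
    (\<forall>T\<in>J. \<forall>S\<in>\<A>. S \<circ> T \<in> J \<and> T \<circ> S \<in> J)"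

text \<open>Positivity of the operator matrix \<open>[M i j]\<close> acting on the direct sum of copies of the Hilbert
  space indexed by the finite set \<open>I\<close>.\<close>

definition positive_operator_matrix :: "'i set \<Rightarrow> ('i \<Rightarrow> 'i \<Rightarrow> 'a::chilbert \<Rightarrow> 'a) \<Rightarrow> bool"
  where "positive_operator_matrix I M \<longleftrightarrow>
    (\<forall>h. let q = \<Sum>i\<in>I. cinner (\<Sum>j\<in>I. M i j (h j)) (h i) in q \<in> \<real> \<and> 0 \<le> Re q)"


section \<open>The full Fock space\<close>

text \<open>The words over \<open>'n\<close> are the free semigroup on \<open>CARD('n)\<close> generators, and the full Fock space
  of \<open>H\<^sub>n\<close> is written in its orthonormal basis \<open>e\<^sub>\<alpha>\<close>. In the same way \<open>('n, 'k) fock\<close> is the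
  Hilbert space tensor product of the Fock space with \<open>'k\<close>: the family \<open>h\<close> stands for
  \<open>\<Sum>\<alpha>. e\<^sub>\<alpha> \<otimes> h \<alpha>\<close>.\<close>

type_synonym ('n, 'k) fock = "('n list, 'k) ell2"

lift_definition basis_vec :: "'i \<Rightarrow> ('i, complex) ell2" is "\<lambda>i j. if j = i then 1 else 0"
  subgoal for i
    unfolding sq_summable_def
    by (rule summable_on_cong_neutral [where S = "{i}", THEN iffD1, where f1 = "\<lambda>_. 1"]) auto
  done

lift_definition simple_tensor :: "('i, complex) ell2 \<Rightarrow> 'k \<Rightarrow> ('i, 'k::chilbert) ell2" (infixr \<open>\<otimes>\<^sub>v\<close> 70)
  is "\<lambda>f h i. f i *\<^sub>C h"
  subgoal for f h
    by (erule sq_summable_bound [where c = "norm h"]) (simp add: norm_scaleC mult.commute)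
  done

lift_definition creation :: "'n \<Rightarrow> ('n, complex) fock \<Rightarrow> ('n, complex) fock"
  is "\<lambda>i f w. case w of [] \<Rightarrow> 0 | j # v \<Rightarrow> if j = i then f v else 0"
  subgoal for i f
  proof -
    let ?g = "\<lambda>w. case w of [] \<Rightarrow> 0 | j # v \<Rightarrow> if j = i then f v else 0"
    assume "sq_summable f"
    then have "(\<lambda>w. (norm (?g w))\<^sup>2) summable_on range ((#) i)"
      by (subst summable_on_reindex) (auto simp: sq_summable_def o_def)
    then show "sq_summable ?g"
      unfolding sq_summable_def
      by (rule summable_on_cong_neutral [THEN iffD1, rotated 3]) (auto split: list.splits)
  qed
  done

definition fock_algebra :: "(('n::finite, complex) fock \<Rightarrow> ('n, complex) fock) set"
  where "fock_algebra =
    (\<lambda>\<A>. operator_algebra \<A> \<and> closedin wot \<A>) hull insert id (range creation)"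

text \<open>The WOT-closed operator space generated by the spatial tensor product of an operator space
  with \<open>B('k)\<close>; an operator on the tensor product is \<open>f \<otimes> X\<close> iff it is so on simple tensors.\<close>

definition tensor_BK ::
    "(('i, complex) ell2 \<Rightarrow> ('i, complex) ell2) set \<Rightarrow> (('i, 'k::chilbert) ell2 \<Rightarrow> ('i, 'k) ell2) set"
  where "tensor_BK \<A> = (\<lambda>\<B>. operator_space \<B> \<and> closedin wot \<B>) hull
    {T. bounded_clinear T \<and>
      (\<exists>f\<in>\<A>. \<exists>X. bounded_clinear X \<and> (\<forall>g h. T (g \<otimes>\<^sub>v h) = f g \<otimes>\<^sub>v X h))}"

definition tensor_subspace :: "('i, complex) ell2 set \<Rightarrow> ('i, 'k::chilbert) ell2 set"
  where "tensor_subspace N = closure (cspan {g \<otimes>\<^sub>v h | g h. g \<in> N})"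

definition word_eval :: "complex ^ 'n \<Rightarrow> 'n list \<Rightarrow> complex"
  where "word_eval z \<alpha> = prod_list (map (\<lambda>i. z $ i) \<alpha>)"

definition scalar_eval :: "(('n, complex) fock \<Rightarrow> ('n, complex) fock) \<Rightarrow> complex ^ 'n \<Rightarrow> complex"
  where "scalar_eval f z = (\<Sum>\<^sub>\<infinity>\<alpha>. coord (f (basis_vec [])) \<alpha> * word_eval z \<alpha>)"

definition fourier_coeff ::
    "(('n, 'k::chilbert) fock \<Rightarrow> ('n, 'k) fock) \<Rightarrow> 'n list \<Rightarrow> 'k \<Rightarrow> 'k"
  where "fourier_coeff \<Phi> \<alpha> h = coord (\<Phi> (basis_vec [] \<otimes>\<^sub>v h)) \<alpha>"

text \<open>Evaluation is defined on the symbol \<open>\<Phi>(S\<^sub>1, \<dots>, S\<^sub>n)\<close>. At points of the zero set of \<open>J\<close> it depends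
  only on the compression \<open>\<Phi>(B\<^sub>1, \<dots>, B\<^sub>n)\<close>.\<close>

definition operator_eval ::
    "(('n, 'k::chilbert) fock \<Rightarrow> ('n, 'k) fock) \<Rightarrow> complex ^ 'n \<Rightarrow> 'k \<Rightarrow> 'k"
  where "operator_eval \<Phi> z h = (\<Sum>\<^sub>\<infinity>\<alpha>. word_eval z \<alpha> *\<^sub>C fourier_coeff \<Phi> \<alpha> h)"


section \<open>Constrained shifts\<close>

definition N_space :: "(('n, complex) fock \<Rightarrow> ('n, complex) fock) set \<Rightarrow> ('n, complex) fock set"
  where "N_space J = ocompl (closure (cspan {f \<phi> | f \<phi>. f \<in> J}))"

definition constrained_shift ::
    "(('n, complex) fock \<Rightarrow> ('n, complex) fock) set \<Rightarrow> 'n \<Rightarrow> ('n, complex) fock \<Rightarrow> ('n, complex) fock"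
  where "constrained_shift J i = compression (N_space J) (creation i)"

text \<open>Here \<open>proj (N_space J)\<close> is the identity of the constrained space.\<close>

definition constrained_algebra ::
    "(('n::finite, complex) fock \<Rightarrow> ('n, complex) fock) set \<Rightarrow> (('n, complex) fock \<Rightarrow> ('n, complex) fock) set"
  where "constrained_algebra J = (\<lambda>\<A>. operator_algebra \<A> \<and> closedin weak_star \<A>) hull
    insert (proj (N_space J)) (range (constrained_shift J))"

definition zero_set :: "(('n::finite, complex) fock \<Rightarrow> ('n, complex) fock) set \<Rightarrow> (complex ^ 'n) set"
  where "zero_set J = {z. norm z < 1 \<and> (\<forall>f\<in>J. scalar_eval f z = 0)}"

definition cvec_inner :: "complex ^ 'n \<Rightarrow> complex ^ 'n \<Rightarrow> complex"
  where "cvec_inner z w = (\<Sum>i\<in>UNIV. z $ i * cnj (w $ i))"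

end

theory Submission
  imports Defs
begin

text \<open>Necessity: every \<open>\<Phi>\<close> satisfies \<open>\<Phi>\<^sup>* (z\<^sub>\<lambda> \<otimes> h) = z\<^sub>\<lambda> \<otimes> \<Phi>(\<lambda>)\<^sup>* h\<close>, and \<open>z\<^sub>\<lambda> \<otimes> h\<close> lies in the
  constrained space, so the contractivity of the compression, tested on \<open>\<Sum>\<^sub>j z\<^sub>\<lambda>\<^sub>j \<otimes> h\<^sub>j\<close>, is the positivity
  of the Pick matrix.

  Sufficiency: factor the Pick matrix as \<open>\<langle>R g, R g'\<rangle>\<close>. Moving the denominators
  to the other side turns this into an isometry (the lurking isometry), whose adjoint extends to a
  contraction \<open>U : H \<times> K \<rightarrow> H\<^sup>n \<times> K\<close>. Read as a linear system whose state branches along the words,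
  \<open>(x(l v))\<^sub>l, y(v) = U (x(v), u(v))\<close> with \<open>x([]) = 0\<close>, the map \<open>u \<mapsto> y\<close> is the required contraction \<open>\<Phi>\<close> on the
  whole Fock space: energy does not increase along the system, and the
  adjoint relation for \<open>U\<close> gives \<open>\<Phi>(\<lambda>\<^sub>j) = A\<^sub>j\<close>. Damping the state by \<open>r < 1\<close> and truncating the memory
  exhibits \<open>\<Phi>\<close> as a WOT limit of sums of operators \<open>S\<^sub>\<alpha> \<otimes> X\<close>.\<close>

section \<open>Complex Hilbert spaces\<close>

text \<open>The Pick matrix depends only on the points and the operators, so the problem is solved
  on the full Fock space and compressed afterwards. The matrix contains the products of A_i with the
  adjoint of A_j; what it controls are therefore adjoints, and this is why the isometry is built
  from the adjoint data and conjugate coordinates and \<open>U\<close> is the adjoint of its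
  extension. The target spaces are hulls, that is intersections, with no description of their
  elements. Membership is therefore proved in an arbitrary WOT-closed operator space that contains
  all S_\<alpha> \<otimes> X. The obstacle is that a contraction may keep energy in the state
  forever: the bound on the truncated systems is uniform only when the state map is a strict
  contraction. Hence there are two limits, the memory first at fixed r and then r to 1.\<close>

lemma scaleC_one [simp]: "1 *\<^sub>C x = (x :: 'a::chilbert)"
  by (metis scaleR_scaleC scaleR_one of_real_1)

lemma scaleC_zero_left [simp]: "0 *\<^sub>C x = (0 :: 'a::chilbert)"
  by (metis scaleR_scaleC scaleR_zero_left of_real_0)

lemma scaleC_zero_right [simp]: "c *\<^sub>C (0 :: 'a::chilbert) = 0"
  using scaleC_add_right [of c 0 "0 :: 'a"] by simp

lemma scaleC_minus_right: "c *\<^sub>C (- x) = - (c *\<^sub>C (x :: 'a::chilbert))"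
  using scaleC_add_right [of c x "- x"] by (simp add: add_eq_0_iff)

lemma scaleC_diff_right: "c *\<^sub>C (x - y) = c *\<^sub>C x - c *\<^sub>C (y :: 'a::chilbert)"
  using scaleC_add_right [of c x "- y"] by (simp add: scaleC_minus_right)

lemma scaleC_sum_right: "c *\<^sub>C (\<Sum>i\<in>I. f i) = (\<Sum>i\<in>I. c *\<^sub>C (f i :: 'a::chilbert))"
  by (induction I rule: infinite_finite_induct) (auto simp: scaleC_add_right)

lemma cinner_add_right: "cinner x (y + z) = cinner x y + cinner x (z :: 'a::chilbert)"
  by (metis cinner_add_left cinner_commute complex_cnj_add)

lemma cinner_scaleC_right: "cinner x (c *\<^sub>C y) = cnj c * cinner x (y :: 'a::chilbert)"
  by (metis cinner_scaleC_left cinner_commute complex_cnj_mult)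

lemma cinner_scaleR_left: "cinner (r *\<^sub>R x) y = of_real r * cinner x (y :: 'a::chilbert)"
  by (simp add: scaleR_scaleC cinner_scaleC_left)

lemma cinner_scaleR_right: "cinner x (r *\<^sub>R y) = of_real r * cinner x (y :: 'a::chilbert)"
  by (simp add: scaleR_scaleC cinner_scaleC_right)

lemma cinner_zero_left [simp]: "cinner 0 (x :: 'a::chilbert) = 0"
  using cinner_scaleC_left [of 0 0 x] by simp

lemma cinner_zero_right [simp]: "cinner (x :: 'a::chilbert) 0 = 0"
  using cinner_scaleC_right [of x 0 0] by simp

lemma cinner_minus_left: "cinner (- x) y = - cinner x (y :: 'a::chilbert)"
  using cinner_add_left [of x "- x" y] by (simp add: add_eq_0_iff)

lemma cinner_minus_right: "cinner x (- y) = - cinner x (y :: 'a::chilbert)"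
  using cinner_add_right [of x y "- y"] by (simp add: add_eq_0_iff)

lemma cinner_diff_left: "cinner (x - y) z = cinner x z - cinner y (z :: 'a::chilbert)"
  using cinner_add_left [of x "- y" z] by (simp add: cinner_minus_left)

lemma cinner_diff_right: "cinner x (y - z) = cinner x y - cinner x (z :: 'a::chilbert)"
  using cinner_add_right [of x y "- z"] by (simp add: cinner_minus_right)

lemma cinner_sum_left: "cinner (\<Sum>i\<in>I. f i) y = (\<Sum>i\<in>I. cinner (f i) (y :: 'a::chilbert))"
  by (induction I rule: infinite_finite_induct) (auto simp: cinner_add_left)

lemma cinner_sum_right: "cinner x (\<Sum>i\<in>I. f i) = (\<Sum>i\<in>I. cinner x (f i :: 'a::chilbert))"
  by (induction I rule: infinite_finite_induct) (auto simp: cinner_add_right)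

lemma cinner_self: "cinner x x = complex_of_real ((norm (x :: 'a::chilbert))\<^sup>2)"
proof -
  have "cinner x x = cnj (cinner x x)"
    by (rule cinner_commute)
  then have "Im (cinner x x) = 0"
    by (metis Reals_cnj_iff complex_is_Real_iff)
  then show ?thesis
    by (simp add: complex_eq_iff power2_norm_eq_inner inner_eq_Re_cinner)
qed

text \<open>The imaginary part is the real inner product against \<open>\<i> *\<^sub>C y\<close>, by
  antilinearity in the second argument. Real Riesz arguments thus become complex by testing with the
  i-multiple as well.\<close>

lemma cinner_eq_inner:
  "cinner x (y :: 'a::chilbert) = Complex (inner x y) (inner x (\<i> *\<^sub>C y))"
  by (simp add: complex_eq_iff inner_eq_Re_cinner cinner_scaleC_right)

lemma cinner_left_ext:
  assumes "\<And>y. cinner x y = cinner x' (y :: 'a::chilbert)" shows "x = x'"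
proof -
  have "cinner (x - x') (x - x') = 0"
    using assms by (simp add: cinner_diff_left)
  then show ?thesis
    by (simp add: cinner_self)
qed

lemma cinner_right_ext:
  assumes "\<And>y. cinner y x = cinner y (x' :: 'a::chilbert)" shows "x = x'"
  by (rule cinner_left_ext) (metis assms cinner_commute)

section \<open>Bounded complex-linear operators\<close>

lemma bounded_linear_cinner_left: "bounded_linear (\<lambda>x. cinner x (y :: 'a::chilbert))"
  by (rule bounded_linear_intro [where K = "norm y"])
    (simp_all add: cinner_add_left cinner_scaleR_left scaleR_conv_of_real cmod_cinner_le)

lemma bounded_linear_cinner_right: "bounded_linear (\<lambda>y. cinner (x :: 'a::chilbert) y)"
  by (rule bounded_linear_intro [where K = "norm x"])
    (simp_all add: cinner_add_right cinner_scaleR_right scaleR_conv_of_real cmod_cinner_le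
      mult.commute [of "norm _" "norm x"])

lemma bounded_linear_scaleC: "bounded_linear (\<lambda>x :: 'a::chilbert. c *\<^sub>C x)"
  by (rule bounded_linear_intro [where K = "cmod c"])
    (simp_all add: scaleC_add_right scaleR_scaleC scaleC_scaleC norm_scaleC mult.commute)

lemma bounded_clinearI:
  assumes "\<And>x y. T (x + y) = T x + T y" "\<And>c x. T (c *\<^sub>C x) = c *\<^sub>C T x"
    "\<And>x. norm (T x) \<le> K * norm x"
  shows "bounded_clinear T"
  unfolding bounded_clinear_def
proof
  show "bounded_linear T"
    by (rule bounded_linear_intro [where K = K])
      (use assms in \<open>simp_all add: scaleR_scaleC mult.commute\<close>)
qed (use assms in simp)

lemma bounded_clinear_linear: "bounded_clinear T \<Longrightarrow> bounded_linear T"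
  by (simp add: bounded_clinear_def)

lemma bounded_clinear_scaleC: "bounded_clinear T \<Longrightarrow> T (c *\<^sub>C x) = c *\<^sub>C T x"
  by (simp add: bounded_clinear_def)

lemma bounded_clinear_add: "bounded_clinear T \<Longrightarrow> T (x + y) = T x + T y"
  by (simp add: bounded_clinear_def linear_simps)

lemma bounded_clinear_diff: "bounded_clinear T \<Longrightarrow> T (x - y) = T x - T y"
  by (simp add: bounded_clinear_def linear_simps)

lemma bounded_clinear_zero: "bounded_clinear T \<Longrightarrow> T 0 = 0"
  by (simp add: bounded_clinear_def linear_simps)

lemma bounded_clinear_sum: "bounded_clinear T \<Longrightarrow> T (\<Sum>i\<in>I. f i) = (\<Sum>i\<in>I. T (f i))"
  by (simp add: bounded_clinear_def linear_sum bounded_linear.linear)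

lemma bounded_clinear_bound:
  assumes "bounded_clinear T"
  obtains K where "0 < K" "\<And>x. norm (T x) \<le> K * norm x"
  using bounded_linear.pos_bounded [OF bounded_clinear_linear [OF assms]]
  by (metis mult.commute)

lemma bounded_clinear_const_zero: "bounded_clinear (\<lambda>_. 0)"
  by (rule bounded_clinearI [where K = 0]) auto

lemma bounded_clinear_ident: "bounded_clinear (\<lambda>x. x)"
  by (rule bounded_clinearI [where K = 1]) auto

lemma bounded_clinear_compose:
  assumes "bounded_clinear S" "bounded_clinear T" shows "bounded_clinear (\<lambda>x. S (T x))"
  using assms bounded_linear_compose unfolding bounded_clinear_def by auto

lemma bounded_clinear_plus:
  assumes "bounded_clinear S" "bounded_clinear T" shows "bounded_clinear (\<lambda>x. S x + T x)"
  using assms bounded_linear_add unfolding bounded_clinear_def by (auto simp: scaleC_add_right)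

lemma bounded_clinear_scale:
  assumes "bounded_clinear T" shows "bounded_clinear (\<lambda>x. c *\<^sub>C T x)"
  using assms bounded_linear_compose [OF bounded_linear_scaleC]
  unfolding bounded_clinear_def by (auto simp: scaleC_scaleC mult.commute)

lemma bounded_clinear_minus:
  assumes "bounded_clinear S" "bounded_clinear T" shows "bounded_clinear (\<lambda>x. S x - T x)"
  using assms bounded_linear_sub unfolding bounded_clinear_def by (auto simp: scaleC_diff_right)

lemma bounded_clinear_setsum:
  assumes "\<And>i. i \<in> I \<Longrightarrow> bounded_clinear (T i)"
  shows "bounded_clinear (\<lambda>x. \<Sum>i\<in>I. T i x)"
  using assms bounded_linear_sum [of I T] unfolding bounded_clinear_def
  by (auto simp: scaleC_sum_right)

text \<open>Minimise |p g|^2 - 2 \<phi> g over S: the images of a minimising sequence converge even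
  if S is not closed and p is not injective. This generality serves adjoints (p the identity),
  projections (S a closed subspace) and the contraction \<open>U\<close> (p with a range that need
  not be closed).\<close>

lemma riesz_subspace:
  fixes p :: "'g::real_vector \<Rightarrow> 'x::{real_inner,complete_space}" and \<phi> :: "'g \<Rightarrow> real"
  assumes S: "subspace S" and p: "linear p" and \<phi>: "linear \<phi>" and c: "0 \<le> c"
    and le: "\<And>g. g \<in> S \<Longrightarrow> \<phi> g \<le> c * norm (p g)"
  obtains x where "x \<in> closure (p ` S)" "\<And>g. g \<in> S \<Longrightarrow> inner (p g) x = \<phi> g" "norm x \<le> c"
proof -
  define q where "q g = (norm (p g))\<^sup>2 - 2 * \<phi> g" for g
  define m where "m = Inf (q ` S)"
  have lower: "- (c\<^sup>2) \<le> q g" if "g \<in> S" for g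
    using le [OF that] zero_le_power2 [of "norm (p g) - c"] unfolding q_def
    by (simp add: power2_diff mult.commute)
  then have m_le: "m \<le> q g" if "g \<in> S" for g
    unfolding m_def using that by (intro cInf_lower bdd_belowI2 [where m = "- (c\<^sup>2)"]) auto
  have "\<exists>g\<in>S. q g < m + 1 / real (Suc n)" for n
  proof -
    have "Inf (q ` S) < m + 1 / real (Suc n)"
      by (simp add: m_def)
    then show ?thesis
      using cInf_lessD [of "q ` S"] subspace_0 [OF S] by blast
  qed
  then obtain g where gS: "\<And>n. g n \<in> S" and g: "\<And>n. q (g n) < m + 1 / real (Suc n)"
    by metis
  \<comment> \<open>Parallelogram identity for the functional: the linear terms cancel, so a
    minimising sequence has a Cauchy image.\<close>
  have par: "(norm (p a - p b))\<^sup>2 = 2 * q a + 2 * q b - 4 * q ((1/2) *\<^sub>R (a + b))" for a b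
    unfolding q_def
    by (simp add: linear_add [OF p] linear_cmul [OF p] linear_add [OF \<phi>] linear_cmul [OF \<phi>]
        power_mult_distrib power2_norm_eq_inner inner_simps field_simps inner_commute)
  have dist: "(norm (p (g i) - p (g j)))\<^sup>2 \<le> 2 / real (Suc i) + 2 / real (Suc j)" for i j
  proof -
    have "(1/2) *\<^sub>R (g i + g j) \<in> S"
      by (intro subspace_scale subspace_add S gS)
    from m_le [OF this] show ?thesis
      using g [of i] g [of j] par [of "g i" "g j"] by simp
  qed
  have "Cauchy (\<lambda>n. p (g n))"
  proof (rule CauchyI)
    fix e :: real
    assume e: "0 < e"
    obtain N :: nat where N: "4 / e\<^sup>2 < real N"
      using reals_Archimedean2 by blast
    show "\<exists>M. \<forall>m\<ge>M. \<forall>n\<ge>M. norm (p (g m) - p (g n)) < e"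
    proof (intro exI allI impI)
      fix i j assume ij: "N \<le> i" "N \<le> j"
      have N0: "0 < real N"
        using N e by (smt (verit) divide_pos_pos zero_less_power)
      have "2 / real (Suc i) \<le> 2 / real N" "2 / real (Suc j) \<le> 2 / real N"
        using ij N0 by (auto intro!: divide_left_mono)
      then have "(norm (p (g i) - p (g j)))\<^sup>2 \<le> 4 / real N"
        using dist [of i j] by simp
      also have "\<dots> < e\<^sup>2"
        using N N0 e by (simp add: field_simps)
      finally show "norm (p (g i) - p (g j)) < e"
        using e by (simp add: power_less_imp_less_base)
    qed
  qed
  then obtain x where x: "(\<lambda>n. p (g n)) \<longlonglongrightarrow> x"
    by (auto simp: Cauchy_convergent_iff convergent_def)
  have xc: "x \<in> closure (p ` S)"
    using x gS unfolding closure_sequential by (intro exI [of _ "\<lambda>n. p (g n)"]) auto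
  have eq: "inner (p h) x = \<phi> h" if h: "h \<in> S" for h
  proof -
    \<comment> \<open>First-order condition: moving from \<open>g n\<close> by t h lowers q by at
      most 1 / (n + 1).\<close>
    have ge: "0 \<le> t\<^sup>2 * (norm (p h))\<^sup>2 + 2 * t * (inner (p h) x - \<phi> h)" for t
    proof -
      have "- (1 / real (Suc n)) \<le> t\<^sup>2 * (norm (p h))\<^sup>2 + 2 * t * (inner (p h) (p (g n)) - \<phi> h)" for n
      proof -
        have "g n + t *\<^sub>R h \<in> S"
          by (intro subspace_scale subspace_add S gS h)
        from m_le [OF this] g [of n]
        have "q (g n) - q (g n + t *\<^sub>R h) \<le> 1 / real (Suc n)"
          by simp
        moreover have "(norm (p (g n + t *\<^sub>R h)))\<^sup>2 =
            (norm (p (g n)))\<^sup>2 + t\<^sup>2 * (norm (p h))\<^sup>2 + 2 * t * inner (p h) (p (g n))"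
          unfolding power2_norm_eq_inner
          by (simp add: linear_add [OF p] linear_cmul [OF p] inner_simps inner_commute
            power2_eq_square algebra_simps)
        ultimately show ?thesis
          unfolding q_def by (simp add: linear_add [OF \<phi>] linear_cmul [OF \<phi>] algebra_simps)
      qed
      moreover have "(\<lambda>n. - (1 / real (Suc n))) \<longlonglongrightarrow> - 0"
        by (intro tendsto_intros LIMSEQ_Suc [OF lim_1_over_n])
      moreover have "(\<lambda>n. t\<^sup>2 * (norm (p h))\<^sup>2 + 2 * t * (inner (p h) (p (g n)) - \<phi> h)) \<longlonglongrightarrow>
         t\<^sup>2 * (norm (p h))\<^sup>2 + 2 * t * (inner (p h) x - \<phi> h)"
        by (intro tendsto_intros x)
      ultimately show ?thesis
        by (metis (no_types, lifting) LIMSEQ_le minus_zero)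
    qed
    \<comment> \<open>The choice t = - d / N makes the quadratic at most - d^2 / N; the summand 1 in
      \<open>N\<close> keeps the quotient meaningful when p h = 0.\<close>
    define d where "d = inner (p h) x - \<phi> h"
    define N where "N = (norm (p h))\<^sup>2 + 1"
    have N: "N > 0"
      by (simp add: N_def add_nonneg_pos)
    have "0 \<le> (d / N)\<^sup>2 * (norm (p h))\<^sup>2 - 2 * (d / N) * d"
      using ge [of "- (d / N)"] unfolding d_def [symmetric] by simp
    also have "(d / N)\<^sup>2 * (norm (p h))\<^sup>2 \<le> (d / N)\<^sup>2 * N"
      by (intro mult_left_mono) (auto simp: N_def)
    also have "(d / N)\<^sup>2 * N - 2 * (d / N) * d = - (d\<^sup>2 / N)"
      using N by (simp add: field_simps power2_eq_square)
    finally have "d\<^sup>2 / N \<le> 0"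
      by simp
    then have "d = 0"
      using N by (simp add: divide_le_0_iff)
    then show ?thesis
      by (simp add: d_def)
  qed
  \<comment> \<open>The norm bound is the hypothesis on \<phi>, passed to the closure and applied to
    x itself.\<close>
  have "closure (p ` S) \<subseteq> {v. inner v x \<le> c * norm v}"
    by (intro closure_minimal closed_Collect_le continuous_intros) (use eq le in auto)
  with xc have "inner x x \<le> c * norm x"
    by auto
  then have "norm x \<le> c"
    using c by (cases "x = 0") (auto simp: power2_norm_eq_inner [symmetric] power2_eq_square)
  with xc eq show thesis
    by (rule that)
qed

lemma cadjoint_exists:
  fixes T :: "'a::chilbert \<Rightarrow> 'b::chilbert"
  assumes T: "bounded_clinear T"
  shows "\<exists>S. \<forall>x y. cinner (T x) y = cinner x (S y)"
proof -
  obtain K where K: "0 < K" "\<And>x. norm (T x) \<le> K * norm x"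
    using bounded_clinear_bound [OF T] by blast
  have "\<exists>s. \<forall>x. inner x s = inner (T x) y" for y
  proof (rule riesz_subspace [where S = UNIV and p = "\<lambda>x. x" and \<phi> = "\<lambda>x. inner (T x) y"
      and c = "K * norm y"])
    show "linear (\<lambda>x. inner (T x) y)"
      by (intro bounded_linear.linear bounded_linear_compose [OF bounded_linear_inner_left]
          bounded_clinear_linear T)
    show "inner (T g) y \<le> K * norm y * norm g" for g
      using norm_cauchy_schwarz [of "T g" y] mult_right_mono [OF K(2) [of g], of "norm y"]
      by (simp add: mult_ac)
  qed (use K in \<open>auto simp: linear_id [unfolded id_def]\<close>)
  then obtain S where S: "\<And>x y. inner x (S y) = inner (T x) y"
    by metis
  have "cinner (T x) y = cinner x (S y)" for x y
  proof -
    \<comment> \<open>The real Riesz vector settles only real parts; the imaginary part is the real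
      part at - i x.\<close>
    have "Im (cinner (T x) y) = inner (T ((- \<i>) *\<^sub>C x)) y"
      by (simp only: bounded_clinear_scaleC [OF T] inner_eq_Re_cinner cinner_scaleC_left) simp
    also have "\<dots> = inner ((- \<i>) *\<^sub>C x) (S y)"
      by (simp only: S)
    also have "\<dots> = Im (cinner x (S y))"
      by (simp add: inner_eq_Re_cinner cinner_scaleC_left)
    finally show ?thesis
      using S [of x y] by (simp add: complex_eq_iff inner_eq_Re_cinner)
  qed
  then show ?thesis
    by blast
qed

lemma cinner_cadjoint_right:
  assumes "bounded_clinear T" shows "cinner (T x) y = cinner x (cadjoint T y)"
proof -
  obtain S where S: "\<forall>x y. cinner (T x) y = cinner x (S y)"
    using cadjoint_exists [OF assms] by blast
  have "\<forall>x y. cinner (T x) y = cinner x (cadjoint T y)"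
    unfolding cadjoint_def
  proof (rule theI [of _ S])
    show "S' = S" if "\<forall>x y. cinner (T x) y = cinner x (S' y)" for S'
      by (rule ext, rule cinner_right_ext) (metis S that)
  qed (rule S)
  then show ?thesis
    by blast
qed

lemma cinner_cadjoint_left:
  assumes "bounded_clinear T" shows "cinner (cadjoint T y) x = cinner y (T x)"
  by (metis cinner_cadjoint_right [OF assms] cinner_commute)

lemma bounded_clinear_cadjoint:
  assumes T: "bounded_clinear T" shows "bounded_clinear (cadjoint T)"
proof -
  obtain K where K: "0 < K" "\<And>x. norm (T x) \<le> K * norm x"
    using bounded_clinear_bound [OF T] by blast
  show ?thesis
  proof (rule bounded_clinearI [where K = K])
    show "cadjoint T (x + y) = cadjoint T x + cadjoint T y" for x y
      by (rule cinner_left_ext) (simp add: cinner_cadjoint_left [OF T] cinner_add_left)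
    show "cadjoint T (c *\<^sub>C x) = c *\<^sub>C cadjoint T x" for c x
      by (rule cinner_left_ext) (simp add: cinner_cadjoint_left [OF T] cinner_scaleC_left)
    show "norm (cadjoint T x) \<le> K * norm x" for x
    proof -
      have "(norm (cadjoint T x))\<^sup>2 = cmod (cinner x (T (cadjoint T x)))"
        by (simp add: cinner_cadjoint_left [OF T, symmetric] cinner_self norm_power)
      also have "\<dots> \<le> norm x * (K * norm (cadjoint T x))"
        using cmod_cinner_le K(2) by (meson mult_left_mono norm_ge_zero order_trans)
      finally have "norm (cadjoint T x) * norm (cadjoint T x) \<le> (K * norm x) * norm (cadjoint T x)"
        by (simp add: power2_eq_square mult_ac)
      then show ?thesis
        using K by (cases "cadjoint T x = 0") auto
    qed
  qed
qed

section \<open>Closed subspaces and orthogonal projections\<close>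

lemma csubspace_imp_subspace: "csubspace M \<Longrightarrow> subspace (M :: 'a::chilbert set)"
  unfolding csubspace_def subspace_def by (simp add: scaleR_scaleC)

lemma csubspace_diff: "csubspace M \<Longrightarrow> x \<in> M \<Longrightarrow> y \<in> M \<Longrightarrow> x - y \<in> M"
  using csubspace_imp_subspace subspace_diff by blast

lemma csubspace_sum: "csubspace M \<Longrightarrow> (\<And>i. i \<in> I \<Longrightarrow> f i \<in> M) \<Longrightarrow> (\<Sum>i\<in>I. f i) \<in> M"
  using csubspace_imp_subspace subspace_sum by blast

lemma csubspace_cspan: "csubspace (cspan S)"
  unfolding cspan_def by (rule hull_in) (auto simp: csubspace_def)

lemma cspan_superset: "S \<subseteq> cspan S"
  unfolding cspan_def by (rule hull_subset)

lemma cspan_minimal: "S \<subseteq> M \<Longrightarrow> csubspace M \<Longrightarrow> cspan S \<subseteq> M"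
  unfolding cspan_def by (rule hull_minimal)

lemma csubspace_closure:
  assumes "csubspace (M :: 'a::chilbert set)" shows "csubspace (closure M)"
  unfolding csubspace_def
proof (intro conjI ballI allI)
  show "0 \<in> closure M"
    using assms closure_subset unfolding csubspace_def by blast
next
  fix x y assume "x \<in> closure M" "y \<in> closure M"
  then obtain f g where "\<And>n. f n \<in> M" "f \<longlonglongrightarrow> x" "\<And>n. g n \<in> M" "g \<longlonglongrightarrow> y"
    unfolding closure_sequential by blast
  then show "x + y \<in> closure M"
    using assms unfolding closure_sequential csubspace_def
    by (intro exI [of _ "\<lambda>n. f n + g n"]) (auto intro: tendsto_add)
next
  fix c x assume x: "x \<in> closure M"
  have "continuous_on (closure M) ((*\<^sub>C) c)"
    by (rule linear_continuous_on [OF bounded_linear_scaleC])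
  moreover have "(*\<^sub>C) c ` M \<subseteq> closure M"
    using assms closure_subset unfolding csubspace_def by blast
  ultimately have "(*\<^sub>C) c ` closure M \<subseteq> closure M"
    by (intro image_closure_subset) auto
  then show "c *\<^sub>C x \<in> closure M"
    using x by blast
qed

lemma csubspace_ocompl: "csubspace (ocompl M)"
  unfolding csubspace_def ocompl_def by (auto simp: cinner_add_left cinner_scaleC_left)

lemma closed_ocompl: "closed (ocompl M)"
proof -
  have "ocompl M = (\<Inter>y\<in>M. {x. cinner x y = 0})"
    by (auto simp: ocompl_def)
  moreover have "closed {x. cinner x y = 0}" for y :: 'a
    by (intro closed_Collect_eq linear_continuous_on bounded_linear_cinner_left continuous_on_const)
  ultimately show ?thesis
    by auto
qed

text \<open>The vectors y with \<open>cinner x y = 0\<close> form a closed complex subspace, so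
  orthogonality can be tested on generators.\<close>

lemma ocompl_closure_cspan: "ocompl (closure (cspan S)) = ocompl S"
proof
  show "ocompl (closure (cspan S)) \<subseteq> ocompl S"
    unfolding ocompl_def using cspan_superset closure_subset by blast
  show "ocompl S \<subseteq> ocompl (closure (cspan S))"
  proof
    fix x assume x: "x \<in> ocompl S"
    have "csubspace {y. cinner x y = 0}"
      by (auto simp: csubspace_def cinner_add_right cinner_scaleC_right)
    moreover have "closed {y. cinner x y = 0}"
      by (intro closed_Collect_eq linear_continuous_on bounded_linear_cinner_right continuous_on_const)
    ultimately have "closure (cspan S) \<subseteq> {y. cinner x y = 0}"
      using x by (intro closure_minimal cspan_minimal) (auto simp: ocompl_def)
    then show "x \<in> ocompl (closure (cspan S))"
      by (auto simp: ocompl_def)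
  qed
qed

context
  fixes M :: "'a::chilbert set"
  assumes M: "csubspace M" "closed M"
begin

lemma projI:
  assumes "p \<in> M" "x - p \<in> ocompl M" shows "proj M x = p"
  unfolding proj_def
proof (rule the_equality)
  fix p' assume p': "p' \<in> M \<and> x - p' \<in> ocompl M"
  have 1: "p - p' \<in> M"
    using assms p' M csubspace_diff by blast
  have "cinner (p - p') (p - p') = cinner (x - p') (p - p') - cinner (x - p) (p - p')"
    by (simp add: cinner_diff_left [symmetric])
  also have "\<dots> = 0"
    using 1 assms p' by (simp add: ocompl_def)
  finally show "p' = p"
    by (simp add: cinner_self)
qed (use assms in auto)

text \<open>On M the functional y \<mapsto> \<open>inner y x\<close> is represented by a vector p in
  the closure of M, which is M. Then x - p is orthogonal to M for the real inner product and,
  testing with \<open>\<i> *\<^sub>C y\<close>, for the complex one.\<close>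

lemma proj_exists: "\<exists>p\<in>M. x - p \<in> ocompl M"
proof (rule riesz_subspace [where S = M and p = "\<lambda>x. x" and \<phi> = "\<lambda>y. inner y x" and c = "norm x"])
  show "inner y x \<le> norm x * norm y" for y
    using norm_cauchy_schwarz [of y x] by (simp add: mult.commute)
  fix p assume p: "p \<in> closure ((\<lambda>x. x) ` M)" "\<And>g. g \<in> M \<Longrightarrow> inner g p = inner g x"
  have "cinner y (x - p) = 0" if "y \<in> M" for y
  proof -
    have "\<i> *\<^sub>C y \<in> M"
      using M that by (simp add: csubspace_def)
    then have "inner y (x - p) = 0" "inner (\<i> *\<^sub>C y) (x - p) = 0"
      using p that by (simp_all add: inner_simps)
    then show ?thesis
      by (simp add: inner_eq_Re_cinner cinner_scaleC_left complex_eq_iff)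
  qed
  then have "x - p \<in> ocompl M"
    by (auto simp: ocompl_def) (metis cinner_commute complex_cnj_zero)
  then show ?thesis
    using p M by (auto intro!: bexI [of _ p])
qed (use M in \<open>auto simp: csubspace_imp_subspace linear_id [unfolded id_def]
    bounded_linear.linear bounded_linear_inner_left\<close>)

lemma proj_in: "proj M x \<in> M"
  and proj_diff: "x - proj M x \<in> ocompl M"
  using proj_exists [of x] projI by auto

lemma proj_id: "x \<in> M \<Longrightarrow> proj M x = x"
  by (rule projI) (auto simp: ocompl_def)

lemma cinner_proj_left: "cinner (proj M x) y = cinner x (proj M y)"
proof -
  have "cinner (proj M x) (y - proj M y) = 0"
    using proj_diff [of y] proj_in [of x]
    by (auto simp: ocompl_def) (metis cinner_commute complex_cnj_zero)
  moreover have "cinner (x - proj M x) (proj M y) = 0"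
    using proj_diff [of x] proj_in [of y] by (auto simp: ocompl_def)
  ultimately show ?thesis
    by (simp add: cinner_diff_left cinner_diff_right)
qed

lemma norm_proj_le: "norm (proj M x) \<le> norm x"
proof -
  have "(norm (proj M x))\<^sup>2 = cmod (cinner (proj M x) (proj M x))"
    by (simp add: cinner_self norm_power)
  also have "\<dots> = cmod (cinner (proj M x) x)"
    using cinner_proj_left [of "proj M x" x] proj_id [OF proj_in] by simp
  also have "\<dots> \<le> norm (proj M x) * norm x"
    by (rule cmod_cinner_le)
  finally show ?thesis
    by (cases "proj M x = 0") (auto simp: power2_eq_square)
qed

lemma bounded_clinear_proj: "bounded_clinear (proj M)"
proof (rule bounded_clinearI [where K = 1])
  show "proj M (x + y) = proj M x + proj M y" for x y
    by (rule cinner_left_ext) (simp add: cinner_proj_left cinner_add_left)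
  show "proj M (c *\<^sub>C x) = c *\<^sub>C proj M x" for c x
    by (rule cinner_left_ext) (simp add: cinner_proj_left cinner_scaleC_left)
qed (simp add: norm_proj_le)

lemma bounded_clinear_compression:
  "bounded_clinear T \<Longrightarrow> bounded_clinear (compression M T)"
  unfolding compression_def o_def
  by (rule bounded_clinear_compose [OF bounded_clinear_proj
        bounded_clinear_compose [OF _ bounded_clinear_proj]])

lemma norm_compression_le:
  assumes "\<And>x. norm (T x) \<le> norm x" shows "norm (compression M T x) \<le> norm x"
  unfolding compression_def o_def
  by (rule order_trans [OF norm_proj_le order_trans [OF assms norm_proj_le]])

end

section \<open>Direct sums of Hilbert spaces\<close>

instantiation prod :: (chilbert, chilbert) chilbert
begin

definition scaleC_prod :: "complex \<Rightarrow> 'a \<times> 'b \<Rightarrow> 'a \<times> 'b"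
  where "scaleC_prod c x = (c *\<^sub>C fst x, c *\<^sub>C snd x)"

definition cinner_prod :: "'a \<times> 'b \<Rightarrow> 'a \<times> 'b \<Rightarrow> complex"
  where "cinner_prod x y = cinner (fst x) (fst y) + cinner (snd x) (snd y)"

instance
proof
  fix x y z :: "'a \<times> 'b" and c d :: complex and r :: real
  show "c *\<^sub>C (x + y) = c *\<^sub>C x + c *\<^sub>C y" "(c + d) *\<^sub>C x = c *\<^sub>C x + d *\<^sub>C x"
    "c *\<^sub>C d *\<^sub>C x = (c * d) *\<^sub>C x"
    by (simp_all add: scaleC_prod_def scaleC_add_right scaleC_add_left scaleC_scaleC)
  show "r *\<^sub>R x = complex_of_real r *\<^sub>C x"
    by (simp add: scaleC_prod_def scaleR_prod_def scaleR_scaleC)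
  show "cinner x y = cnj (cinner y x)"
    unfolding cinner_prod_def by (metis cinner_commute complex_cnj_add)
  show "cinner (x + y) z = cinner x z + cinner y z" "cinner (c *\<^sub>C x) y = c * cinner x y"
    by (simp_all add: cinner_prod_def scaleC_prod_def cinner_add_left cinner_scaleC_left
        distrib_left)
  show "inner x y = Re (cinner x y)"
    by (simp add: cinner_prod_def inner_prod_def inner_eq_Re_cinner)
qed

end

text \<open>The lurking isometry argument: \<open>p g \<mapsto> q g\<close> is a contraction on the range of \<open>p\<close>, and \<open>U\<close> is
  the adjoint of its extension by zero.\<close>

lemma contraction_adjoint_exists:
  fixes p :: "'g::chilbert \<Rightarrow> 'x::chilbert" and q :: "'g \<Rightarrow> 'y::chilbert"
  assumes p: "bounded_clinear p" and q: "bounded_clinear q" and le: "\<And>g. norm (q g) \<le> norm (p g)"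
  obtains U :: "'y \<Rightarrow> 'x" where "bounded_clinear U" "\<And>y. norm (U y) \<le> norm y"
    "\<And>y g. cinner (U y) (p g) = cinner y (q g)"
proof -
  define R where "R = closure (range p)"
  have "csubspace (range p)"
    unfolding csubspace_def
  proof (intro conjI ballI allI)
    show "0 \<in> range p"
      by (rule image_eqI [where x = 0]) (simp_all add: bounded_clinear_zero [OF p])
    show "x + y \<in> range p" if "x \<in> range p" "y \<in> range p" for x y
      using that by (auto simp: bounded_clinear_add [OF p, symmetric])
    show "c *\<^sub>C x \<in> range p" if "x \<in> range p" for c x
      using that by (auto simp: bounded_clinear_scaleC [OF p, symmetric])
  qed
  then have R: "csubspace R"
    unfolding R_def by (rule csubspace_closure)
  \<comment> \<open>The representing vector is taken in R, where it is unique; an arbitrary choice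
    among vectors with the same pairings need not be linear in y.\<close>
  have "\<exists>u. u \<in> R \<and> norm u \<le> norm y \<and> (\<forall>g. cinner u (p g) = cinner y (q g))" for y
  proof (rule riesz_subspace [where S = UNIV and p = p and \<phi> = "\<lambda>g. inner (q g) y" and c = "norm y"])
    show "linear p"
      by (intro bounded_linear.linear bounded_clinear_linear p)
    show "linear (\<lambda>g. inner (q g) y)"
      by (intro bounded_linear.linear bounded_linear_compose [OF bounded_linear_inner_left]
          bounded_clinear_linear q)
    show "inner (q g) y \<le> norm y * norm (p g)" for g
      using norm_cauchy_schwarz [of "q g" y] mult_left_mono [OF le [of g], of "norm y"]
      by (simp add: mult.commute)
    fix u assume u: "u \<in> closure (range p)" "\<And>g. g \<in> UNIV \<Longrightarrow> inner (p g) u = inner (q g) y"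
      "norm u \<le> norm y"
    have "cinner u (p g) = cinner y (q g)" for g
    proof -
      have "inner u (p g) = inner y (q g)" "inner u (p (\<i> *\<^sub>C g)) = inner y (q (\<i> *\<^sub>C g))"
        using u(2) by (metis UNIV_I inner_commute)+
      then show ?thesis
        by (simp only: cinner_eq_inner bounded_clinear_scaleC [OF p] bounded_clinear_scaleC [OF q])
    qed
    with u show ?thesis
      by (auto simp: R_def)
  qed auto
  then obtain U where U: "\<And>y. U y \<in> R" "\<And>y. norm (U y) \<le> norm y"
    "\<And>y g. cinner (U y) (p g) = cinner y (q g)"
    by metis
  have uniq: "a = b" if "a \<in> R" "b \<in> R" "\<And>g. cinner a (p g) = cinner b (p g)" for a b
  proof -
    have "a - b \<in> ocompl (range p)"
      using that by (auto simp: ocompl_def cinner_diff_left)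
    moreover have "ocompl (range p) = ocompl R"
    proof -
      have "cspan (range p) = range p"
        by (intro subset_antisym cspan_minimal cspan_superset \<open>csubspace (range p)\<close> order_refl)
      then show ?thesis
        unfolding R_def by (metis ocompl_closure_cspan)
    qed
    moreover have "a - b \<in> R"
      using that R csubspace_diff by blast
    ultimately have "cinner (a - b) (a - b) = 0"
      by (auto simp: ocompl_def)
    then show ?thesis
      by (simp add: cinner_self)
  qed
  have "bounded_clinear U"
  proof (rule bounded_clinearI [where K = 1])
    show "U (x + y) = U x + U y" for x y
      using U R by (intro uniq) (auto simp: csubspace_def cinner_add_left)
    show "U (c *\<^sub>C x) = c *\<^sub>C U x" for c x
      using U R by (intro uniq) (auto simp: csubspace_def cinner_scaleC_left)
  qed (use U in auto)
  then show thesis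
    using U by (intro that) auto
qed

section \<open>Square-summable families\<close>

lemma ell2_eqI: "(\<And>i. coord x i = coord y i) \<Longrightarrow> x = y"
  by (simp add: coord_inject [symmetric] fun_eq_iff)

lemma coord_sum: "coord (\<Sum>a\<in>I. f a) i = (\<Sum>a\<in>I. coord (f a) i)"
  by (induction I rule: infinite_finite_induct) (auto simp: plus_ell2.rep_eq zero_ell2.rep_eq)

lemma bounded_clinear_coord: "bounded_clinear (\<lambda>x. coord x i)"
  by (rule bounded_clinearI [where K = 1])
    (auto simp: plus_ell2.rep_eq scaleC_ell2.rep_eq norm_coord_le)

lemma sq_summable_if_bounded:
  assumes "\<And>F. finite F \<Longrightarrow> (\<Sum>i\<in>F. (norm (f i))\<^sup>2) \<le> C"
  shows "sq_summable f"
  unfolding sq_summable_def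
  by (intro nonneg_bdd_above_summable_on bdd_aboveI2 [where M = C]) (use assms in auto)

lemma coord_Abs_ell2: "sq_summable f \<Longrightarrow> coord (Abs_ell2 f) = f"
  by (simp add: Abs_ell2_inverse)

lemma norm_ell2_le:
  assumes "\<And>F. finite F \<Longrightarrow> (\<Sum>i\<in>F. (norm (coord x i))\<^sup>2) \<le> C\<^sup>2" "0 \<le> C"
  shows "norm x \<le> C"
proof -
  have "(norm x)\<^sup>2 \<le> C\<^sup>2"
    unfolding norm_ell2_sq
    by (rule infsum_le_finite_sums)
      (use assms sq_summable_coord [of x] in \<open>auto simp: sq_summable_def\<close>)
  then show ?thesis
    using assms by (simp add: power2_le_iff_abs_le)
qed

lemma infsum_delta: "(\<Sum>\<^sub>\<infinity>j. if j = i then f j else 0) = (f i :: 'b::{comm_monoid_add,t2_space})"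
  by (subst infsum_cong_neutral [where T = "{i}" and g = f]) auto

lemma cinner_simple_tensor: "cinner (f \<otimes>\<^sub>v h) (g \<otimes>\<^sub>v k) = cinner f g * cinner h k"
  unfolding cinner_ell2_def simple_tensor.rep_eq
  by (subst infsum_cmult_left' [symmetric])
    (simp add: cinner_scaleC_left cinner_scaleC_right cinner_complex_def mult_ac)

lemma simple_tensor_add_left: "(f + g) \<otimes>\<^sub>v h = f \<otimes>\<^sub>v h + g \<otimes>\<^sub>v h"
  by transfer (simp add: scaleC_add_left)

lemma simple_tensor_diff_left: "(f - g) \<otimes>\<^sub>v h = f \<otimes>\<^sub>v h - g \<otimes>\<^sub>v h"
  using simple_tensor_add_left [of "f - g" g h] by simp

lemma simple_tensor_add_right: "f \<otimes>\<^sub>v (h + k) = f \<otimes>\<^sub>v h + f \<otimes>\<^sub>v k"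
  by transfer (simp add: scaleC_add_right)

lemma simple_tensor_scaleC_right: "f \<otimes>\<^sub>v (c *\<^sub>C h) = c *\<^sub>C (f \<otimes>\<^sub>v h)"
  by transfer (simp add: scaleC_scaleC mult.commute)

lemma norm_simple_tensor: "norm (f \<otimes>\<^sub>v h) = norm f * norm h"
proof -
  have "complex_of_real ((norm (f \<otimes>\<^sub>v h))\<^sup>2) = of_real ((norm f * norm h)\<^sup>2)"
    by (simp add: cinner_self [symmetric] cinner_simple_tensor power_mult_distrib
        del: of_real_power of_real_mult) (simp add: cinner_self)
  then have "(norm (f \<otimes>\<^sub>v h))\<^sup>2 = (norm f * norm h)\<^sup>2"
    by (simp only: of_real_eq_iff)
  then show ?thesis
    by (simp add: power2_eq_iff_nonneg)
qed

lemma bounded_clinear_simple_tensor: "bounded_clinear (\<lambda>h. f \<otimes>\<^sub>v h)"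
  by (rule bounded_clinearI [where K = "norm f"])
    (simp_all add: simple_tensor_add_right simple_tensor_scaleC_right norm_simple_tensor)

lemma coord_basis_tensor: "coord (basis_vec i \<otimes>\<^sub>v h) j = (if j = i then h else 0)"
  by (simp add: simple_tensor.rep_eq basis_vec.rep_eq)

lemma cinner_basis_tensor_left: "cinner (basis_vec i \<otimes>\<^sub>v h) x = cinner h (coord x i)"
proof -
  have "cinner (basis_vec i \<otimes>\<^sub>v h) x = (\<Sum>\<^sub>\<infinity>j. if j = i then cinner h (coord x j) else 0)"
    unfolding cinner_ell2_def by (rule infsum_cong) (simp add: coord_basis_tensor)
  then show ?thesis
    by (simp add: infsum_delta)
qed

lemma cinner_basis_tensor_right: "cinner x (basis_vec i \<otimes>\<^sub>v h) = cinner (coord x i) h"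
  by (metis cinner_basis_tensor_left cinner_commute)

lemma norm_basis_vec: "norm (basis_vec i) = 1"
proof -
  have "(\<Sum>\<^sub>\<infinity>j. (norm (coord (basis_vec i) j))\<^sup>2) = (\<Sum>\<^sub>\<infinity>j. if j = i then 1 else 0)"
    by (rule infsum_cong) (simp add: basis_vec.rep_eq)
  then have "(norm (basis_vec i))\<^sup>2 = 1"
    by (simp only: norm_ell2_sq infsum_delta)
  then show ?thesis
    by (simp add: power2_eq_1_iff) (metis norm_ge_zero not_one_le_zero neg_0_le_iff_le)
qed

text \<open>The truncation y to F satisfies <x, y> = <y, y>, so |x - y|^2 is a tail of the
  convergent series for |x|^2.\<close>

lemma ell2_finite_approx:
  assumes "0 < e"
  obtains F where "finite F" "norm (x - (\<Sum>i\<in>F. basis_vec i \<otimes>\<^sub>v coord x i)) < e"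
proof -
  have "((\<lambda>i. (norm (coord x i))\<^sup>2) has_sum (norm x)\<^sup>2) UNIV"
    using sq_summable_coord [of x] unfolding norm_ell2_sq sq_summable_def by (rule has_sum_infsum)
  then have "\<forall>\<^sub>F F in finite_subsets_at_top UNIV. dist (\<Sum>i\<in>F. (norm (coord x i))\<^sup>2) ((norm x)\<^sup>2) < e\<^sup>2"
    unfolding has_sum_def using assms by (intro tendstoD) auto
  then obtain F where F: "finite F" "dist (\<Sum>i\<in>F. (norm (coord x i))\<^sup>2) ((norm x)\<^sup>2) < e\<^sup>2"
    unfolding eventually_finite_subsets_at_top by blast
  define y where "y = (\<Sum>i\<in>F. basis_vec i \<otimes>\<^sub>v coord x i)"
  define s where "s = (\<Sum>i\<in>F. (norm (coord x i))\<^sup>2)"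
  have xy: "cinner x y = of_real s"
    by (simp add: y_def s_def cinner_sum_right cinner_basis_tensor_right cinner_self)
  have yy: "cinner y y = of_real s"
  proof -
    have "cinner y y = (\<Sum>i\<in>F. cinner (coord x i) (coord y i))"
      by (subst y_def) (simp add: cinner_sum_left cinner_basis_tensor_left)
    also have "\<dots> = (\<Sum>i\<in>F. cinner (coord x i) (coord x i))"
      by (rule sum.cong) (auto simp: y_def coord_sum coord_basis_tensor F sum.delta')
    finally show ?thesis
      by (simp add: s_def cinner_self)
  qed
  have "cinner y x = of_real s"
    using xy by (metis cinner_commute complex_cnj_complex_of_real)
  then have "complex_of_real ((norm (x - y))\<^sup>2) = of_real ((norm x)\<^sup>2 - s)"
    by (simp add: cinner_self [symmetric] cinner_diff_left cinner_diff_right xy yy del: of_real_power)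
  then have "(norm (x - y))\<^sup>2 = (norm x)\<^sup>2 - s"
    by (simp only: of_real_eq_iff)
  also have "\<dots> < e\<^sup>2"
    using F by (simp add: s_def dist_real_def abs_less_iff)
  finally have "norm (x - y) < e"
    using assms by (simp add: power_less_imp_less_base)
  then show thesis
    using F that unfolding y_def by blast
qed

text \<open>Against a finitely supported vector the pairing is a finite sum; the uniform bound
  absorbs the approximation of a general y.\<close>

lemma weak_tendsto_if_coord_tendsto:
  assumes bound: "\<And>m. norm (x m) \<le> C" and lim: "\<And>i. (\<lambda>m. coord (x m) i) \<longlonglongrightarrow> coord a i"
  shows "(\<lambda>m. cinner (x m) y) \<longlonglongrightarrow> cinner a y"
proof (rule LIMSEQ_I)
  fix e :: real
  assume e: "0 < e"
  \<comment> \<open>\<open>D\<close> bounds every norm (x m - a); the summand 1 makes it positive,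
    as the choice of \<open>F\<close> divides by it.\<close>
  define D where "D = C + norm a + 1"
  have D: "0 < D"
    using norm_ge_zero [of "x 0"] bound [of 0] norm_ge_zero [of a] unfolding D_def by linarith
  obtain F where F: "finite F" and yF: "norm (y - (\<Sum>i\<in>F. basis_vec i \<otimes>\<^sub>v coord y i)) < e / (2 * D)"
    by (rule ell2_finite_approx [of "e / (2 * D)" y]) (use e D in auto)
  define z where "z = (\<Sum>i\<in>F. basis_vec i \<otimes>\<^sub>v coord y i)"
  have "(\<lambda>m. \<Sum>i\<in>F. cinner (coord (x m) i) (coord y i)) \<longlonglongrightarrow> (\<Sum>i\<in>F. cinner (coord a i) (coord y i))"
    by (intro tendsto_sum bounded_linear.tendsto [OF bounded_linear_cinner_left] lim)
  then have "(\<lambda>m. cinner (x m) z) \<longlonglongrightarrow> cinner a z"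
    by (simp add: z_def cinner_sum_right cinner_basis_tensor_right)
  then obtain N where N: "\<And>m. N \<le> m \<Longrightarrow> norm (cinner (x m) z - cinner a z) < e / 2"
    using e by (meson LIMSEQ_D half_gt_zero)
  show "\<exists>no. \<forall>m\<ge>no. norm (cinner (x m) y - cinner a y) < e"
  proof (intro exI allI impI)
    fix m assume m: "N \<le> m"
    have "cinner (x m) y - cinner a y = (cinner (x m) z - cinner a z) + cinner (x m - a) (y - z)"
      by (simp add: cinner_diff_left cinner_diff_right)
    then have "norm (cinner (x m) y - cinner a y)
        \<le> norm (cinner (x m) z - cinner a z) + norm (cinner (x m - a) (y - z))"
      by (metis norm_triangle_ineq)
    moreover have "norm (cinner (x m - a) (y - z)) \<le> norm (x m - a) * norm (y - z)"
      by (rule cmod_cinner_le)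
    moreover have "norm (x m - a) * norm (y - z) \<le> D * (e / (2 * D))"
    proof (rule mult_mono)
      show "norm (x m - a) \<le> D"
        using norm_triangle_ineq4 [of "x m" a] bound [of m] by (simp add: D_def)
    qed (use yF D z_def in auto)
    moreover have "D * (e / (2 * D)) = e / 2"
      using D by simp
    ultimately show "norm (cinner (x m) y - cinner a y) < e"
      using N [OF m] by linarith
  qed
qed


section \<open>The weak operator topology\<close>

lemma topspace_wot: "topspace wot = {T. bounded_clinear T}"
proof
  show "topspace wot \<subseteq> {T. bounded_clinear T}"
    unfolding wot_def topology_generated_by_topspace by blast
  have "{T :: 'a \<Rightarrow> 'a. bounded_clinear T} = {T. bounded_clinear T \<and> cinner (T 0) 0 \<in> UNIV}"
    by simp
  also have "\<dots> \<in> {{T. bounded_clinear T \<and> cinner (T x) y \<in> U} | x y U. open U}"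
    using open_UNIV by blast
  finally show "{T :: 'a \<Rightarrow> 'a. bounded_clinear T} \<subseteq> topspace wot"
    unfolding wot_def topology_generated_by_topspace by blast
qed

lemma openin_wot_basic: "open U \<Longrightarrow> openin wot {T. bounded_clinear T \<and> cinner (T x) y \<in> U}"
  unfolding wot_def by (rule topology_generated_by_Basis) blast

lemma continuous_map_wot_cinner: "continuous_map wot euclidean (\<lambda>T. cinner (T x) y)"
  unfolding continuous_map_def topspace_wot by (auto simp: openin_wot_basic)

text \<open>This is the shape of the eigenvector identities for kernel vectors: both sides are
  WOT-continuous in T, so such an identity passes from generators to a WOT-closed hull.\<close>

lemma closedin_wot_eq:
  "closedin wot {T. bounded_clinear T \<and> cinner (T x) y = c * cinner (T x') y'}"
proof -
  have "continuous_map wot euclidean (\<lambda>T. cinner (T x) y - c * cinner (T x') y')"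
  proof (intro continuous_map_diff continuous_map_wot_cinner)
    have "continuous_map euclidean euclidean ((*) c)"
      by (simp add: continuous_on_mult_left)
    from continuous_map_compose [OF continuous_map_wot_cinner this]
    show "continuous_map wot euclidean (\<lambda>T. c * cinner (T x') y')"
      by (simp add: o_def)
  qed
  from closedin_continuous_map_preimage [OF this, of "{0}"]
  show ?thesis
    by (simp add: topspace_wot)
qed

lemma closedin_wot_bounded: "closedin wot {T. bounded_clinear T}"
  by (metis closedin_topspace topspace_wot)

text \<open>The convergence hypothesis speaks only about the subbasis. Induction over the generated
  open sets shows that the sequence eventually enters every open set around T, which would include
  the complement of \<open>\<B>\<close>.\<close>

lemma closedin_wot_sequentially:
  assumes B: "closedin wot \<B>" and mem: "\<And>m. S m \<in> \<B>" and T: "bounded_clinear T"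
    and lim: "\<And>x y. (\<lambda>m. cinner (S m x) y) \<longlonglongrightarrow> cinner (T x) y"
  shows "T \<in> \<B>"
proof (rule ccontr)
  assume "T \<notin> \<B>"
  have S: "bounded_clinear (S m)" for m
    using closedin_subset [OF B] mem [of m] unfolding topspace_wot by auto
  have ev: "T \<in> U \<longrightarrow> (\<forall>\<^sub>F m in sequentially. S m \<in> U)" if "openin wot U" for U
    using that unfolding wot_def openin_topology_generated_by_iff
  proof (induction U rule: generate_topology_on.induct)
    case (Int U V)
    then show ?case
      by (auto simp: eventually_conj_iff)
  next
    case (UN K)
    show ?case
    proof
      assume "T \<in> \<Union>K"
      then obtain X where X: "X \<in> K" "T \<in> X"
        by blast
      then have "\<forall>\<^sub>F m in sequentially. S m \<in> X"
        using UN.IH by blast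
      then show "\<forall>\<^sub>F m in sequentially. S m \<in> \<Union>K"
        by (rule eventually_mono) (use X in blast)
    qed
  next
    case (Basis V)
    then obtain x y U where V: "V = {T. bounded_clinear T \<and> cinner (T x) y \<in> U}" and U: "open U"
      by blast
    show ?case
      using topological_tendstoD [OF lim [of x y] U] S unfolding V by auto
  qed auto
  have "\<forall>\<^sub>F m in sequentially. S m \<in> topspace wot - \<B>"
    by (rule ev [THEN mp]) (use B T \<open>T \<notin> \<B>\<close> in \<open>auto simp: closedin_def topspace_wot\<close>)
  then show False
    using mem by (auto simp: eventually_sequentially)
qed

lemma closedin_wot_coordwise:
  fixes T :: "('i, 'k::chilbert) ell2 \<Rightarrow> ('i, 'k) ell2"
  assumes "closedin wot \<B>" "\<And>m. S m \<in> \<B>" "bounded_clinear T"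
    and "\<And>m x. norm (S m x) \<le> C * norm x" "\<And>x i. (\<lambda>m. coord (S m x) i) \<longlonglongrightarrow> coord (T x) i"
  shows "T \<in> \<B>"
  by (rule closedin_wot_sequentially [OF assms(1-3)])
    (rule weak_tendsto_if_coord_tendsto [OF assms(4,5)])

text \<open>The projection P is self-adjoint, so <P T P x, y> = <T (P x), P y> and preimages of
  subbasic sets are subbasic.\<close>

lemma continuous_map_wot_compression:
  assumes M: "csubspace M" "closed M"
  shows "continuous_map wot wot (compression M)"
  unfolding wot_def
proof (rule continuous_on_generated_topo)
  fix V assume "V \<in> {{T :: 'a \<Rightarrow> 'a. bounded_clinear T \<and> cinner (T x) y \<in> U} | x y U. open U}"
  then obtain x y U where V: "V = {T. bounded_clinear T \<and> cinner (T x) y \<in> U}" and U: "open U"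
    by blast
  have "compression M -` V \<inter> topspace wot
      = {T. bounded_clinear T \<and> cinner (T (proj M x)) (proj M y) \<in> U}"
    unfolding V topspace_wot using bounded_clinear_compression [OF M]
    by (auto simp: compression_def cinner_proj_left [OF M])
  then show "openin (topology_generated_by {{T :: 'a \<Rightarrow> 'a. bounded_clinear T \<and> cinner (T x) y \<in> U} | x y U. open U})
     (compression M -` V \<inter> topspace (topology_generated_by
       {{T :: 'a \<Rightarrow> 'a. bounded_clinear T \<and> cinner (T x) y \<in> U} | x y U. open U}))"
    using openin_wot_basic [OF U] unfolding wot_def by simp
next
  have "T \<in> topspace wot \<Longrightarrow> compression M T \<in> topspace wot" for T
    using bounded_clinear_compression [OF M] by (simp add: topspace_wot)
  then show "compression M ` topspace (topology_generated_by
      {{T :: 'a \<Rightarrow> 'a. bounded_clinear T \<and> cinner (T x) y \<in> U} | x y U. open U})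
    \<subseteq> \<Union> {{T :: 'a \<Rightarrow> 'a. bounded_clinear T \<and> cinner (T x) y \<in> U} | x y U. open U}"
    unfolding wot_def topology_generated_by_topspace by blast
qed

lemma operator_space_bounded: "operator_space {T. bounded_clinear T}"
  unfolding operator_space_def
  by (auto intro: bounded_clinear_const_zero bounded_clinear_plus bounded_clinear_scale)

lemma operator_space_sum:
  assumes B: "operator_space \<B>" and T: "\<And>i. i \<in> I \<Longrightarrow> T i \<in> \<B>"
  shows "(\<lambda>x. \<Sum>i\<in>I. T i x) \<in> \<B>"
  using T by (induction I rule: infinite_finite_induct) (use B in \<open>auto simp: operator_space_def\<close>)

lemma tensor_BK_bounded: "T \<in> tensor_BK \<A> \<Longrightarrow> bounded_clinear T"
  using hull_minimal [of _ "{T. bounded_clinear T}"] operator_space_bounded closedin_wot_bounded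
  unfolding tensor_BK_def by (smt (verit, best) mem_Collect_eq subset_iff)

section \<open>Sums over words\<close>

lemma finite_words_length: "finite {w :: 'n::finite list. length w = m}"
  using finite_lists_length_eq [of "UNIV :: 'n set" m] by simp

lemma finite_words_length_le: "finite {w :: 'n::finite list. length w \<le> m}"
  using finite_lists_length_le [of "UNIV :: 'n set" m] by simp

lemma sum_words_Suc:
  "(\<Sum>w | length w = Suc m. f w) = (\<Sum>l\<in>UNIV. \<Sum>v | length v = m. f (l # v))"
  for f :: "'n::finite list \<Rightarrow> 'a::comm_monoid_add"
proof -
  have eq: "{w :: 'n list. length w = Suc m} = (\<lambda>(l, v). l # v) ` (UNIV \<times> {v. length v = m})"
    by (auto simp: length_Suc_conv)
  have "(\<Sum>w | length w = Suc m. f w) = (\<Sum>(l, v)\<in>UNIV \<times> {v. length v = m}. f (l # v))"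
    unfolding eq by (subst sum.reindex) (auto simp: inj_on_def intro!: sum.cong)
  then show ?thesis
    by (simp add: sum.cartesian_product)
qed

lemma sum_words_le_Suc:
  "(\<Sum>w | length w \<le> Suc m. f w) = (\<Sum>w | length w \<le> m. f w) + (\<Sum>w | length w = Suc m. f w)"
  for f :: "'n::finite list \<Rightarrow> 'a::comm_monoid_add"
proof -
  have "{w :: 'n list. length w \<le> Suc m} = {w. length w \<le> m} \<union> {w. length w = Suc m}"
    by auto
  then show ?thesis
    by (simp add: sum.union_disjoint finite_words_length finite_words_length_le disjoint_iff)
qed

lemma sum_words_le:
  "(\<Sum>w | length w \<le> m. f w) = (\<Sum>d\<le>m. \<Sum>w | length w = d. f w)"
  for f :: "'n::finite list \<Rightarrow> 'a::comm_monoid_add"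
  by (induction m) (simp_all add: sum_words_le_Suc)

lemma finite_words_bounded:
  assumes "finite (F :: 'n list set)" obtains m where "F \<subseteq> {w. length w \<le> m}"
proof
  show "F \<subseteq> {w. length w \<le> Max (length ` F)}"
    using assms by auto
qed

text \<open>The sets of words of length at most m eventually contain every finite set, so an
  unordered sum can be computed level by level.\<close>

lemma has_sum_words_LIMSEQ:
  fixes f :: "'n::finite list \<Rightarrow> 'a::{comm_monoid_add,topological_space}"
  assumes "(f has_sum s) UNIV"
  shows "(\<lambda>m. \<Sum>w | length w \<le> m. f w) \<longlonglongrightarrow> s"
proof -
  have "filterlim (\<lambda>m. {w :: 'n list. length w \<le> m}) (finite_subsets_at_top UNIV) sequentially"
    unfolding filterlim_iff eventually_finite_subsets_at_top
  proof (intro allI impI)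
    fix P assume "\<exists>X. finite X \<and> X \<subseteq> (UNIV :: 'n list set) \<and>
      (\<forall>Y. finite Y \<and> X \<subseteq> Y \<and> Y \<subseteq> UNIV \<longrightarrow> P Y)"
    then obtain X :: "'n list set" where X: "finite X" "\<And>Y. finite Y \<Longrightarrow> X \<subseteq> Y \<Longrightarrow> P Y"
      by auto
    obtain m where m: "X \<subseteq> {w. length w \<le> m}"
      using finite_words_bounded [OF X(1)] by blast
    have "P {w. length w \<le> k}" if "m \<le> k" for k
      using m that by (intro X(2) finite_words_length_le) auto
    then show "\<forall>\<^sub>F k in sequentially. P {w. length w \<le> k}"
      by (auto simp: eventually_sequentially)
  qed
  with assms show ?thesis
    unfolding has_sum_def by (rule filterlim_compose)
qed

section \<open>Evaluation of words and kernel vectors\<close>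

lemma word_eval_Nil [simp]: "word_eval z [] = 1"
  and word_eval_Cons [simp]: "word_eval z (l # w) = z $ l * word_eval z w"
  by (simp_all add: word_eval_def)

text \<open>Splitting off the first letter factors the sum. Adding up the levels gives the geometric
  series behind the denominators 1 - <x, y>.\<close>

lemma sum_word_eval:
  "(\<Sum>w | length w = m. word_eval x w * cnj (word_eval y w)) = cvec_inner x y ^ m"
proof (induction m)
  case (Suc m)
  have "(\<Sum>w | length w = Suc m. word_eval x w * cnj (word_eval y w))
      = (\<Sum>l\<in>UNIV. \<Sum>v | length v = m. (x $ l * cnj (y $ l)) * (word_eval x v * cnj (word_eval y v)))"
    unfolding sum_words_Suc by (simp add: mult_ac)
  also have "\<dots> = cvec_inner x y * (\<Sum>v | length v = m. word_eval x v * cnj (word_eval y v))"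
    by (simp add: cvec_inner_def sum_product)
  finally show ?case
    by (simp add: Suc)
qed simp

lemma cvec_inner_self: "cvec_inner x x = of_real ((norm x)\<^sup>2)"
  unfolding cvec_inner_def norm_vec_def L2_set_def
  by (simp add: sum_nonneg complex_norm_square del: of_real_power)

lemma sum_norm_word_eval: "(\<Sum>w | length w = m. (cmod (word_eval z w))\<^sup>2) = (norm z ^ m)\<^sup>2"
proof -
  have "complex_of_real (\<Sum>w | length w = m. (cmod (word_eval z w))\<^sup>2) = of_real ((norm z ^ m)\<^sup>2)"
    using sum_word_eval [of z z m]
    by (simp add: complex_norm_square cvec_inner_self mult.commute
        del: of_real_power) (simp add: power_mult [symmetric] mult.commute)
  then show ?thesis
    by (simp only: of_real_eq_iff)
qed

lemma norm_cvec_inner_le: "cmod (cvec_inner x y) \<le> norm x * norm y"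
proof -
  have "cmod (cvec_inner x y) \<le> (\<Sum>i\<in>UNIV. \<bar>cmod (x $ i)\<bar> * \<bar>cmod (y $ i)\<bar>)"
    unfolding cvec_inner_def by (rule sum_norm_le) (simp add: norm_mult)
  also have "\<dots> \<le> norm x * norm y"
    unfolding norm_vec_def by (rule L2_set_mult_ineq)
  finally show ?thesis .
qed

lemma norm_cvec_inner_less: 
  assumes "norm x < 1" "norm y < 1" shows "cmod (cvec_inner x y) < 1"
proof -
  have "norm x * norm y < 1"
    using mult_left_mono [of "norm y" 1 "norm x"] assms by simp
  then show ?thesis
    using norm_cvec_inner_le [of x y] by linarith
qed

lemma sq_summable_word_eval:
  assumes z: "norm z < 1" shows "sq_summable (word_eval z)"
proof (rule sq_summable_if_bounded)
  fix F :: "'a list set"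
  assume "finite F"
  then obtain m where m: "F \<subseteq> {w. length w \<le> m}"
    using finite_words_bounded by blast
  have "(\<Sum>w\<in>F. (norm (word_eval z w))\<^sup>2) \<le> (\<Sum>w | length w \<le> m. (norm (word_eval z w))\<^sup>2)"
    by (rule sum_mono2) (use m finite_words_length_le in auto)
  also have "\<dots> = (\<Sum>d\<le>m. ((norm z)\<^sup>2) ^ d)"
    unfolding sum_words_le sum_norm_word_eval by (simp add: power_mult [symmetric] mult.commute)
  also have "\<dots> \<le> (\<Sum>d. ((norm z)\<^sup>2) ^ d)"
    by (rule sum_le_suminf) (use z in \<open>auto simp: abs_square_less_1 intro!: summable_geometric\<close>)
  finally show "(\<Sum>w\<in>F. (norm (word_eval z w))\<^sup>2) \<le> (\<Sum>d. ((norm z)\<^sup>2) ^ d)" .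
qed

text \<open>The reproducing kernel vector. Its coordinates are conjugated because
  \<open>cinner\<close> is antilinear in the second argument, so that pairing with it on the right
  evaluates at z.\<close>

definition kernel_vec :: "complex ^ 'n \<Rightarrow> ('n::finite, complex) fock"
  where "kernel_vec z = Abs_ell2 (\<lambda>w. cnj (word_eval z w))"

lemma coord_kernel_vec: "norm z < 1 \<Longrightarrow> coord (kernel_vec z) w = cnj (word_eval z w)"
  unfolding kernel_vec_def
  by (simp add: coord_Abs_ell2 sq_summable_bound [OF sq_summable_word_eval, where c = 1])

lemma cinner_kernel_vec:
  assumes x: "norm x < 1" and y: "norm y < 1"
  shows "cinner (kernel_vec x) (kernel_vec y) = 1 / (1 - cvec_inner y x)"
proof -
  have "((\<lambda>w. cinner (coord (kernel_vec x) w) (coord (kernel_vec y) w))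
      has_sum cinner (kernel_vec x) (kernel_vec y)) UNIV"
    unfolding cinner_ell2_def using summable_on_cinner_coord by (rule has_sum_infsum)
  from has_sum_words_LIMSEQ [OF this]
  have "(\<lambda>m. \<Sum>d\<le>m. cvec_inner y x ^ d) \<longlonglongrightarrow> cinner (kernel_vec x) (kernel_vec y)"
    by (simp add: coord_kernel_vec x y cinner_complex_def sum_words_le sum_word_eval [symmetric]
        mult.commute)
  moreover have "(\<lambda>d. cvec_inner y x ^ d) sums (1 / (1 - cvec_inner y x))"
    by (rule geometric_sums) (rule norm_cvec_inner_less [OF y x])
  ultimately show ?thesis
    unfolding sums_def_le using LIMSEQ_unique by blast
qed


section \<open>Creation by words\<close>

text \<open>The operator S_\<alpha> \<otimes> T. The two coefficient spaces may differ, since the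
  linear system maps states as well as inputs.\<close>

definition word_op :: "'n list \<Rightarrow> ('h \<Rightarrow> 'k) \<Rightarrow> ('n, 'h::chilbert) fock \<Rightarrow> ('n, 'k::chilbert) fock"
  where "word_op \<alpha> T u =
    Abs_ell2 (\<lambda>w. if take (length \<alpha>) w = \<alpha> then T (coord u (drop (length \<alpha>) w)) else 0)"

text \<open>Removing the prefix \<alpha> is injective on the words that have it, so after bounding T
  the sum runs over distinct coordinates of u.\<close>

lemma sum_word_op_le:
  assumes K: "\<And>x. norm (T x) \<le> K * norm x" "0 \<le> K" and F: "finite F"
  shows "(\<Sum>w\<in>F. (norm (if take (length \<alpha>) w = \<alpha> then T (coord u (drop (length \<alpha>) w)) else 0))\<^sup>2)
    \<le> (K * norm u)\<^sup>2"
proof -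
  let ?G = "{w\<in>F. take (length \<alpha>) w = \<alpha>}"
  have inj: "inj_on (drop (length \<alpha>)) ?G"
    by (rule inj_onI) (metis (mono_tags, lifting) append_take_drop_id mem_Collect_eq)
  have "(\<Sum>w\<in>F. (norm (if take (length \<alpha>) w = \<alpha> then T (coord u (drop (length \<alpha>) w)) else 0))\<^sup>2)
      = (\<Sum>w\<in>?G. (norm (T (coord u (drop (length \<alpha>) w))))\<^sup>2)"
    using F by (intro sum.mono_neutral_cong_right) auto
  also have "\<dots> \<le> (\<Sum>w\<in>?G. K\<^sup>2 * (norm (coord u (drop (length \<alpha>) w)))\<^sup>2)"
    by (intro sum_mono) (use K in \<open>metis norm_ge_zero power_mono power_mult_distrib\<close>)
  also have "\<dots> = K\<^sup>2 * (\<Sum>v\<in>drop (length \<alpha>) ` ?G. (norm (coord u v))\<^sup>2)"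
    by (simp add: sum.reindex [OF inj] sum_distrib_left)
  also have "\<dots> \<le> K\<^sup>2 * (norm u)\<^sup>2"
    using F by (intro mult_left_mono sum_norm_coord_le) auto
  finally show ?thesis
    by (simp add: power_mult_distrib)
qed

lemma coord_word_op:
  assumes "bounded_clinear T"
  shows "coord (word_op \<alpha> T u) w
    = (if take (length \<alpha>) w = \<alpha> then T (coord u (drop (length \<alpha>) w)) else 0)"
proof -
  obtain K where K: "0 < K" "\<And>x. norm (T x) \<le> K * norm x"
    using bounded_clinear_bound [OF assms] by blast
  have "sq_summable (\<lambda>w. if take (length \<alpha>) w = \<alpha> then T (coord u (drop (length \<alpha>) w)) else 0)"
    by (rule sq_summable_if_bounded) (rule sum_word_op_le, use K in auto)
  then show ?thesis
    by (simp add: word_op_def coord_Abs_ell2)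
qed

lemma bounded_clinear_word_op:
  assumes T: "bounded_clinear T" shows "bounded_clinear (word_op \<alpha> T)"
proof -
  obtain K where K: "0 < K" "\<And>x. norm (T x) \<le> K * norm x"
    using bounded_clinear_bound [OF assms] by blast
  show ?thesis
  proof (rule bounded_clinearI [where K = K])
    show "word_op \<alpha> T (x + y) = word_op \<alpha> T x + word_op \<alpha> T y" for x y
      by (rule ell2_eqI) (simp add: coord_word_op [OF T] plus_ell2.rep_eq bounded_clinear_add [OF T])
    show "word_op \<alpha> T (c *\<^sub>C x) = c *\<^sub>C word_op \<alpha> T x" for c x
      by (rule ell2_eqI) (simp add: coord_word_op [OF T] scaleC_ell2.rep_eq bounded_clinear_scaleC [OF T])
    show "norm (word_op \<alpha> T x) \<le> K * norm x" for x
      by (rule norm_ell2_le) (unfold coord_word_op [OF T], rule sum_word_op_le, use K in auto)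
  qed
qed

lemma word_op_compose:
  assumes S: "bounded_clinear S" and T: "bounded_clinear T"
  shows "word_op \<alpha> S (word_op \<beta> T u) = word_op (\<alpha> @ \<beta>) (\<lambda>x. S (T x)) u"
proof (rule ell2_eqI)
  fix w
  have "take (length \<alpha> + length \<beta>) w = \<alpha> @ \<beta> \<longleftrightarrow>
      take (length \<alpha>) w = \<alpha> \<and> take (length \<beta>) (drop (length \<alpha>) w) = \<beta>"
  proof
    assume eq: "take (length \<alpha> + length \<beta>) w = \<alpha> @ \<beta>"
    show "take (length \<alpha>) w = \<alpha> \<and> take (length \<beta>) (drop (length \<alpha>) w) = \<beta>"
      using arg_cong [OF eq, of "take (length \<alpha>)"] arg_cong [OF eq, of "drop (length \<alpha>)"]
      by (simp add: drop_take)
  qed (simp add: take_add)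
  then show "coord (word_op \<alpha> S (word_op \<beta> T u)) w = coord (word_op (\<alpha> @ \<beta>) (\<lambda>x. S (T x)) u) w"
    by (simp add: coord_word_op S T bounded_clinear_compose [OF S T] bounded_clinear_zero [OF S]
        add.commute [of "length \<beta>"])
qed

lemma word_op_simple_tensor:
  assumes T: "bounded_clinear T"
  shows "word_op \<alpha> T (g \<otimes>\<^sub>v h) = word_op \<alpha> (\<lambda>x. x) g \<otimes>\<^sub>v T h"
  by (rule ell2_eqI)
    (simp add: coord_word_op T bounded_clinear_ident simple_tensor.rep_eq bounded_clinear_scaleC [OF T])

lemma creation_eq_word_op: "creation i = word_op [i] (\<lambda>x. x)"
proof
  fix u show "creation i u = word_op [i] (\<lambda>x. x) u"
  proof (rule ell2_eqI)
    fix w show "coord (creation i u) w = coord (word_op [i] (\<lambda>x. x) u) w"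
      by (cases w) (auto simp: coord_word_op bounded_clinear_ident creation.rep_eq)
  qed
qed

lemma word_op_Nil: "word_op [] (\<lambda>x. x) = id"
  by (rule ext, rule ell2_eqI) (simp add: coord_word_op bounded_clinear_ident)

lemma word_op_Cons: "word_op (i # \<alpha>) (\<lambda>x. x) = creation i \<circ> word_op \<alpha> (\<lambda>x. x)"
  by (rule ext) (simp add: creation_eq_word_op word_op_compose bounded_clinear_ident)

lemma bounded_clinear_creation: "bounded_clinear (creation i)"
  by (simp add: creation_eq_word_op bounded_clinear_word_op bounded_clinear_ident)

lemma operator_algebra_comp: "operator_algebra \<A> \<Longrightarrow> S \<in> \<A> \<Longrightarrow> T \<in> \<A> \<Longrightarrow> S \<circ> T \<in> \<A>"
  by (simp add: operator_algebra_def)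

lemma creation_in_fock_algebra: "creation i \<in> fock_algebra"
  unfolding fock_algebra_def by (rule hull_inc) auto

lemma word_op_in_fock_algebra: "word_op \<alpha> (\<lambda>x. x) \<in> fock_algebra"
proof (induction \<alpha>)
  case Nil
  show ?case
    unfolding word_op_Nil fock_algebra_def by (rule hull_inc) auto
next
  case (Cons i \<alpha>)
  then show ?case
    unfolding word_op_Cons using creation_in_fock_algebra [of i]
    unfolding fock_algebra_def hull_def by (blast intro: operator_algebra_comp)
qed

section \<open>Kernel vectors and evaluation\<close>

lemma cinner_basis_vec: "cinner (basis_vec i) x = cnj (coord x i)"
proof -
  have "basis_vec i \<otimes>\<^sub>v (1 :: complex) = basis_vec i"
    by (rule ell2_eqI) (simp add: coord_basis_tensor basis_vec.rep_eq)
  then show ?thesis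
    using cinner_basis_tensor_left [of i "1 :: complex" x] by (simp add: cinner_complex_def)
qed

text \<open>Only words starting with i contribute, and on them the factor \<open>z $ i\<close>
  splits off: the kernel vector is an eigenvector of the adjoint creation operator.\<close>

lemma cinner_creation_kernel_vec:
  assumes z: "norm z < 1"
  shows "cinner (creation i g) (kernel_vec z) = z $ i * cinner g (kernel_vec z)"
proof -
  let ?f = "\<lambda>w. cinner (coord (creation i g) w) (coord (kernel_vec z) w)"
  have "cinner (creation i g) (kernel_vec z) = infsum ?f (range ((#) i))"
    unfolding cinner_ell2_def
    by (rule infsum_cong_neutral) (auto simp: creation.rep_eq image_iff split: list.splits)
  also have "\<dots> = (\<Sum>\<^sub>\<infinity>w. z $ i * cinner (coord g w) (coord (kernel_vec z) w))"
    by (subst infsum_reindex)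
      (auto simp: o_def creation.rep_eq coord_kernel_vec [OF z] cinner_complex_def intro!: infsum_cong)
  also have "\<dots> = z $ i * cinner g (kernel_vec z)"
    by (simp add: infsum_cmult_right' cinner_ell2_def)
  finally show ?thesis .
qed

text \<open>The kernel vector is an eigenvector of the adjoint of f. Writing the eigenvalue as a
  pairing with the image of \<open>basis_vec []\<close> makes the condition linear and WOT-closed in
  f, so it passes from the generators to the hull.\<close>

lemma fock_algebra_cinner_kernel_vec:
  assumes z: "norm z < 1" and f: "f \<in> fock_algebra"
  shows "cinner (f g) (kernel_vec z)
    = cinner g (kernel_vec z) * cinner (f (basis_vec [])) (kernel_vec z)"
proof -
  define \<A>' where "\<A>' g = {f. bounded_clinear f \<and> cinner (f g) (kernel_vec z)
    = cinner g (kernel_vec z) * cinner (f (basis_vec [])) (kernel_vec z)}" for g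
  \<comment> \<open>Each \<open>\<A>' g\<close> is a WOT-closed space, but closure under products
    needs all g at once: S is tested at T g.\<close>
  define \<A> where "\<A> = (\<Inter>g. \<A>' g)"
  have one: "cinner (basis_vec []) (kernel_vec z) = 1"
    by (simp add: cinner_basis_vec coord_kernel_vec z)
  have "operator_space (\<A>' g)" for g
    unfolding operator_space_def \<A>'_def
    by (auto simp: bounded_clinear_const_zero bounded_clinear_plus bounded_clinear_scale
        cinner_add_left cinner_scaleC_left distrib_left)
  then have "operator_space \<A>"
    unfolding operator_space_def \<A>_def by simp
  moreover have "S \<circ> T \<in> \<A>" if "S \<in> \<A>" "T \<in> \<A>" for S T
  proof -
    have mem: "S \<in> \<A>' g" "T \<in> \<A>' g" for g
      using that by (simp_all add: \<A>_def)
    have S: "cinner (S g) (kernel_vec z)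
        = cinner g (kernel_vec z) * cinner (S (basis_vec [])) (kernel_vec z)" for g
      using mem(1) [of g] unfolding \<A>'_def by blast
    have T: "cinner (T g) (kernel_vec z)
        = cinner g (kernel_vec z) * cinner (T (basis_vec [])) (kernel_vec z)" for g
      using mem(2) [of g] unfolding \<A>'_def by blast
    have "cinner (S (T g)) (kernel_vec z)
        = cinner g (kernel_vec z) * cinner (S (T (basis_vec []))) (kernel_vec z)" for g
      by (simp only: S [of "T g"] S [of "T (basis_vec [])"] T [of g] mult.assoc)
    moreover have "bounded_clinear (\<lambda>x. S (T x))"
      using mem [of undefined] by (simp add: \<A>'_def bounded_clinear_compose)
    ultimately show ?thesis
      unfolding \<A>_def \<A>'_def o_def by blast
  qed
  moreover have "closedin wot \<A>"
    unfolding \<A>_def \<A>'_def by (auto intro: closedin_Inter closedin_wot_eq)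
  moreover have "insert id (range creation) \<subseteq> \<A>"
    by (auto simp: \<A>_def \<A>'_def one cinner_creation_kernel_vec [OF z] bounded_clinear_creation
        bounded_clinear_ident id_def)
  ultimately have "fock_algebra \<subseteq> \<A>"
    unfolding fock_algebra_def by (intro hull_minimal) (auto simp: operator_algebra_def)
  then show ?thesis
    using f by (auto simp: \<A>_def \<A>'_def)
qed

lemma scalar_eval_eq: "norm z < 1 \<Longrightarrow> scalar_eval f z = cinner (f (basis_vec [])) (kernel_vec z)"
  by (simp add: scalar_eval_def cinner_ell2_def coord_kernel_vec cinner_complex_def)

lemma N_space_eq: "N_space J = ocompl {f \<phi> | f \<phi>. f \<in> J}"
  by (simp add: N_space_def ocompl_closure_cspan)

text \<open>The adjoint of f multiplies the kernel vector by the conjugate of f(z), which vanishes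
  for f in J.\<close>

lemma kernel_vec_in_N_space:
  assumes "J \<subseteq> fock_algebra" "z \<in> zero_set J"
  shows "kernel_vec z \<in> N_space J"
proof -
  have z: "norm z < 1" "\<And>f. f \<in> J \<Longrightarrow> scalar_eval f z = 0"
    using assms by (auto simp: zero_set_def)
  have "cinner (f \<phi>) (kernel_vec z) = 0" if "f \<in> J" for f \<phi>
    using fock_algebra_cinner_kernel_vec [OF z(1), of f \<phi>] that assms(1) z(2) [OF that]
    by (auto simp: scalar_eval_eq [OF z(1)])
  then show ?thesis
    unfolding N_space_eq ocompl_def by clarsimp (metis cinner_commute complex_cnj_zero)
qed

lemma has_sum_operator_eval:
  fixes T :: "('n::finite, 'k::chilbert) fock \<Rightarrow> ('n, 'k) fock"
  assumes z: "norm z < 1"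
  shows "((\<lambda>w. word_eval z w *\<^sub>C fourier_coeff T w h) has_sum operator_eval T z h) UNIV"
proof -
  have "(\<lambda>w. norm (word_eval z w *\<^sub>C fourier_coeff T w h)) summable_on UNIV"
    by (rule sq_summable_mult_bound [OF sq_summable_word_eval [OF z]
          sq_summable_coord [of "T (basis_vec [] \<otimes>\<^sub>v h)"]])
      (simp add: norm_scaleC fourier_coeff_def)
  then show ?thesis
    unfolding operator_eval_def by (rule has_sum_infsum [OF abs_summable_summable])
qed

lemma cinner_operator_eval:
  assumes z: "norm z < 1"
  shows "cinner (operator_eval T z h) k = cinner (T (basis_vec [] \<otimes>\<^sub>v h)) (kernel_vec z \<otimes>\<^sub>v k)"
proof -
  have "((\<lambda>w. cinner (word_eval z w *\<^sub>C fourier_coeff T w h) k) has_sum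
      cinner (operator_eval T z h) k) UNIV"
    by (rule has_sum_bounded_linear [OF bounded_linear_cinner_left has_sum_operator_eval [OF z]])
  then show ?thesis
    by (simp add: cinner_ell2_def simple_tensor.rep_eq coord_kernel_vec [OF z] fourier_coeff_def
        cinner_scaleC_left cinner_scaleC_right infsumI)
qed

text \<open>Weak form of the rule that the adjoint of \<Phi> maps z_\<lambda> \<otimes> k to
  z_\<lambda> \<otimes> \<Phi>(\<lambda>)^* k. On a generator f \<otimes> X it is the scalar
  relation times <X h, k>; the hull here is only a space, so g, h and k can stay fixed.\<close>

lemma tensor_BK_cinner_kernel_vec:
  fixes T :: "('n::finite, 'k::chilbert) fock \<Rightarrow> ('n, 'k) fock"
  assumes z: "norm z < 1" and T: "T \<in> tensor_BK fock_algebra"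
  shows "cinner (T (g \<otimes>\<^sub>v h)) (kernel_vec z \<otimes>\<^sub>v k)
    = cinner g (kernel_vec z) * cinner (operator_eval T z h) k"
proof -
  define \<B> :: "(('n, 'k) fock \<Rightarrow> ('n, 'k) fock) set"
    where "\<B> = {T. bounded_clinear T \<and> cinner (T (g \<otimes>\<^sub>v h)) (kernel_vec z \<otimes>\<^sub>v k)
    = cinner g (kernel_vec z) * cinner (T (basis_vec [] \<otimes>\<^sub>v h)) (kernel_vec z \<otimes>\<^sub>v k)}"
  have "tensor_BK fock_algebra \<subseteq> \<B>"
    unfolding tensor_BK_def
  proof (rule hull_minimal)
    show "operator_space \<B> \<and> closedin wot \<B>"
      unfolding operator_space_def \<B>_def
      by (auto simp: bounded_clinear_const_zero bounded_clinear_plus bounded_clinear_scale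
        cinner_add_left cinner_scaleC_left distrib_left closedin_wot_eq)
    show "{T. bounded_clinear T \<and> (\<exists>f\<in>fock_algebra. \<exists>X. bounded_clinear X \<and>
        (\<forall>g h. T (g \<otimes>\<^sub>v h) = f g \<otimes>\<^sub>v X h))} \<subseteq> \<B>"
    proof clarify
      fix T :: "('n, 'k) fock \<Rightarrow> ('n, 'k) fock" and f X
      assume "bounded_clinear T" "f \<in> fock_algebra" "\<forall>g h. T (g \<otimes>\<^sub>v h) = f g \<otimes>\<^sub>v X h"
      then show "T \<in> \<B>"
        using fock_algebra_cinner_kernel_vec [OF z, of f g]
        by (simp add: \<B>_def cinner_simple_tensor)
    qed
  qed
  then show ?thesis
    using T by (auto simp: \<B>_def cinner_operator_eval [OF z])
qed


section \<open>Constrained spaces\<close>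

lemma csubspace_N_space: "csubspace (N_space J)"
  and closed_N_space: "closed (N_space J)"
  by (simp_all add: N_space_def csubspace_ocompl closed_ocompl)

lemma csubspace_tensor_subspace: "csubspace (tensor_subspace N)"
  and closed_tensor_subspace: "closed (tensor_subspace N)"
  by (simp_all add: tensor_subspace_def csubspace_closure csubspace_cspan)

lemma tensor_in_tensor_subspace: "g \<in> N \<Longrightarrow> g \<otimes>\<^sub>v h \<in> tensor_subspace N"
  unfolding tensor_subspace_def
  by (rule subsetD [OF closure_subset subsetD [OF cspan_superset]]) auto

text \<open>Orthogonality to the tensor subspace reduces to its generating simple tensors, where the
  inner product factors.\<close>

lemma proj_tensor_subspace:
  assumes N: "csubspace N" "closed N"
  shows "proj (tensor_subspace N) (g \<otimes>\<^sub>v h) = proj N g \<otimes>\<^sub>v h"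
proof (rule projI [OF csubspace_tensor_subspace closed_tensor_subspace])
  show "proj N g \<otimes>\<^sub>v h \<in> tensor_subspace N"
    by (rule tensor_in_tensor_subspace [OF proj_in [OF N]])
  show "g \<otimes>\<^sub>v h - proj N g \<otimes>\<^sub>v h \<in> ocompl (tensor_subspace N)"
    unfolding tensor_subspace_def ocompl_closure_cspan
    using proj_diff [OF N, of g]
    by (auto simp: ocompl_def simple_tensor_diff_left [symmetric] cinner_simple_tensor)
qed

text \<open>With f also S_i f lies in J, so <S_i^* x, f \<phi>> = <x, S_i f \<phi>> = 0: the
  constrained space is co-invariant.\<close>

lemma cadjoint_creation_N_space:
  assumes J: "two_sided_ideal J fock_algebra" and x: "x \<in> N_space J"
  shows "cadjoint (creation i) x \<in> N_space J"
proof -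
  have "cinner (cadjoint (creation i) x) (f \<phi>) = 0" if "f \<in> J" for f \<phi>
  proof -
    have "creation i \<circ> f \<in> J"
      using J that creation_in_fock_algebra by (auto simp: two_sided_ideal_def)
    then have "cinner x ((creation i \<circ> f) \<phi>) = 0"
      using x unfolding N_space_eq ocompl_def by blast
    then show ?thesis
      by (simp add: cinner_cadjoint_left [OF bounded_clinear_creation])
  qed
  then show ?thesis
    unfolding N_space_eq ocompl_def by blast
qed

text \<open>Co-invariance gives P S_i = P S_i P, so compression is multiplicative when the left
  factor is a creation operator. This lets words be compressed letter by letter.\<close>

lemma compression_creation_comp:
  assumes J: "two_sided_ideal J fock_algebra" and T: "bounded_clinear T"
  shows "compression (N_space J) (creation i \<circ> T)
    = compression (N_space J) (creation i) \<circ> compression (N_space J) T"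
proof
  fix x
  note N = csubspace_N_space [of J] closed_N_space [of J]
  let ?P = "proj (N_space J)"
  have *: "?P (creation i y) = ?P (creation i (?P y))" for y
  proof (rule cinner_left_ext)
    fix w
    have 1: "cadjoint (creation i) (?P w) \<in> N_space J"
      by (rule cadjoint_creation_N_space [OF J proj_in [OF N]])
    have "cinner (?P (creation i y)) w = cinner y (?P (cadjoint (creation i) (?P w)))"
      by (simp add: cinner_proj_left [OF N] cinner_cadjoint_right [OF bounded_clinear_creation]
          proj_id [OF N 1])
    also have "\<dots> = cinner (?P (creation i (?P y))) w"
      by (simp add: cinner_proj_left [OF N] cinner_cadjoint_right [OF bounded_clinear_creation])
    finally show "cinner (?P (creation i y)) w = cinner (?P (creation i (?P y))) w" .
  qed
  show "compression (N_space J) (creation i \<circ> T) x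
    = (compression (N_space J) (creation i) \<circ> compression (N_space J) T) x"
    using * [of "T (?P x)"] by (simp add: compression_def proj_id [OF N proj_in [OF N]])
qed

lemma compression_word_op_in_constrained_algebra:
  assumes J: "two_sided_ideal J fock_algebra"
  shows "compression (N_space J) (word_op \<alpha> (\<lambda>x. x)) \<in> constrained_algebra J"
proof (induction \<alpha>)
  case Nil
  have "compression (N_space J) (word_op [] (\<lambda>x. x)) = proj (N_space J)"
    by (rule ext) (simp add: compression_def word_op_Nil
        proj_id [OF csubspace_N_space closed_N_space proj_in [OF csubspace_N_space closed_N_space]])
  then show ?case
    unfolding constrained_algebra_def by (auto intro: hull_inc)
next
  case (Cons i \<alpha>)
  have "constrained_shift J i \<in> constrained_algebra J"
    unfolding constrained_algebra_def by (rule hull_inc) auto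
  with Cons show ?case
    unfolding word_op_Cons constrained_shift_def
      compression_creation_comp [OF J bounded_clinear_word_op [OF bounded_clinear_ident]]
    unfolding constrained_algebra_def hull_def by (blast intro: operator_algebra_comp)
qed

section \<open>Necessity\<close>

definition pick_entry :: "(nat \<Rightarrow> complex ^ 'n::finite) \<Rightarrow> (nat \<Rightarrow> 'k::chilbert \<Rightarrow> 'k) \<Rightarrow> nat \<Rightarrow> nat \<Rightarrow> 'k \<Rightarrow> 'k"
  where "pick_entry z A i j h =
    (1 / (1 - cvec_inner (z i) (z j))) *\<^sub>C (h - A i (cadjoint (A j) h))"

lemma bounded_clinear_pick_entry:
  assumes "bounded_clinear (A i)" "bounded_clinear (A j)"
  shows "bounded_clinear (pick_entry z A i j)"
  unfolding pick_entry_def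
  by (rule bounded_clinear_scale, rule bounded_clinear_minus [OF bounded_clinear_ident],
      rule bounded_clinear_compose [OF assms(1) bounded_clinear_cadjoint [OF assms(2)]])

lemma cinner_pick_entry:
  assumes "bounded_clinear (A i)"
  shows "cinner (pick_entry z A i j h) k = (cinner h k - cinner (cadjoint (A j) h) (cadjoint (A i) k))
    / (1 - cvec_inner (z i) (z j))"
  using cinner_cadjoint_right [OF assms]
  by (simp add: pick_entry_def cinner_scaleC_left cinner_diff_left)

lemma cinner_sum_tensor:
  "cinner (\<Sum>j\<in>I. f j \<otimes>\<^sub>v h j) (\<Sum>i\<in>I. g i \<otimes>\<^sub>v k i)
    = (\<Sum>i\<in>I. \<Sum>j\<in>I. cinner (f j) (g i) * cinner (h j) (k i))"
  by (simp add: cinner_sum_right cinner_sum_left cinner_simple_tensor)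

text \<open>The factors 1 / (1 - <z_i, z_j>) form the Gram matrix of the kernel vectors, and inner
  products of simple tensors factor, so the Pick form is a difference of two squared norms.\<close>

lemma pick_form_eq:
  fixes h :: "nat \<Rightarrow> 'k::chilbert"
  assumes z: "\<And>j. j \<in> I \<Longrightarrow> norm (z j) < 1" and A: "\<And>j. j \<in> I \<Longrightarrow> bounded_clinear (A j)"
  defines "x \<equiv> \<Sum>j\<in>I. kernel_vec (z j) \<otimes>\<^sub>v h j"
    and "y \<equiv> \<Sum>j\<in>I. kernel_vec (z j) \<otimes>\<^sub>v cadjoint (A j) (h j)"
  shows "(\<Sum>i\<in>I. cinner (\<Sum>j\<in>I. pick_entry z A i j (h j)) (h i))
    = of_real ((norm x)\<^sup>2 - (norm y)\<^sup>2)"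
proof -
  have "(\<Sum>i\<in>I. cinner (\<Sum>j\<in>I. pick_entry z A i j (h j)) (h i)) = cinner x x - cinner y y"
    unfolding x_def y_def cinner_sum_tensor sum_subtractf [symmetric]
    by (auto simp: cinner_sum_left cinner_pick_entry A cinner_kernel_vec z diff_divide_distrib
        intro!: sum.cong)
  then show ?thesis
    by (simp add: cinner_self)
qed

lemma positive_operator_matrix_if_interpolant:
  fixes \<Phi> :: "('n::finite, 'k::chilbert) fock \<Rightarrow> ('n, 'k) fock"
  assumes J: "two_sided_ideal J fock_algebra"
    and z: "\<And>j. j \<in> I \<Longrightarrow> z j \<in> zero_set J"
    and A: "\<And>j. j \<in> I \<Longrightarrow> bounded_clinear (A j)"
    and \<Phi>: "\<Phi> \<in> tensor_BK fock_algebra"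
    and le: "onorm (compression (tensor_subspace (N_space J)) \<Phi>) \<le> 1"
    and ev: "\<And>j. j \<in> I \<Longrightarrow> operator_eval \<Phi> (z j) = A j"
  shows "positive_operator_matrix I (pick_entry z A)"
proof -
  let ?M = "tensor_subspace (N_space J) :: ('n, 'k) fock set"
  note M = csubspace_tensor_subspace [of "N_space J"] closed_tensor_subspace [of "N_space J"]
  have z1: "norm (z j) < 1" if "j \<in> I" for j
    using z [OF that] by (simp add: zero_set_def)
  have bc: "bounded_clinear \<Phi>"
    by (rule tensor_BK_bounded [OF \<Phi>])
  have kv: "kernel_vec (z j) \<in> N_space J" if "j \<in> I" for j
    using J z [OF that] by (intro kernel_vec_in_N_space) (auto simp: two_sided_ideal_def)
  have "norm (\<Sum>j\<in>I. kernel_vec (z j) \<otimes>\<^sub>v cadjoint (A j) (h j))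
      \<le> norm (\<Sum>j\<in>I. kernel_vec (z j) \<otimes>\<^sub>v h j)" for h
  proof -
    define x where "x = (\<Sum>j\<in>I. kernel_vec (z j) \<otimes>\<^sub>v h j)"
    define y where "y = (\<Sum>j\<in>I. kernel_vec (z j) \<otimes>\<^sub>v cadjoint (A j) (h j))"
    have xM: "x \<in> ?M" and yM: "y \<in> ?M"
      unfolding x_def y_def
      by (rule csubspace_sum [OF M(1)], rule tensor_in_tensor_subspace, rule kv, assumption)+
    have "cinner (compression ?M \<Phi> y) x = cinner (\<Phi> y) x"
      by (simp add: compression_def cinner_proj_left [OF M] proj_id [OF M xM] proj_id [OF M yM])
    also have "\<dots> = (\<Sum>i\<in>I. \<Sum>j\<in>I. cinner (\<Phi> (kernel_vec (z j) \<otimes>\<^sub>v cadjoint (A j) (h j)))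
        (kernel_vec (z i) \<otimes>\<^sub>v h i))"
      by (simp add: x_def y_def bounded_clinear_sum [OF bc] cinner_sum_left cinner_sum_right)
    \<comment> \<open>The adjoint of \<Phi> takes x to y, so the contraction bound yields |y|^2
      \<le> |y| |x|.\<close>
    also have "\<dots> = cinner y y"
      unfolding y_def cinner_sum_tensor
      by (auto simp: tensor_BK_cinner_kernel_vec [OF z1 \<Phi>] ev cinner_cadjoint_right [OF A]
          intro!: sum.cong)
    finally have "(norm y)\<^sup>2 = cmod (cinner (compression ?M \<Phi> y) x)"
      by (simp add: cinner_self norm_power)
    also have "\<dots> \<le> norm (compression ?M \<Phi> y) * norm x"
      by (rule cmod_cinner_le)
    also have "\<dots> \<le> norm y * norm x"
    proof (rule mult_right_mono)
      have "norm (compression ?M \<Phi> y) \<le> onorm (compression ?M \<Phi>) * norm y"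
        by (rule onorm [OF bounded_clinear_linear [OF bounded_clinear_compression [OF M bc]]])
      also have "\<dots> \<le> 1 * norm y"
        using le by (rule mult_right_mono) simp
      finally show "norm (compression ?M \<Phi> y) \<le> norm y"
        by simp
    qed simp
    finally show "norm y \<le> norm x"
      by (cases "y = 0") (auto simp: power2_eq_square)
  qed
  then have "0 \<le> (norm (\<Sum>j\<in>I. kernel_vec (z j) \<otimes>\<^sub>v h j))\<^sup>2
      - (norm (\<Sum>j\<in>I. kernel_vec (z j) \<otimes>\<^sub>v cadjoint (A j) (h j)))\<^sup>2" for h
    by (simp add: power_mono)
  then show ?thesis
    unfolding positive_operator_matrix_def Let_def
    by (subst (1 2) pick_form_eq [OF z1 A]) (simp_all del: of_real_diff)
qed


section \<open>Square roots of positive operators\<close>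

text \<open>Polarisation: testing at x + y and at x + i y shows that a + b and i (b - a) are real,
  which forces a to be the conjugate of b.\<close>

lemma cinner_symmetric_if_real:
  assumes T: "bounded_clinear T" and real: "\<And>x. cinner (T x) x \<in> \<real>"
  shows "cinner (T x) y = cinner x (T y)"
proof -
  define a b where "a = cinner (T x) y" and "b = cinner (T y) x"
  have "cinner (T (x + y)) (x + y) = cinner (T x) x + cinner (T y) y + (a + b)"
    by (simp add: a_def b_def bounded_clinear_add [OF T] cinner_add_left cinner_add_right)
  then have "a + b \<in> \<real>"
    by (metis Reals_add Reals_diff add_diff_cancel_left' real)
  moreover have "cinner (T (x + \<i> *\<^sub>C y)) (x + \<i> *\<^sub>C y)
      = cinner (T x) x + cinner (T y) y + \<i> * (b - a)"
    by (simp add: a_def b_def bounded_clinear_add [OF T] bounded_clinear_scaleC [OF T]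
        cinner_add_left cinner_add_right cinner_scaleC_left cinner_scaleC_right algebra_simps)
  then have "\<i> * (b - a) \<in> \<real>"
    by (metis Reals_add Reals_diff add_diff_cancel_left' real)
  ultimately have "a = cnj b"
    by (auto simp: complex_is_Real_iff complex_eq_iff)
  then show ?thesis
    unfolding a_def b_def by (metis cinner_commute)
qed

text \<open>The scalar majorant of the operator iteration for square roots: it increases, because (1
  - b)^2 \<ge> 0, and stays in [0, 1].\<close>

lemma scalar_sqrt_iteration:
  defines "b \<equiv> rec_nat (0 :: real) (\<lambda>_ x. (1 + x\<^sup>2) / 2)"
  shows "0 \<le> b n" "b n \<le> 1" "Cauchy b"
proof -
  have S: "b (Suc n) = (1 + (b n)\<^sup>2) / 2" for n
    by (simp add: b_def)
  have bd: "0 \<le> b n \<and> b n \<le> 1" for n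
  proof (induction n)
    case (Suc n)
    then show ?case
      using power_le_one [of "b n" 2] by (simp add: S)
  qed (simp add: b_def)
  then show "0 \<le> b n" "b n \<le> 1"
    by auto
  have "incseq b"
  proof (rule incseq_SucI)
    show "b n \<le> b (Suc n)" for n
      using zero_le_power2 [of "1 - b n"] unfolding S by (simp add: power2_diff)
  qed
  then show "Cauchy b"
    using bd by (metis LIMSEQ_imp_Cauchy incseq_convergent)
qed

text \<open>For \<open>0 \<le> T \<le> I\<close> the iteration \<open>B \<mapsto> ((I - T) + B\<^sup>2) / 2\<close>, dominated by the scalar
  iteration with \<open>T = 0\<close>, converges in norm to some \<open>L\<close> with \<open>(I - L)\<^sup>2 = T\<close>.\<close>

lemma sqrt_contraction_exists:
  fixes T :: "'a::chilbert \<Rightarrow> 'a"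
  assumes T: "bounded_clinear T" and real: "\<And>x. cinner (T x) x \<in> \<real>"
    and pos: "\<And>x. 0 \<le> Re (cinner (T x) x)" and le: "\<And>x. norm (T x) \<le> norm x"
  obtains R :: "'a \<Rightarrow> 'a" where "bounded_clinear R" "\<And>x y. cinner (R x) (R y) = cinner (T x) y"
proof -
  have sym: "cinner (T x) y = cinner x (T y)" for x y
    by (rule cinner_symmetric_if_real [OF T real])
  have isym: "inner (T x) y = inner x (T y)" for x y
    by (simp add: inner_eq_Re_cinner sym)
  \<comment> \<open>This is T^2 \<le> T, from positivity of T at x - T x. It yields the bound 1 for
    I - T in \<open>le1\<close>, where the triangle inequality would give only 2.\<close>
  have Tsq: "(norm (T x))\<^sup>2 \<le> inner (T x) x" for x
  proof -
    have "0 \<le> inner (T (x - T x)) (x - T x)"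
      using pos by (simp add: inner_eq_Re_cinner)
    also have "\<dots> = inner (T x) x - 2 * (norm (T x))\<^sup>2 + inner (T (T x)) (T x)"
      using isym [of "T x" x]
      by (simp add: bounded_clinear_diff [OF T] inner_diff_left inner_diff_right power2_norm_eq_inner)
    finally have "2 * (norm (T x))\<^sup>2 \<le> inner (T x) x + inner (T (T x)) (T x)"
      by simp
    moreover have "inner (T (T x)) (T x) \<le> norm (T x) * norm (T x)"
      using norm_cauchy_schwarz [of "T (T x)" "T x"] mult_right_mono [OF le [of "T x"], of "norm (T x)"]
      by simp
    ultimately show ?thesis
      by (simp add: power2_eq_square)
  qed
  have le1: "norm (x - T x) \<le> norm x" for x
  proof -
    have "(norm (x - T x))\<^sup>2 = (norm x)\<^sup>2 - 2 * inner (T x) x + (norm (T x))\<^sup>2"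
      unfolding power2_norm_eq_inner by (simp add: inner_diff_left inner_diff_right inner_commute)
    also have "\<dots> \<le> (norm x)\<^sup>2"
      using Tsq [of x] zero_le_power2 [of "norm (T x)"] by linarith
    finally show ?thesis
      by (simp add: power2_le_iff_abs_le)
  qed
  have bl: "bounded_linear (\<lambda>x. x - T x)"
    by (intro bounded_linear_sub bounded_linear_ident bounded_clinear_linear T)
  define A where "A = Blinfun (\<lambda>x. x - T x)"
  have A: "blinfun_apply A x = x - T x" for x
    by (simp add: A_def bounded_linear_Blinfun_apply [OF bl])
  have normA: "norm A \<le> 1"
    by (rule norm_blinfun_bound) (simp_all add: A le1)
  define B where "B = rec_nat (0 :: 'a \<Rightarrow>\<^sub>L 'a) (\<lambda>_ X. (1/2) *\<^sub>R (A + (X o\<^sub>L X)))"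
  have B0: "B 0 = 0" and BS: "B (Suc n) = (1/2) *\<^sub>R (A + (B n o\<^sub>L B n))" for n
    by (simp_all add: B_def)
  define b where "b = rec_nat (0 :: real) (\<lambda>_ x. (1 + x\<^sup>2) / 2)"
  have b0: "b 0 = 0" and bS: "b (Suc n) = (1 + (b n)\<^sup>2) / 2" for n
    by (simp_all add: b_def)
  note b = scalar_sqrt_iteration [folded b_def]
  have comp: "norm (X o\<^sub>L Y) \<le> norm X * norm Y" for X Y :: "'a \<Rightarrow>\<^sub>L 'a"
    by (rule norm_blinfun_compose)
  have normB: "norm (B n) \<le> b n" for n
  proof (induction n)
    case (Suc n)
    have "norm (B n o\<^sub>L B n) \<le> (b n)\<^sup>2"
      using comp [of "B n" "B n"] mult_mono [OF Suc Suc b(1)] by (simp add: power2_eq_square)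
    then have "norm (A + (B n o\<^sub>L B n)) \<le> 1 + (b n)\<^sup>2"
      using norm_triangle_ineq [of A "B n o\<^sub>L B n"] normA by linarith
    then show ?case
      by (simp add: BS bS)
  qed (simp add: B0 b0)
  have step: "norm (B (Suc n) - B n) \<le> b (Suc n) - b n" for n
  proof (induction n)
    case 0
    show ?case
      using normA by (simp add: B0 b0 BS bS)
  next
    case (Suc n)
    \<comment> \<open>X^2 - Y^2 = X (X - Y) + (X - Y) Y holds without commutativity, and the scalar
      iteration obeys the same identity, so its increments dominate.\<close>
    have "B (Suc (Suc n)) - B (Suc n)
        = (1/2) *\<^sub>R ((B (Suc n) o\<^sub>L (B (Suc n) - B n)) + ((B (Suc n) - B n) o\<^sub>L B n))"
      unfolding BS [of "Suc n"] BS [of n, THEN arg_cong, of "\<lambda>X. _ - X"]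
      by (simp add: scaleR_diff_right [symmetric] bounded_bilinear.diff_left [OF bounded_bilinear_blinfun_compose]
        bounded_bilinear.diff_right [OF bounded_bilinear_blinfun_compose])
    then have "norm (B (Suc (Suc n)) - B (Suc n))
        \<le> (1/2) * (norm (B (Suc n) o\<^sub>L (B (Suc n) - B n)) + norm ((B (Suc n) - B n) o\<^sub>L B n))"
      using norm_triangle_ineq [of "B (Suc n) o\<^sub>L (B (Suc n) - B n)" "(B (Suc n) - B n) o\<^sub>L B n"]
      by simp
    also have "\<dots> \<le> (1/2) * (b (Suc n) * (b (Suc n) - b n) + (b (Suc n) - b n) * b n)"
    proof -
      have "norm (B (Suc n) o\<^sub>L (B (Suc n) - B n)) \<le> b (Suc n) * (b (Suc n) - b n)"
        by (rule order_trans [OF comp]) (rule mult_mono [OF normB Suc b(1) norm_ge_zero])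
      moreover have "norm ((B (Suc n) - B n) o\<^sub>L B n) \<le> (b (Suc n) - b n) * b n"
        by (rule order_trans [OF comp])
          (rule mult_mono [OF Suc normB order_trans [OF norm_ge_zero Suc] norm_ge_zero])
      ultimately show ?thesis
        by simp
    qed
    also have "\<dots> = b (Suc (Suc n)) - b (Suc n)"
      unfolding bS [of "Suc n"] bS [of n, THEN arg_cong, of "\<lambda>x. _ - x"]
      by (simp add: power2_eq_square algebra_simps)
    finally show ?case .
  qed
  have gap: "norm (B (n + k) - B n) \<le> b (n + k) - b n" for n k
  proof (induction k)
    case (Suc k)
    have "norm (B (n + Suc k) - B n) \<le> norm (B (Suc (n + k)) - B (n + k)) + norm (B (n + k) - B n)"
      using norm_triangle_ineq [of "B (Suc (n + k)) - B (n + k)" "B (n + k) - B n"] by simp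
    then show ?case
      using step [of "n + k"] Suc by simp
  qed simp
  have "Cauchy B"
  proof (rule CauchyI')
    fix e :: real
    assume "0 < e"
    then obtain N where N: "\<And>m n. N \<le> m \<Longrightarrow> N \<le> n \<Longrightarrow> norm (b m - b n) < e"
      using CauchyD [OF b(3)] by blast
    show "\<exists>M. \<forall>m\<ge>M. \<forall>n>m. dist (B m) (B n) < e"
    proof (intro exI allI impI)
      fix m n :: nat assume mn: "N \<le> m" "m < n"
      then have "norm (B n - B m) \<le> b n - b m"
        using gap [of m "n - m"] by simp
      then show "dist (B m) (B n) < e"
        using N [of n m] mn by (simp add: dist_norm norm_minus_commute)
    qed
  qed
  then obtain L where L: "B \<longlonglongrightarrow> L"
    by (auto simp: Cauchy_convergent_iff convergent_def)
  have "(\<lambda>n. B (Suc n)) \<longlonglongrightarrow> (1/2) *\<^sub>R (A + (L o\<^sub>L L))"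
    unfolding BS by (intro tendsto_intros bounded_bilinear.tendsto [OF bounded_bilinear_blinfun_compose] L)
  then have "L = (1/2) *\<^sub>R (A + (L o\<^sub>L L))"
    by (rule LIMSEQ_unique [OF LIMSEQ_Suc [OF L]])
  then have "2 *\<^sub>R L = A + (L o\<^sub>L L)"
    by (metis scaleR_half_double scaleR_2 scaleR_add_right)
  then have fix2: "2 *\<^sub>R blinfun_apply L x = (x - T x) + blinfun_apply L (blinfun_apply L x)" for x
    by (metis A blinfun.add_left blinfun.scaleR_left blinfun_apply_blinfun_compose)
  have Lx: "(\<lambda>n. blinfun_apply (B n) x) \<longlonglongrightarrow> blinfun_apply L x" for x
    by (intro blinfun.tendsto L tendsto_const)
  \<comment> \<open>The iteration lives among real-linear operators; complex linearity and symmetry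
    are proved for each iterate and passed to the limit.\<close>
  have Bc: "blinfun_apply (B n) (c *\<^sub>C x) = c *\<^sub>C blinfun_apply (B n) x" for n c x
  proof (induction n arbitrary: x)
    case (Suc n)
    then show ?case
      by (simp add: BS blinfun.add_left blinfun.scaleR_left A bounded_clinear_scaleC [OF T]
          scaleC_diff_right [symmetric] scaleC_add_right [symmetric] scaleR_scaleC scaleC_scaleC mult.commute)
  qed (simp add: B0)
  have Bs: "cinner (blinfun_apply (B n) x) y = cinner x (blinfun_apply (B n) y)" for n x y
  proof (induction n arbitrary: x y)
    case (Suc n)
    show ?case
      by (simp add: BS blinfun.add_left blinfun.scaleR_left A cinner_add_left cinner_add_right
          cinner_scaleR_left cinner_scaleR_right cinner_diff_left cinner_diff_right sym Suc)
  qed (simp add: B0)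
  have Lc: "blinfun_apply L (c *\<^sub>C x) = c *\<^sub>C blinfun_apply L x" for c x
    using Lx [of "c *\<^sub>C x"] bounded_linear.tendsto [OF bounded_linear_scaleC Lx, of c x]
    unfolding Bc by (rule LIMSEQ_unique)
  have Ls: "cinner (blinfun_apply L x) y = cinner x (blinfun_apply L y)" for x y
    using bounded_linear.tendsto [OF bounded_linear_cinner_left [of y] Lx [of x]]
      bounded_linear.tendsto [OF bounded_linear_cinner_right [of x] Lx [of y]]
    unfolding Bs by (rule LIMSEQ_unique)
  have Lbc: "bounded_clinear (blinfun_apply L)"
    unfolding bounded_clinear_def using Lc blinfun.bounded_linear_right by auto
  show thesis
  proof (rule that)
    show "bounded_clinear (\<lambda>x. x - blinfun_apply L x)"
      by (rule bounded_clinear_minus [OF bounded_clinear_ident Lbc])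
    show "cinner (x - blinfun_apply L x) (y - blinfun_apply L y) = cinner (T x) y" for x y
    proof -
      have "cinner (x - blinfun_apply L x) (y - blinfun_apply L y)
          = cinner (x - 2 *\<^sub>R blinfun_apply L x + blinfun_apply L (blinfun_apply L x)) y"
        by (simp add: scaleR_2 cinner_diff_left cinner_diff_right cinner_add_left Ls)
      also have "x - 2 *\<^sub>R blinfun_apply L x + blinfun_apply L (blinfun_apply L x) = T x"
        by (simp add: fix2)
      finally show ?thesis .
    qed
  qed
qed

lemma positive_sqrt_exists:
  fixes T :: "'a::chilbert \<Rightarrow> 'a"
  assumes T: "bounded_clinear T" and real: "\<And>x. cinner (T x) x \<in> \<real>"
    and pos: "\<And>x. 0 \<le> Re (cinner (T x) x)"
  obtains R :: "'a \<Rightarrow> 'a" where "bounded_clinear R" "\<And>x y. cinner (R x) (R y) = cinner (T x) y"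
proof -
  obtain K where K: "0 < K" "\<And>x. norm (T x) \<le> K * norm x"
    using bounded_clinear_bound [OF T] by blast
  define T' where "T' x = complex_of_real (1 / K) *\<^sub>C T x" for x
  obtain R :: "'a \<Rightarrow> 'a" where R: "bounded_clinear R" "\<And>x y. cinner (R x) (R y) = cinner (T' x) y"
  proof (rule sqrt_contraction_exists [of T'])
    show "bounded_clinear T'"
      unfolding T'_def by (rule bounded_clinear_scale [OF T])
    show "cinner (T' x) x \<in> \<real>" "0 \<le> Re (cinner (T' x) x)" for x
      using K real [of x] pos [of x]
      by (auto simp: T'_def cinner_scaleC_left complex_is_Real_iff)
    show "norm (T' x) \<le> norm x" for x
      using K by (simp add: T'_def norm_scaleC norm_divide divide_le_eq mult.commute)
  qed blast
  show thesis
  proof (rule that)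
    show "bounded_clinear (\<lambda>x. complex_of_real (sqrt K) *\<^sub>C R x)"
      by (rule bounded_clinear_scale [OF R(1)])
    show "cinner (complex_of_real (sqrt K) *\<^sub>C R x) (complex_of_real (sqrt K) *\<^sub>C R y) = cinner (T x) y"
      for x y
    proof -
      have "complex_of_real (sqrt K) * complex_of_real (sqrt K) = complex_of_real K"
        using K by (metis of_real_mult real_sqrt_mult_self abs_of_pos)
      then show ?thesis
        using K by (simp add: cinner_scaleC_left cinner_scaleC_right R(2) T'_def mult.assoc [symmetric])
    qed
  qed
qed

section \<open>Transfer functions on words\<close>

lemma norm_prod_sq: "(norm x)\<^sup>2 = (norm (fst x))\<^sup>2 + (norm (snd x))\<^sup>2"
  by (simp add: norm_prod_def)

lemma norm_fst_le: "norm (fst x) \<le> norm x" and norm_snd_le: "norm (snd x) \<le> norm x"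
  by (simp_all add: norm_prod_def real_le_rsqrt)

lemma norm_ell2_finite_sq: "(norm x)\<^sup>2 = (\<Sum>l\<in>UNIV. (norm (coord x l))\<^sup>2)"
  for x :: "('n::finite, 'h::chilbert) ell2"
  by (simp add: norm_ell2_sq)

lemma bounded_clinear_fst: "bounded_clinear fst" and bounded_clinear_snd: "bounded_clinear snd"
  by (rule bounded_clinearI [where K = 1]; simp add: scaleC_prod_def norm_fst_le norm_snd_le)+

lemma bounded_clinear_Pair:
  assumes S: "bounded_clinear S" and T: "bounded_clinear T"
  shows "bounded_clinear (\<lambda>x. (S x, T x))"
  unfolding bounded_clinear_def
  using bounded_linear_Pair [OF bounded_clinear_linear [OF S] bounded_clinear_linear [OF T]]
  by (simp add: scaleC_prod_def bounded_clinear_scaleC [OF S] bounded_clinear_scaleC [OF T])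

lemma norm_word_op_le:
  assumes "bounded_clinear T" "\<And>x. norm (T x) \<le> norm x"
  shows "norm (word_op \<alpha> T u) \<le> norm u"
proof (rule norm_ell2_le)
  show "(\<Sum>w\<in>F. (norm (coord (word_op \<alpha> T u) w))\<^sup>2) \<le> (norm u)\<^sup>2" if "finite F" for F
    using sum_word_op_le [of T 1 F \<alpha> u] assms that by (simp add: coord_word_op)
qed simp

text \<open>The word is consumed from its right end: l selects a component of the state produced at
  v. The output at w thus depends on the inputs at suffixes of w, as it does for combinations of
  left creations.\<close>

primrec state_at :: "('h \<times> 'k \<Rightarrow> ('n, 'h) ell2 \<times> 'k) \<Rightarrow> ('n list \<Rightarrow> 'k) \<Rightarrow> 'n list \<Rightarrow> 'h::chilbert"
where
  "state_at U u [] = 0"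
| "state_at U u (l # v) = coord (fst (U (state_at U u v, u v))) l"

definition response :: "('h \<times> 'k \<Rightarrow> ('n, 'h::chilbert) ell2 \<times> 'k) \<Rightarrow> ('n list \<Rightarrow> 'k) \<Rightarrow> 'n list \<Rightarrow> 'k"
  where "response U u w = snd (U (state_at U u w, u w))"

definition transfer_op ::
    "('h \<times> 'k \<Rightarrow> ('n, 'h::chilbert) ell2 \<times> 'k) \<Rightarrow> ('n, 'k::chilbert) fock \<Rightarrow> ('n, 'k) fock"
  where "transfer_op U u = Abs_ell2 (response U (coord u))"

text \<open>The state is a fixed point x = \<Sum>_l S_l (F_l x + G_l u), with F_l and G_l the
  components of U; this is its m-fold iteration from 0. It is a finite sum of \<open>word_op\<close>
  terms and is exact at words of length at most m.\<close>

primrec truncated_state ::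
    "('h \<times> 'k \<Rightarrow> ('n::finite, 'h) ell2 \<times> 'k) \<Rightarrow> nat \<Rightarrow> ('n, 'k::chilbert) fock \<Rightarrow> ('n, 'h::chilbert) fock"
where
  "truncated_state U 0 u = 0"
| "truncated_state U (Suc m) u =
    (\<Sum>l\<in>UNIV. word_op [l] (\<lambda>x. coord (fst (U (x, 0))) l) (truncated_state U m u)
      + word_op [l] (\<lambda>k. coord (fst (U (0, k))) l) u)"

definition truncated_transfer_op ::
    "('h::chilbert \<times> 'k \<Rightarrow> ('n::finite, 'h) ell2 \<times> 'k) \<Rightarrow> nat \<Rightarrow> ('n, 'k::chilbert) fock \<Rightarrow> ('n, 'k) fock"
  where "truncated_transfer_op U m u =
    word_op [] (\<lambda>x. snd (U (x, 0))) (truncated_state U m u) + word_op [] (\<lambda>k. snd (U (0, k))) u"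

context
  fixes U :: "'h::chilbert \<times> 'k::chilbert \<Rightarrow> ('n::finite, 'h) ell2 \<times> 'k"
  assumes U: "bounded_clinear U" and contraction: "\<And>x. norm (U x) \<le> norm x"
begin

lemma state_at_add: "state_at U (\<lambda>v. u v + u' v) w = state_at U u w + state_at U u' w"
proof (induction w)
  case (Cons l v)
  have "U (state_at U u v + state_at U u' v, u v + u' v) = U (state_at U u v, u v) + U (state_at U u' v, u' v)"
    by (simp add: bounded_clinear_add [OF U, symmetric])
  then show ?case
    by (simp add: Cons plus_ell2.rep_eq)
qed simp

lemma state_at_scaleC: "state_at U (\<lambda>v. c *\<^sub>C u v) w = c *\<^sub>C state_at U u w"
proof (induction w)
  case (Cons l v)
  have "U (c *\<^sub>C state_at U u v, c *\<^sub>C u v) = c *\<^sub>C U (state_at U u v, u v)"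
    using bounded_clinear_scaleC [OF U, of c "(state_at U u v, u v)"] by (simp add: scaleC_prod_def)
  then show ?case
    by (simp add: Cons scaleC_ell2.rep_eq scaleC_prod_def)
qed simp

lemma response_add: "response U (\<lambda>v. u v + u' v) w = response U u w + response U u' w"
proof -
  have "U (state_at U u w + state_at U u' w, u w + u' w) = U (state_at U u w, u w) + U (state_at U u' w, u' w)"
    by (simp add: bounded_clinear_add [OF U, symmetric])
  then show ?thesis
    by (simp add: response_def state_at_add)
qed

lemma response_scaleC: "response U (\<lambda>v. c *\<^sub>C u v) w = c *\<^sub>C response U u w"
proof -
  have "U (c *\<^sub>C state_at U u w, c *\<^sub>C u w) = c *\<^sub>C U (state_at U u w, u w)"
    using bounded_clinear_scaleC [OF U, of c "(state_at U u w, u w)"] by (simp add: scaleC_prod_def)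
  then show ?thesis
    by (simp add: response_def state_at_scaleC scaleC_prod_def)
qed

lemma energy_balance:
  "(\<Sum>l\<in>UNIV. (norm (state_at U u (l # v)))\<^sup>2) + (norm (response U u v))\<^sup>2
    \<le> (norm (state_at U u v))\<^sup>2 + (norm (u v))\<^sup>2"
proof -
  let ?y = "U (state_at U u v, u v)"
  have "(\<Sum>l\<in>UNIV. (norm (state_at U u (l # v)))\<^sup>2) + (norm (response U u v))\<^sup>2 = (norm ?y)\<^sup>2"
    by (simp add: norm_prod_sq [of ?y] norm_ell2_finite_sq response_def)
  also have "\<dots> \<le> (norm (state_at U u v, u v))\<^sup>2"
    by (intro power_mono contraction) simp
  finally show ?thesis
    by (simp add: norm_prod_sq)
qed

text \<open>\<open>energy_balance\<close> summed over each level telescopes from the zero initial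
  state. The state energy of level m + 1 is kept because it later controls the increments of the
  partial sums of the evaluation.\<close>

lemma energy_sum:
  "(\<Sum>w | length w = Suc m. (norm (state_at U u w))\<^sup>2) + (\<Sum>w | length w \<le> m. (norm (response U u w))\<^sup>2)
    \<le> (\<Sum>w | length w \<le> m. (norm (u w))\<^sup>2)"
proof -
  have level: "(\<Sum>w | length w = Suc d. (norm (state_at U u w))\<^sup>2) + (\<Sum>w | length w = d. (norm (response U u w))\<^sup>2)
      \<le> (\<Sum>w | length w = d. (norm (state_at U u w))\<^sup>2) + (\<Sum>w | length w = d. (norm (u w))\<^sup>2)" for d
    unfolding sum_words_Suc
    by (subst sum.swap) (simp only: sum.distrib [symmetric] sum_mono energy_balance)
  show ?thesis
  proof (induction m)
    case 0
    show ?case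
      using level [of 0] by simp
  next
    case (Suc m)
    then show ?case
      using level [of "Suc m"] unfolding sum_words_le_Suc by linarith
  qed
qed

lemma sum_response_le:
  assumes "finite F" shows "(\<Sum>w\<in>F. (norm (response U (coord u) w))\<^sup>2) \<le> (norm u)\<^sup>2"
proof -
  obtain m where m: "F \<subseteq> {w. length w \<le> m}"
    using finite_words_bounded [OF assms] by blast
  have "(\<Sum>w\<in>F. (norm (response U (coord u) w))\<^sup>2) \<le> (\<Sum>w | length w \<le> m. (norm (response U (coord u) w))\<^sup>2)"
    by (rule sum_mono2) (use m finite_words_length_le in auto)
  also have "\<dots> \<le> (\<Sum>w | length w \<le> m. (norm (coord u w))\<^sup>2)"
    using energy_sum [of "coord u" m]
      sum_nonneg [of "{w. length w = Suc m}" "\<lambda>w. (norm (state_at U (coord u) w))\<^sup>2"] by simp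
  also have "\<dots> \<le> (norm u)\<^sup>2"
    by (rule sum_norm_coord_le [OF finite_words_length_le])
  finally show ?thesis .
qed

lemma coord_transfer_op: "coord (transfer_op U u) = response U (coord u)"
  unfolding transfer_op_def by (rule coord_Abs_ell2, rule sq_summable_if_bounded, rule sum_response_le)

lemma norm_transfer_op_le: "norm (transfer_op U u) \<le> norm u"
  by (rule norm_ell2_le) (simp_all add: coord_transfer_op sum_response_le)

lemma bounded_clinear_transfer_op: "bounded_clinear (transfer_op U)"
proof (rule bounded_clinearI [where K = 1])
  show "transfer_op U (x + y) = transfer_op U x + transfer_op U y" for x y
    by (rule ell2_eqI) (simp add: coord_transfer_op plus_ell2.rep_eq response_add)
  show "transfer_op U (c *\<^sub>C x) = c *\<^sub>C transfer_op U x" for c x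
    by (rule ell2_eqI) (simp add: coord_transfer_op scaleC_ell2.rep_eq response_scaleC)
qed (simp add: norm_transfer_op_le)

section \<open>Truncation of the memory\<close>

lemma bounded_clinear_components:
  "bounded_clinear (\<lambda>x. coord (fst (U (x, 0))) l)" "bounded_clinear (\<lambda>k. coord (fst (U (0, k))) l)"
  "bounded_clinear (\<lambda>x. snd (U (x, 0)))" "bounded_clinear (\<lambda>k. snd (U (0, k)))"
proof -
  note inl = bounded_clinear_Pair [OF bounded_clinear_ident bounded_clinear_const_zero]
    and inr = bounded_clinear_Pair [OF bounded_clinear_const_zero bounded_clinear_ident]
  note Ul = bounded_clinear_compose [OF U inl] and Ur = bounded_clinear_compose [OF U inr]
  show "bounded_clinear (\<lambda>x. coord (fst (U (x, 0))) l)"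
    by (rule bounded_clinear_compose [OF bounded_clinear_coord bounded_clinear_compose [OF bounded_clinear_fst Ul]])
  show "bounded_clinear (\<lambda>k. coord (fst (U (0, k))) l)"
    by (rule bounded_clinear_compose [OF bounded_clinear_coord bounded_clinear_compose [OF bounded_clinear_fst Ur]])
  show "bounded_clinear (\<lambda>x. snd (U (x, 0)))"
    by (rule bounded_clinear_compose [OF bounded_clinear_snd Ul])
  show "bounded_clinear (\<lambda>k. snd (U (0, k)))"
    by (rule bounded_clinear_compose [OF bounded_clinear_snd Ur])
qed

lemma split_input: "U (x, k) = U (x, 0) + U (0, k)"
  by (simp add: bounded_clinear_add [OF U, symmetric])

lemma coord_truncated_state_Nil: "coord (truncated_state U m u) [] = 0"
  by (cases m) (simp_all add: zero_ell2.rep_eq coord_sum plus_ell2.rep_eq coord_word_op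
      bounded_clinear_components)

lemma coord_truncated_state_Cons:
  "coord (truncated_state U (Suc m) u) (l # v)
    = coord (fst (U (coord (truncated_state U m u) v, coord u v))) l"
  by (simp add: coord_sum plus_ell2.rep_eq coord_word_op bounded_clinear_components
      split_input [of "coord (truncated_state U m u) v" "coord u v"] sum.distrib)

lemma coord_truncated_transfer_op:
  "coord (truncated_transfer_op U m u) w = snd (U (coord (truncated_state U m u) w, coord u w))"
  by (simp add: truncated_transfer_op_def plus_ell2.rep_eq coord_word_op bounded_clinear_components
      split_input [of "coord (truncated_state U m u) w" "coord u w"])

lemma truncated_state_eq: "length w \<le> m \<Longrightarrow> coord (truncated_state U m u) w = state_at U (coord u) w"
proof (induction w arbitrary: m)
  case (Cons l v)
  then obtain m' where "m = Suc m'" "length v \<le> m'"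
    by (cases m) auto
  then show ?case
    using Cons by (simp add: coord_truncated_state_Cons del: truncated_state.simps)
qed (simp add: coord_truncated_state_Nil)

text \<open>The squared norms obey s (m + 1) \<le> r^2 (s m + |u|^2), whose fixed point is the
  stated bound. It is uniform in m but blows up as r tends to 1, which is the reason for
  damping.\<close>

lemma norm_truncated_state_le:
  assumes r: "\<And>x. norm (fst (U x)) \<le> r * norm x" "0 \<le> r" "r < 1"
  shows "(norm (truncated_state U m u))\<^sup>2 \<le> r\<^sup>2 / (1 - r\<^sup>2) * (norm u)\<^sup>2"
proof (induction m)
  case 0
  have "r\<^sup>2 < 1"
    using r by (simp add: power_less_one_iff)
  then show ?case
    by simp
next
  case (Suc m)
  let ?s = "truncated_state U m u"
  have r1: "r\<^sup>2 < 1"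
    using r by (simp add: power_less_one_iff)
  have "norm (truncated_state U (Suc m) u) \<le> sqrt (r\<^sup>2 * ((norm ?s)\<^sup>2 + (norm u)\<^sup>2))"
  proof (rule norm_ell2_le)
    fix F :: "'n list set"
    assume F: "finite F"
    let ?t = "\<lambda>w. (norm (coord (truncated_state U (Suc m) u) w))\<^sup>2"
    \<comment> \<open>F is enlarged to the empty word and all one-letter extensions of its tails, so
      that the sum over l reassembles the norm of the state output of U.\<close>
    have "sum ?t F \<le> sum ?t (insert [] ((\<lambda>(l, v). l # v) ` (UNIV \<times> tl ` F)))"
    proof (rule sum_mono2)
      show "F \<subseteq> insert [] ((\<lambda>(l, v). l # v) ` (UNIV \<times> tl ` F))"
      proof
        fix w assume "w \<in> F"
        then show "w \<in> insert [] ((\<lambda>(l, v). l # v) ` (UNIV \<times> tl ` F))"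
          by (cases w) (force intro: rev_image_eqI)+
      qed
    qed (use F in auto)
    also have "\<dots> = sum ?t ((\<lambda>(l, v). l # v) ` (UNIV \<times> tl ` F))"
      using F by (subst sum.insert) (auto simp: coord_truncated_state_Nil simp del: truncated_state.simps)
    also have "\<dots> = (\<Sum>(l, v)\<in>UNIV \<times> tl ` F. ?t (l # v))"
      by (subst sum.reindex) (auto simp: inj_on_def o_def case_prod_unfold simp del: truncated_state.simps)
    also have "\<dots> = (\<Sum>v\<in>tl ` F. \<Sum>l\<in>UNIV. ?t (l # v))"
      by (subst sum.swap) (simp only: sum.cartesian_product)
    also have "\<dots> = (\<Sum>v\<in>tl ` F. (norm (fst (U (coord ?s v, coord u v))))\<^sup>2)"
      by (simp add: coord_truncated_state_Cons norm_ell2_finite_sq del: truncated_state.simps)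
    also have "\<dots> \<le> (\<Sum>v\<in>tl ` F. r\<^sup>2 * ((norm (coord ?s v))\<^sup>2 + (norm (coord u v))\<^sup>2))"
    proof (rule sum_mono)
      fix v
      have "(norm (fst (U (coord ?s v, coord u v))))\<^sup>2 \<le> (r * norm (coord ?s v, coord u v))\<^sup>2"
        by (intro power_mono r) simp
      then show "(norm (fst (U (coord ?s v, coord u v))))\<^sup>2 \<le> r\<^sup>2 * ((norm (coord ?s v))\<^sup>2 + (norm (coord u v))\<^sup>2)"
        by (simp add: power_mult_distrib norm_prod_sq)
    qed
    also have "\<dots> = r\<^sup>2 * ((\<Sum>v\<in>tl ` F. (norm (coord ?s v))\<^sup>2) + (\<Sum>v\<in>tl ` F. (norm (coord u v))\<^sup>2))"
      by (simp add: sum_distrib_left [symmetric] sum.distrib)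
    also have "\<dots> \<le> r\<^sup>2 * ((norm ?s)\<^sup>2 + (norm u)\<^sup>2)"
      using F by (intro mult_left_mono add_mono sum_norm_coord_le) auto
    finally show "sum ?t F \<le> (sqrt (r\<^sup>2 * ((norm ?s)\<^sup>2 + (norm u)\<^sup>2)))\<^sup>2"
      by (simp add: real_sqrt_pow2)
  qed simp
  then have "(norm (truncated_state U (Suc m) u))\<^sup>2 \<le> (sqrt (r\<^sup>2 * ((norm ?s)\<^sup>2 + (norm u)\<^sup>2)))\<^sup>2"
    by (rule power_mono) simp
  then have "(norm (truncated_state U (Suc m) u))\<^sup>2 \<le> r\<^sup>2 * ((norm ?s)\<^sup>2 + (norm u)\<^sup>2)"
    by (simp only: real_sqrt_pow2 mult_nonneg_nonneg zero_le_power2 add_nonneg_nonneg)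
  also have "\<dots> \<le> r\<^sup>2 * (r\<^sup>2 / (1 - r\<^sup>2) * (norm u)\<^sup>2 + (norm u)\<^sup>2)"
    by (intro mult_left_mono add_right_mono Suc) simp
  also have "\<dots> = r\<^sup>2 / (1 - r\<^sup>2) * (norm u)\<^sup>2"
    using r1 by (simp add: field_simps)
  finally show ?case .
qed

lemma truncated_transfer_op_bounded:
  assumes r: "\<And>x. norm (fst (U x)) \<le> r * norm x" "0 \<le> r" "r < 1"
  obtains C where "\<And>m u. norm (truncated_transfer_op U m u) \<le> C * norm u"
proof
  fix m u
  have "norm (truncated_state U m u) \<le> sqrt (r\<^sup>2 / (1 - r\<^sup>2)) * norm u"
    using real_sqrt_le_mono [OF norm_truncated_state_le [OF r, of m u]]
    by (simp add: real_sqrt_mult real_sqrt_divide)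
  moreover have "norm (snd (U (x, 0))) \<le> norm x" for x
    using order_trans [OF norm_snd_le contraction, of "(x, 0)"] by simp
  moreover have "norm (snd (U (0, k))) \<le> norm k" for k
    using order_trans [OF norm_snd_le contraction, of "(0, k)"] by simp
  ultimately show "norm (truncated_transfer_op U m u) \<le> (sqrt (r\<^sup>2 / (1 - r\<^sup>2)) + 1) * norm u"
    using norm_word_op_le [OF bounded_clinear_components(3), of "[]" "truncated_state U m u"]
      norm_word_op_le [OF bounded_clinear_components(4), of "[]" u]
      norm_triangle_ineq [of "word_op [] (\<lambda>x. snd (U (x, 0))) (truncated_state U m u)"
        "word_op [] (\<lambda>k. snd (U (0, k))) u"]
    unfolding truncated_transfer_op_def by (simp add: distrib_right)
qed

lemma truncated_transfer_op_mem:
  assumes B: "operator_space \<B>" and mem: "\<And>\<alpha> X. bounded_clinear X \<Longrightarrow> word_op \<alpha> X \<in> \<B>"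
  shows "truncated_transfer_op U m \<in> \<B>"
proof -
  have add: "(\<lambda>u. S u + T u) \<in> \<B>" if "S \<in> \<B>" "T \<in> \<B>" for S T
    using B that by (simp add: operator_space_def)
  \<comment> \<open>The truncated state has values in the state space, so it becomes an operator on
    the right Fock space only after a map \<beta> into the output space. Each unfolding appends a
    letter to \<alpha> and composes \<beta>, hence both are arbitrary in the induction.\<close>
  have word: "(\<lambda>u. word_op \<alpha> \<beta> (truncated_state U m u)) \<in> \<B>" if \<beta>: "bounded_clinear \<beta>"
    for \<alpha> and \<beta> :: "'h \<Rightarrow> 'k"
    using \<beta>
  proof (induction m arbitrary: \<alpha> \<beta>)
    case 0
    then show ?case
      using B by (simp add: bounded_clinear_zero [OF bounded_clinear_word_op] operator_space_def)
  next
    case (Suc m)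
    note W = bounded_clinear_word_op [OF Suc.prems]
    have "(\<lambda>u. word_op \<alpha> \<beta> (truncated_state U (Suc m) u))
      = (\<lambda>u. \<Sum>l\<in>UNIV. word_op (\<alpha> @ [l]) (\<lambda>x. \<beta> (coord (fst (U (x, 0))) l)) (truncated_state U m u)
          + word_op (\<alpha> @ [l]) (\<lambda>k. \<beta> (coord (fst (U (0, k))) l)) u)"
      by (simp add: bounded_clinear_sum [OF W] bounded_clinear_add [OF W]
          word_op_compose [OF Suc.prems] bounded_clinear_components)
    also have "\<dots> \<in> \<B>"
      by (intro operator_space_sum [OF B] add mem Suc.IH
          bounded_clinear_compose [OF Suc.prems] bounded_clinear_components)
    finally show ?case .
  qed
  show ?thesis
    unfolding truncated_transfer_op_def [abs_def]
    by (intro add mem word bounded_clinear_components)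
qed

lemma transfer_op_mem_if_strict:
  assumes r: "\<And>x. norm (fst (U x)) \<le> r * norm x" "0 \<le> r" "r < 1"
    and B: "operator_space \<B>" "closedin wot \<B>"
    and mem: "\<And>\<alpha> X. bounded_clinear X \<Longrightarrow> word_op \<alpha> X \<in> \<B>"
  shows "transfer_op U \<in> \<B>"
proof -
  obtain C where C: "\<And>m u. norm (truncated_transfer_op U m u) \<le> C * norm u"
    using truncated_transfer_op_bounded [OF r] by blast
  show ?thesis
  proof (rule closedin_wot_coordwise [OF B(2) truncated_transfer_op_mem [OF B(1) mem]
        bounded_clinear_transfer_op C])
    fix u w
    \<comment> \<open>Truncation is exact at w from m = length w on, so each coordinate is
      eventually constant.\<close>
    have "\<forall>\<^sub>F m in sequentially. coord (truncated_transfer_op U m u) w = coord (transfer_op U u) w"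
      unfolding eventually_sequentially coord_truncated_transfer_op coord_transfer_op response_def
      using truncated_state_eq [of w] by (intro exI [of _ "length w"]) simp
    then show "(\<lambda>m. coord (truncated_transfer_op U m u) w) \<longlonglongrightarrow> coord (transfer_op U u) w"
      by (rule tendsto_eventually)
  qed
qed

end

text \<open>Only the state output is scaled: for 0 \<le> r \<le> 1 a contraction stays a
  contraction, while its state part gets norm at most r.\<close>

definition damp :: "real \<Rightarrow> ('h \<times> 'k \<Rightarrow> ('n, 'h::chilbert) ell2 \<times> 'k) \<Rightarrow> 'h \<times> 'k \<Rightarrow> ('n, 'h) ell2 \<times> 'k"
  where "damp r U x = (r *\<^sub>R fst (U x), snd (U x))"

lemma fst_damp [simp]: "fst (damp r U x) = r *\<^sub>R fst (U x)"
  and snd_damp [simp]: "snd (damp r U x) = snd (U x)"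
  by (simp_all add: damp_def)

lemma tendsto_coord: "(f \<longlongrightarrow> a) F \<Longrightarrow> ((\<lambda>x. coord (f x) i) \<longlongrightarrow> coord a i) F"
  by (rule bounded_linear.tendsto [OF bounded_clinear_linear [OF bounded_clinear_coord]])

text \<open>The arbitrary \<open>\<B>\<close> covers both the hull over the Fock algebra and a
  preimage under compression. The damped operators are uniformly contractive, so convergence of each
  coordinate suffices.\<close>

lemma transfer_op_mem:
  fixes U :: "'h::chilbert \<times> 'k::chilbert \<Rightarrow> ('n::finite, 'h) ell2 \<times> 'k"
  assumes U: "bounded_clinear U" and contraction: "\<And>x. norm (U x) \<le> norm x"
    and B: "operator_space \<B>" "closedin wot \<B>"
    and mem: "\<And>\<alpha> X. bounded_clinear X \<Longrightarrow> word_op \<alpha> X \<in> \<B>"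
  shows "transfer_op U \<in> \<B>"
proof -
  define r where "r m = real m / real (Suc m)" for m
  have r: "0 \<le> r m" "r m < 1" for m
    by (simp_all add: r_def)
  have rlim: "r \<longlonglongrightarrow> 1"
    unfolding r_def by (rule LIMSEQ_n_over_Suc_n)
  have bc: "bounded_clinear (damp (r m) U)" for m
    unfolding damp_def [abs_def] scaleR_scaleC
    by (rule bounded_clinear_Pair [OF bounded_clinear_scale [OF bounded_clinear_compose [OF bounded_clinear_fst U]]
          bounded_clinear_compose [OF bounded_clinear_snd U]])
  have le: "norm (damp (r m) U x) \<le> norm x" for m x
  proof -
    have "(norm (damp (r m) U x))\<^sup>2 \<le> (norm (U x))\<^sup>2"
      using r [of m] unfolding norm_prod_sq
      by (simp add: power_mult_distrib mult_left_le_one_le power_le_one)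
    then have "norm (damp (r m) U x) \<le> norm (U x)"
      by (simp add: power2_le_iff_abs_le)
    then show ?thesis
      using contraction [of x] by linarith
  qed
  have strict: "norm (fst (damp (r m) U x)) \<le> r m * norm x" for m x
    using r [of m] order_trans [OF norm_fst_le contraction, of x]
    by (simp add: mult_left_mono)
  show ?thesis
  proof (rule closedin_wot_coordwise [OF B(2), where S = "\<lambda>m. transfer_op (damp (r m) U)" and C = 1])
    show "transfer_op (damp (r m) U) \<in> \<B>" for m
      by (rule transfer_op_mem_if_strict [OF bc le strict r B mem])
    show "bounded_clinear (transfer_op U)"
      by (rule bounded_clinear_transfer_op [OF U contraction])
    show "norm (transfer_op (damp (r m) U) u) \<le> 1 * norm u" for m u
      using norm_transfer_op_le [OF bc le] by simp
    fix u :: "('n, 'k) fock" and w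
    have Ulim: "(\<lambda>m. U (f m, k)) \<longlonglongrightarrow> U (a, k)" if "f \<longlonglongrightarrow> a" for f a k
      by (intro bounded_linear.tendsto [OF bounded_clinear_linear [OF U]] tendsto_Pair that tendsto_const)
    have st: "(\<lambda>m. state_at (damp (r m) U) (coord u) w) \<longlonglongrightarrow> state_at U (coord u) w" for w
    proof (induction w)
      case (Cons l v)
      have "(\<lambda>m. coord (r m *\<^sub>R fst (U (state_at (damp (r m) U) (coord u) v, coord u v))) l)
          \<longlonglongrightarrow> coord (1 *\<^sub>R fst (U (state_at U (coord u) v, coord u v))) l"
        by (intro tendsto_coord tendsto_scaleR rlim tendsto_fst Ulim Cons)
      then show ?case
        by simp
    qed simp
    show "(\<lambda>m. coord (transfer_op (damp (r m) U) u) w) \<longlonglongrightarrow> coord (transfer_op U u) w"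
      unfolding coord_transfer_op [OF bc le] coord_transfer_op [OF U contraction] response_def
      unfolding snd_damp by (intro tendsto_snd Ulim st)
  qed
qed

section \<open>Sufficiency\<close>

text \<open>Splitting off the first letter matches the recursion of the state, whereas
  \<open>sum_words_le_Suc\<close> splits off the longest words and gives the increments of partial
  sums.\<close>

lemma sum_words_le_Cons:
  "(\<Sum>w | length w \<le> Suc m. f w) = f [] + (\<Sum>l\<in>UNIV. \<Sum>v | length v \<le> m. f (l # v))"
  for f :: "'n::finite list \<Rightarrow> 'a::comm_monoid_add"
proof -
  have "(\<Sum>w | length w \<le> Suc m. f w) = f [] + (\<Sum>d\<le>m. \<Sum>l\<in>UNIV. \<Sum>v | length v = d. f (l # v))"
    by (simp add: sum_words_le sum.atMost_Suc_shift sum_words_Suc del: sum.atMost_Suc)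
  then show ?thesis
    by (subst (asm) sum.swap) (simp add: sum_words_le)
qed

text \<open>The partial sums \<open>a m\<close> of \<open>\<Sum>\<^sub>w z\<^sub>w x(w)\<close>, \<open>x\<close> the state, satisfy
  \<open>U (a m, h) = ((\<dots>)\<^sub>l, y m)\<close> with \<open>y m\<close> the partial sums of the evaluation; here
  \<open>a (m + 1) - a m \<longlongrightarrow> 0\<close> although \<open>a\<close> itself is not shown to converge.\<close>

lemma cinner_operator_eval_transfer_op:
  fixes U :: "'h::chilbert \<times> 'k::chilbert \<Rightarrow> ('n::finite, 'h) ell2 \<times> 'k"
  assumes U: "bounded_clinear U" and contraction: "\<And>x. norm (U x) \<le> norm x"
    and z: "norm z < 1"
    and adj: "\<And>x. cinner (U x) (\<Sum>l\<in>UNIV. basis_vec l \<otimes>\<^sub>v (cnj (z $ l) *\<^sub>C \<gamma>), k) = cinner x (\<gamma>, k')"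
  shows "cinner (operator_eval (transfer_op U) z h) k = cinner h k'"
proof -
  define u where "u = coord (basis_vec [] \<otimes>\<^sub>v h :: ('n, 'k) fock)"
  define s where "s w = word_eval z w *\<^sub>C state_at U u w" for w
  define a where "a m = (\<Sum>w | length w \<le> m. s w)" for m
  define y where "y m = (\<Sum>w | length w \<le> m. word_eval z w *\<^sub>C response U u w)" for m
  have "((\<lambda>w. word_eval z w *\<^sub>C response U u w) has_sum operator_eval (transfer_op U) z h) UNIV"
    using has_sum_operator_eval [OF z, of "transfer_op U" h]
    by (simp add: fourier_coeff_def coord_transfer_op [OF U contraction] u_def)
  then have ylim: "y \<longlonglongrightarrow> operator_eval (transfer_op U) z h"
    unfolding y_def by (rule has_sum_words_LIMSEQ)
  \<comment> \<open>The input is h at the empty word and 0 elsewhere, so its partial sums equal h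
    from m = 0 on.\<close>
  have hsum: "(\<Sum>w | length w \<le> m. word_eval z w *\<^sub>C u w) = h" for m
  proof -
    have "(\<Sum>w | length w \<le> m. word_eval z w *\<^sub>C u w) = (\<Sum>w | length (w :: 'n list) \<le> m. if w = [] then h else 0)"
      by (rule sum.cong) (auto simp: u_def coord_basis_tensor)
    then show ?thesis
      by (simp add: sum.delta finite_words_length_le)
  qed
  have Ua: "U (a m, h) = (\<Sum>w | length w \<le> m. word_eval z w *\<^sub>C U (state_at U u w, u w))" for m
  proof -
    have "(a m, h) = (\<Sum>w | length w \<le> m. word_eval z w *\<^sub>C (state_at U u w, u w))"
      by (rule prod_eqI) (simp_all add: a_def s_def fst_sum snd_sum scaleC_prod_def hsum)
    then show ?thesis
      by (simp add: bounded_clinear_sum [OF U] bounded_clinear_scaleC [OF U])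
  qed
  have snd_Ua: "snd (U (a m, h)) = y m" for m
    by (simp add: Ua y_def snd_sum scaleC_prod_def response_def)
  \<comment> \<open>Prefixing a letter shifts the length bound by one; nothing is lost, since the
    state at the empty word is 0.\<close>
  have fst_Ua: "(\<Sum>l\<in>UNIV. z $ l *\<^sub>C coord (fst (U (a m, h))) l) = a (Suc m)" for m
  proof -
    have "a (Suc m) = (\<Sum>l\<in>UNIV. \<Sum>v | length v \<le> m. s (l # v))"
      unfolding a_def sum_words_le_Cons by (simp add: s_def)
    then show ?thesis
      by (simp add: Ua fst_sum scaleC_prod_def coord_sum scaleC_ell2.rep_eq s_def scaleC_sum_right
          scaleC_scaleC)
  qed
  \<comment> \<open>This is \<open>adj\<close> tested at (a m, h): \<gamma> is paired only with an
    increment of \<open>a\<close>.\<close>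
  have bal: "cinner (y m) k = cinner h k' + cinner (a m - a (Suc m)) \<gamma>" for m
  proof -
    have "cinner (U (a m, h)) (\<Sum>l\<in>UNIV. basis_vec l \<otimes>\<^sub>v (cnj (z $ l) *\<^sub>C \<gamma>), k)
        = (\<Sum>l\<in>UNIV. cinner (z $ l *\<^sub>C coord (fst (U (a m, h))) l) \<gamma>) + cinner (y m) k"
      by (simp add: cinner_prod_def snd_Ua cinner_sum_right cinner_basis_tensor_right
          cinner_scaleC_left cinner_scaleC_right)
    then have "cinner (a (Suc m)) \<gamma> + cinner (y m) k = cinner (a m) \<gamma> + cinner h k'"
      by (simp add: adj cinner_sum_left [symmetric] fst_Ua) (simp add: cinner_prod_def)
    then show ?thesis
      by (simp add: cinner_diff_left algebra_simps)
  qed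
  \<comment> \<open>Cauchy-Schwarz on level m + 1: the evaluations have l2 norm |z|^(m + 1) and the
    states at most |h|, by \<open>energy_sum\<close>.\<close>
  have small: "norm (a m - a (Suc m)) \<le> norm z ^ Suc m * norm h" for m
  proof -
    have "norm (a m - a (Suc m)) = norm (\<Sum>w | length w = Suc m. s w)"
      unfolding a_def sum_words_le_Suc by simp
    also have "\<dots> \<le> (\<Sum>w | length w = Suc m. \<bar>cmod (word_eval z w)\<bar> * \<bar>norm (state_at U u w)\<bar>)"
      by (rule sum_norm_le) (simp add: s_def norm_scaleC)
    also have "\<dots> \<le> L2_set (\<lambda>w. cmod (word_eval z w)) {w. length w = Suc m}
        * L2_set (\<lambda>w. norm (state_at U u w)) {w. length w = Suc m}"
      by (rule L2_set_mult_ineq)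
    also have "\<dots> \<le> norm z ^ Suc m * norm h"
    proof (rule mult_mono)
      show "L2_set (\<lambda>w. cmod (word_eval z w)) {w. length w = Suc m} \<le> norm z ^ Suc m"
        unfolding L2_set_def sum_norm_word_eval by simp
      have "(\<Sum>w | length w = Suc m. (norm (state_at U u w))\<^sup>2) \<le> (\<Sum>w | length w \<le> m. (norm (u w))\<^sup>2)"
        using energy_sum [OF U contraction, of u m]
          sum_nonneg [of "{w. length w \<le> m}" "\<lambda>w. (norm (response U u w))\<^sup>2"] by simp
      also have "\<dots> \<le> (norm h)\<^sup>2"
        using sum_norm_coord_le [OF finite_words_length_le, of "basis_vec [] \<otimes>\<^sub>v h" m]
        by (simp add: u_def norm_simple_tensor norm_basis_vec)
      finally show "L2_set (\<lambda>w. norm (state_at U u w)) {w. length w = Suc m} \<le> norm h"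
        unfolding L2_set_def by (simp add: real_le_lsqrt)
    qed (simp_all add: L2_set_nonneg)
    finally show ?thesis .
  qed
  have "(\<lambda>m. norm z ^ Suc m * norm h) \<longlonglongrightarrow> 0 * norm h"
    by (intro tendsto_intros LIMSEQ_Suc LIMSEQ_power_zero) (use z in simp)
  then have "(\<lambda>m. norm z ^ Suc m * norm h) \<longlonglongrightarrow> 0"
    by simp
  then have "(\<lambda>m. a m - a (Suc m)) \<longlonglongrightarrow> 0"
    by (rule Lim_null_comparison [rotated]) (simp only: small eventually_True)
  then have "(\<lambda>m. cinner h k' + cinner (a m - a (Suc m)) \<gamma>) \<longlonglongrightarrow> cinner h k' + cinner 0 \<gamma>"
    by (intro tendsto_add tendsto_const bounded_linear.tendsto [OF bounded_linear_cinner_left])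
  moreover have "(\<lambda>m. cinner (y m) k) \<longlonglongrightarrow> cinner (operator_eval (transfer_op U) z h) k"
    by (rule bounded_linear.tendsto [OF bounded_linear_cinner_left ylim])
  ultimately show ?thesis
    unfolding bal using LIMSEQ_unique by force
qed

lemma interpolating_colligation_exists:
  fixes z :: "nat \<Rightarrow> complex ^ 'n::finite" and A :: "nat \<Rightarrow> 'k::chilbert \<Rightarrow> 'k"
  assumes I: "finite I" and z: "\<And>j. j \<in> I \<Longrightarrow> norm (z j) < 1"
    and A: "\<And>j. j \<in> I \<Longrightarrow> bounded_clinear (A j)"
    and pos: "positive_operator_matrix I (pick_entry z A)"
  obtains U :: "(nat, 'k) ell2 \<times> 'k \<Rightarrow> ('n, (nat, 'k) ell2) ell2 \<times> 'k"
  where "bounded_clinear U" "\<And>x. norm (U x) \<le> norm x"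
    "\<And>j. j \<in> I \<Longrightarrow> operator_eval (transfer_op U) (z j) = A j"
proof -
  \<comment> \<open>The Pick matrix as a single operator on sequences, zero off I. Its square root
    acts on this sequence space, which becomes the state space of the system.\<close>
  define P :: "(nat, 'k) ell2 \<Rightarrow> (nat, 'k) ell2"
    where "P g = (\<Sum>i\<in>I. basis_vec i \<otimes>\<^sub>v (\<Sum>j\<in>I. pick_entry z A i j (coord g j)))" for g
  have bcP: "bounded_clinear P"
    unfolding P_def
    by (rule bounded_clinear_setsum, rule bounded_clinear_compose [OF bounded_clinear_simple_tensor],
        rule bounded_clinear_setsum, rule bounded_clinear_compose [OF bounded_clinear_pick_entry
          bounded_clinear_coord]) (rule A, assumption)+
  have cP: "cinner (P g) g' = (\<Sum>i\<in>I. cinner (\<Sum>j\<in>I. pick_entry z A i j (coord g j)) (coord g' i))" for g g'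
    by (simp add: P_def cinner_sum_left cinner_basis_tensor_left)
  have "cinner (P g) g \<in> \<real> \<and> 0 \<le> Re (cinner (P g) g)" for g
    using pos unfolding positive_operator_matrix_def Let_def cP by blast
  then obtain R :: "(nat, 'k) ell2 \<Rightarrow> (nat, 'k) ell2"
    where R: "bounded_clinear R" "\<And>x y. cinner (R x) (R y) = cinner (P x) y"
    using positive_sqrt_exists [OF bcP] by metis
  \<comment> \<open>Weights the j-th coordinate by \<open>c j\<close>. With the conjugates of
    \<open>z j $ l\<close> as weights and summed over l, the Pick form gains the factor <z_i,
    z_j>.\<close>
  define D :: "(nat \<Rightarrow> complex) \<Rightarrow> (nat, 'k) ell2 \<Rightarrow> (nat, 'k) ell2"
    where "D c g = (\<Sum>j\<in>I. basis_vec j \<otimes>\<^sub>v (c j *\<^sub>C coord g j))" for c g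
  have bcD: "bounded_clinear (D c)" for c
    unfolding D_def
    by (rule bounded_clinear_setsum, rule bounded_clinear_compose [OF bounded_clinear_simple_tensor],
        rule bounded_clinear_scale [OF bounded_clinear_coord])
  have coordD: "coord (D c g) i = (if i \<in> I then c i *\<^sub>C coord g i else 0)" for c g i
    using I by (simp add: D_def coord_sum coord_basis_tensor sum.delta)
  define t where "t g i j = cinner (coord g j) (coord g i)" for g :: "(nat, 'k) ell2" and i j
  define t' where "t' g i j = cinner (cadjoint (A j) (coord g j)) (cadjoint (A i) (coord g i))"
    for g i j
  define \<sigma> where "\<sigma> i j = cvec_inner (z i) (z j)" for i j
  have \<sigma>1: "\<sigma> i j \<noteq> 1" if "i \<in> I" "j \<in> I" for i j
    using norm_cvec_inner_less [OF z [OF that(1)] z [OF that(2)]] by (auto simp: \<sigma>_def)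
  have RD: "cinner (R (D c g)) (R (D c g))
      = (\<Sum>i\<in>I. \<Sum>j\<in>I. c j * cnj (c i) * ((t g i j - t' g i j) / (1 - \<sigma> i j)))" for c g
  proof -
    have "cinner (R (D c g)) (R (D c g))
        = (\<Sum>i\<in>I. \<Sum>j\<in>I. cinner (pick_entry z A i j (c j *\<^sub>C coord g j)) (c i *\<^sub>C coord g i))"
      by (simp add: R cP coordD cinner_sum_left)
    also have "\<dots> = (\<Sum>i\<in>I. \<Sum>j\<in>I. c j * cnj (c i) * ((t g i j - t' g i j) / (1 - \<sigma> i j)))"
      by (auto simp: bounded_clinear_scaleC [OF bounded_clinear_pick_entry] A cinner_pick_entry
          cinner_scaleC_left cinner_scaleC_right t_def t'_def \<sigma>_def intro!: sum.cong)
    finally show ?thesis .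
  qed
  \<comment> \<open>With G the Pick matrix, (1 - <z_i, z_j>) G_ij = I - A_i A_j^*. Accordingly |p
    g|^2 collects the terms <z_i, z_j> G_ij + I and |q g|^2 the terms G_ij + A_i A_j^*.\<close>
  define p where "p g = (\<Sum>l\<in>UNIV. basis_vec l \<otimes>\<^sub>v R (D (\<lambda>j. cnj (z j $ l)) g), \<Sum>j\<in>I. coord g j)" for g
  define q where "q g = (R (D (\<lambda>_. 1) g), \<Sum>j\<in>I. cadjoint (A j) (coord g j))" for g
  have bcp: "bounded_clinear p"
    unfolding p_def
    by (rule bounded_clinear_Pair; rule bounded_clinear_setsum)
      (rule bounded_clinear_compose [OF bounded_clinear_simple_tensor bounded_clinear_compose [OF R(1) bcD]],
       rule bounded_clinear_coord)
  have bcq: "bounded_clinear q"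
    unfolding q_def
    by (rule bounded_clinear_Pair [OF bounded_clinear_compose [OF R(1) bcD]]; rule bounded_clinear_setsum)
      (rule bounded_clinear_compose [OF bounded_clinear_cadjoint [OF A] bounded_clinear_coord])
  have "cinner (q g) (q g) = cinner (p g) (p g)" for g
  proof -
    have "coord (fst (p g)) l = R (D (\<lambda>j. cnj (z j $ l)) g)" for l
      by (simp add: p_def coord_sum coord_basis_tensor sum.delta)
    then have "cinner (p g) (p g) = (\<Sum>l\<in>UNIV. cinner (R (D (\<lambda>j. cnj (z j $ l)) g)) (R (D (\<lambda>j. cnj (z j $ l)) g)))
        + (\<Sum>i\<in>I. \<Sum>j\<in>I. t g i j)"
      by (simp add: cinner_prod_def cinner_ell2_def) (simp add: p_def t_def cinner_sum_left cinner_sum_right)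
    also have "(\<Sum>l\<in>UNIV. cinner (R (D (\<lambda>j. cnj (z j $ l)) g)) (R (D (\<lambda>j. cnj (z j $ l)) g)))
        = (\<Sum>i\<in>I. \<Sum>j\<in>I. \<sigma> i j * ((t g i j - t' g i j) / (1 - \<sigma> i j)))"
      unfolding RD \<sigma>_def cvec_inner_def sum_distrib_right
      by (subst sum.swap, rule sum.cong [OF refl], subst sum.swap) (simp add: mult_ac)
    also have "\<dots> + (\<Sum>i\<in>I. \<Sum>j\<in>I. t g i j)
        = (\<Sum>i\<in>I. \<Sum>j\<in>I. (t g i j - t' g i j) / (1 - \<sigma> i j)) + (\<Sum>i\<in>I. \<Sum>j\<in>I. t' g i j)"
      unfolding sum.distrib [symmetric]
    proof (intro sum.cong refl)
      fix i j assume "i \<in> I" "j \<in> I"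
      then have "1 - \<sigma> i j \<noteq> 0"
        using \<sigma>1 by simp
      then show "\<sigma> i j * ((t g i j - t' g i j) / (1 - \<sigma> i j)) + t g i j
          = (t g i j - t' g i j) / (1 - \<sigma> i j) + t' g i j"
        by (simp add: divide_simps) (simp add: algebra_simps)
    qed
    also have "\<dots> = cinner (q g) (q g)"
      by (simp add: q_def cinner_prod_def RD cinner_sum_left cinner_sum_right t'_def)
    finally show ?thesis
      by simp
  qed
  then have "(norm (q g))\<^sup>2 = (norm (p g))\<^sup>2" for g
    by (simp only: cinner_self of_real_eq_iff)
  then have le: "norm (q g) \<le> norm (p g)" for g
    by (simp add: power2_eq_iff_nonneg)
  obtain U where U: "bounded_clinear U" "\<And>x. norm (U x) \<le> norm x"
    and Uadj: "\<And>x g. cinner (U x) (p g) = cinner x (q g)"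
    using contraction_adjoint_exists [OF bcp bcq le] by blast
  have "operator_eval (transfer_op U) (z j) h = A j h" if j: "j \<in> I" for j h
  proof (rule cinner_left_ext)
    fix k
    \<comment> \<open>For a family concentrated at j, the adjoint relation of U becomes the
      hypothesis \<open>adj\<close> with \<gamma> = R g and k' the image of k under the adjoint of
      A_j.\<close>
    let ?g = "basis_vec j \<otimes>\<^sub>v k :: (nat, 'k) ell2"
    have Dg: "D c ?g = c j *\<^sub>C ?g" for c
      using j by (intro ell2_eqI) (auto simp: coordD coord_basis_tensor scaleC_ell2.rep_eq)
    have pg: "p ?g = (\<Sum>l\<in>UNIV. basis_vec l \<otimes>\<^sub>v (cnj (z j $ l) *\<^sub>C R ?g), k)"
      using I j by (simp add: p_def Dg bounded_clinear_scaleC [OF R(1)] coord_basis_tensor sum.delta)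
    have "(\<Sum>i\<in>I. cadjoint (A i) (coord ?g i)) = (\<Sum>i\<in>I. if i = j then cadjoint (A j) k else 0)"
      by (rule sum.cong) (auto simp: coord_basis_tensor bounded_clinear_zero [OF bounded_clinear_cadjoint [OF A]])
    then have qg: "q ?g = (R ?g, cadjoint (A j) k)"
      using I j by (simp add: q_def Dg)
    have "cinner (operator_eval (transfer_op U) (z j) h) k = cinner h (cadjoint (A j) k)"
      by (rule cinner_operator_eval_transfer_op [OF U z [OF j]]) (use Uadj [of _ ?g] pg qg in simp)
    then show "cinner (operator_eval (transfer_op U) (z j) h) k = cinner (A j h) k"
      by (simp add: cinner_cadjoint_right [OF A [OF j]])
  qed
  with U show thesis
    by (intro that) auto
qed

lemma transfer_op_in_tensor_BK:
  fixes U :: "'h::chilbert \<times> 'k::chilbert \<Rightarrow> ('n::finite, 'h) ell2 \<times> 'k"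
  assumes U: "bounded_clinear U" and contraction: "\<And>x. norm (U x) \<le> norm x"
  shows "transfer_op U \<in> tensor_BK fock_algebra"
  unfolding tensor_BK_def hull_def
proof (rule InterI, clarify)
  fix \<B> :: "(('n, 'k) fock \<Rightarrow> ('n, 'k) fock) set"
  assume B: "operator_space \<B>" "closedin wot \<B>"
    and gen: "{T. bounded_clinear T \<and> (\<exists>f\<in>fock_algebra. \<exists>X. bounded_clinear X \<and>
      (\<forall>g h. T (g \<otimes>\<^sub>v h) = f g \<otimes>\<^sub>v X h))} \<subseteq> \<B>"
  show "transfer_op U \<in> \<B>"
  proof (rule transfer_op_mem [OF U contraction B])
    fix \<alpha> and X :: "'k \<Rightarrow> 'k"
    assume X: "bounded_clinear X"
    show "word_op \<alpha> X \<in> \<B>"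
      by (rule subsetD [OF gen]) (use X word_op_in_fock_algebra in
        \<open>auto simp: bounded_clinear_word_op word_op_simple_tensor\<close>)
  qed
qed

text \<open>The operators whose compression lies in \<open>\<B>\<close> form a WOT-closed operator
  space, and it contains every S_\<alpha> \<otimes> X because these compress to B_\<alpha> \<otimes>
  X. Applying \<open>transfer_op_mem\<close> to this preimage keeps all limits on the full Fock
  space.\<close>

lemma compression_transfer_op_in_tensor_BK:
  fixes U :: "'h::chilbert \<times> 'k::chilbert \<Rightarrow> ('n::finite, 'h) ell2 \<times> 'k"
  assumes J: "two_sided_ideal J fock_algebra"
    and U: "bounded_clinear U" and contraction: "\<And>x. norm (U x) \<le> norm x"
  shows "compression (tensor_subspace (N_space J)) (transfer_op U) \<in> tensor_BK (constrained_algebra J)"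
  unfolding tensor_BK_def hull_def
proof (rule InterI, clarify)
  let ?M = "tensor_subspace (N_space J) :: ('n, 'k) fock set"
  note M = csubspace_tensor_subspace [of "N_space J"] closed_tensor_subspace [of "N_space J"]
  note N = csubspace_N_space [of J] closed_N_space [of J]
  fix \<B> :: "(('n, 'k) fock \<Rightarrow> ('n, 'k) fock) set"
  assume B: "operator_space \<B>" "closedin wot \<B>"
    and gen: "{T. bounded_clinear T \<and> (\<exists>f\<in>constrained_algebra J. \<exists>X. bounded_clinear X \<and>
      (\<forall>g h. T (g \<otimes>\<^sub>v h) = f g \<otimes>\<^sub>v X h))} \<subseteq> \<B>"
  let ?B = "{T. bounded_clinear T \<and> compression ?M T \<in> \<B>}"
  have P: "bounded_clinear (proj ?M)"
    by (rule bounded_clinear_proj [OF M])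
  have add: "compression ?M (\<lambda>x. S x + T x) = (\<lambda>x. compression ?M S x + compression ?M T x)" for S T
    by (simp add: compression_def fun_eq_iff bounded_clinear_add [OF P])
  have scale: "compression ?M (\<lambda>x. c *\<^sub>C T x) = (\<lambda>x. c *\<^sub>C compression ?M T x)" for c T
    by (simp add: compression_def fun_eq_iff bounded_clinear_scaleC [OF P])
  have zero: "compression ?M (\<lambda>_. 0) = (\<lambda>_. 0)"
    by (simp add: compression_def fun_eq_iff bounded_clinear_zero [OF P])
  have "transfer_op U \<in> ?B"
  proof (rule transfer_op_mem [OF U contraction])
    show "operator_space ?B"
      using B(1) unfolding operator_space_def
      by (auto simp: add scale zero bounded_clinear_const_zero bounded_clinear_plus bounded_clinear_scale)
    show "closedin wot ?B"
      using closedin_continuous_map_preimage [OF continuous_map_wot_compression [OF M] B(2)]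
      by (simp add: topspace_wot)
    fix \<alpha> and X :: "'k \<Rightarrow> 'k"
    assume X: "bounded_clinear X"
    have "compression ?M (word_op \<alpha> X) (g \<otimes>\<^sub>v h)
        = compression (N_space J) (word_op \<alpha> (\<lambda>x. x)) g \<otimes>\<^sub>v X h" for g h
      by (simp add: compression_def proj_tensor_subspace [OF N] word_op_simple_tensor [OF X])
    then show "word_op \<alpha> X \<in> ?B"
      using X compression_word_op_in_constrained_algebra [OF J, of \<alpha>]
        bounded_clinear_compression [OF M bounded_clinear_word_op [OF X]]
      by (auto simp: bounded_clinear_word_op intro!: subsetD [OF gen])
  qed
  then show "compression ?M (transfer_op U) \<in> \<B>"
    by simp
qed

theorem theorem5p3:
  fixes J :: "(('n::finite, complex) fock \<Rightarrow> ('n, complex) fock) set"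
    and z :: "nat \<Rightarrow> complex ^ 'n"
    and A :: "nat \<Rightarrow> 'k::chilbert \<Rightarrow> 'k"
    and k :: nat
  assumes "two_sided_ideal J fock_algebra"
    and "closedin wot J"
    and "inj_on z {1..k}"
    and "\<And>j. j \<in> {1..k} \<Longrightarrow> z j \<in> zero_set J"
    and "\<And>j. j \<in> {1..k} \<Longrightarrow> bounded_clinear (A j)"
  shows "(\<exists>\<Phi> \<in> tensor_BK fock_algebra.
            compression (tensor_subspace (N_space J)) \<Phi> \<in> tensor_BK (constrained_algebra J) \<and>
            onorm (compression (tensor_subspace (N_space J)) \<Phi>) \<le> 1 \<and>
            (\<forall>j\<in>{1..k}. operator_eval \<Phi> (z j) = A j))
         \<longleftrightarrow>
         positive_operator_matrix {1..k}
           (\<lambda>i j h. (1 / (1 - cvec_inner (z i) (z j))) *\<^sub>C (h - A i (cadjoint (A j) h)))"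
    (is "?L \<longleftrightarrow> ?R")
proof -
  have pick: "(\<lambda>i j h. (1 / (1 - cvec_inner (z i) (z j))) *\<^sub>C (h - A i (cadjoint (A j) h)))
      = pick_entry z A"
    by (simp add: fun_eq_iff pick_entry_def)
  show ?thesis
    unfolding pick
  proof
    assume ?L
    then show "positive_operator_matrix {1..k} (pick_entry z A)"
      using positive_operator_matrix_if_interpolant [of J "{1..k}" z A, OF assms(1,4,5)] by blast
  next
    assume pos: "positive_operator_matrix {1..k} (pick_entry z A)"
    have z: "norm (z j) < 1" if "j \<in> {1..k}" for j
      using assms(4) [OF that] by (simp add: zero_set_def)
    obtain U :: "(nat, 'k) ell2 \<times> 'k \<Rightarrow> ('n, (nat, 'k) ell2) ell2 \<times> 'k"
      where U: "bounded_clinear U" "\<And>x. norm (U x) \<le> norm x"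
        and ev: "\<And>j. j \<in> {1..k} \<Longrightarrow> operator_eval (transfer_op U) (z j) = A j"
      using interpolating_colligation_exists [OF finite_atLeastAtMost z assms(5) pos] by blast
    have "onorm (compression (tensor_subspace (N_space J)) (transfer_op U)) \<le> 1"
      by (rule onorm_bound) (simp_all add: norm_compression_le [OF csubspace_tensor_subspace
          closed_tensor_subspace norm_transfer_op_le [OF U]])
    then show ?L
      using transfer_op_in_tensor_BK [OF U] compression_transfer_op_in_tensor_BK [OF assms(1) U] ev
      by blast
  qed
qed

end
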